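(* Let $x,y,z$ be non-negative integers and let $\mathbf a=(a_1,\dots,a_m)$, $\mathbf b=(b_1,\dots,b_n)$ be sequences of non-negative integers. Put $\mu=2\lfloor\frac{m+1}{2}\rfloor$, $\mu'=2\lceil\frac{m-1}{2}\rceil$, $\nu=2\lfloor\frac{n+1}{2}\rfloor$, $\nu'=2\lceil\frac{n-1}{2}\rceil$, and $$\mathbf t^{+}=(0,a_1,\dots,a_{\mu-1},\,a_{\mu}+x+y+b_{\nu},\,b_{\nu-1},\dots,b_1),\qquad \mathbf t^{-}=(a_1,\dots,a_{\mu'},\,a_{\mu'+1}+x+y+b_{\nu'+1},\,b_{\nu'},\dots,b_1,z).$$ Then $$M(H^{(2)}_{x,y,z}(\mathbf a;\mathbf b))=\frac{M(H^{(2)}_{x+y,0,z}(\mathbf a;\mathbf b))\,M(H^{(2)}_{0,y,z}(\mathbf a;\mathbf b))}{M(H^{(2)}_{y,0,z}(\mathbf a;\mathbf b))}\cdot\frac{T(x+1,2a+b+2y+z-1,y)\,V(2x+2a+3,b+2y+z-2,y)}{T(1,2a+b+2y+z-1,y)\,V(2a+3,b+2y+z-2,y)}$$ $$=K(\mathbf t^{+})\,K(\mathbf t^{-})\cdot\frac{(2a-1)!!}{(2a+2y-1)!!}\cdot\frac{H_2(2o_a+2o_b)\,H_2(2e_a+2e_b+2z)}{H_2(2o_a+2o_b+2y)\,H_2(2e_a+2e_b+2y+2z)}\cdot\frac{H(2a+b+2y+z)\,H(b+y+z)}{H(2a+b+y+z)\,H(b+z)}$$ $$\cdot\frac{T(x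+1,2a+b+2y+z-1,y)\,V(2x+2a+3,b+2y+z-2,y)}{T(1,2a+b+2y+z-1,y)\,V(2a+3,b+2y+z-2,y)}.$$
   Context: Lattice and tilings. For real $u,k$ let $[u;k]$ be the point of the plane with Cartesian coordinates $(u,\frac{\sqrt3}{2}k)$. The triangular lattice has as vertices all $[u;k]$ with $k\in\mathbb Z$, $u-k/2\in\mathbb Z$; its faces are unit equilateral triangles, up-pointing or down-pointing. A region is a finite union of unit triangles. A lozenge is the union of two unit triangles sharing an edge; it is vertical if that edge is horizontal. A tiling of a region is a covering of it by lozenges contained in it, without gaps or overlaps. $M(R)$ is the number of tilings of $R$; $M(\emptyset)=1$. Sequences. $a=\sum a_i$, $b=\sum b_j$; $o_a,e_a$ are the sums of the $a_i$ with $i$ odd, resp. even; $o_b,e_b$ likewise. $a_i=0$ for $i>m$, $b_j=0$ for $j>n$; an empty sequence is treated as the one-term sequence $(0)$. Functions. $H(n)=\prod_{i=0}^{n-1}i!$; $H_2(n)=\prod_{i=1}^{\lfloor n/2\rfloor}(n-2i)!$; for $n\ge0$, $(x)_n=x(x+1)\cdots(x+n-1)$ and $[x]_n=x(x+2)\cdots(x+2n-2)$ (both $1$ for $n=0$); $T(x,n,m)=\prod_{i=0}^{m-1}(x+i)_{n-2i}$, $V(x,n,m)=\prod_{i=0}^{m-1}[x+2i]_{n-2i}$; $(2n+1)!!=1\cdot3\cdots(2n+1)$, $(-1)!!=1$. Empty products are $1$. Quartered hexagons. For a sequence $\mathbf t=(t_1,\dots,t_{2l})$ of non-negative integers let $s_k=t_1+\dots+t_k$,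 $o_t=\sum_{i\text{ odd}}t_i$, $e_t=\sum_{i\text{ even}}t_i$. If $e_t\ge1$, take the region bounded by the base from $[0;0]$ to $[o_t+e_t;0]$, the segment from $[o_t+e_t;0]$ to $[o_t+\frac12;2e_t-1]$, the north side from there to $[\frac12;2e_t-1]$, and the west zigzag through $[0;0],[\frac12;1],[0;2],[\frac12;3],\dots,[\frac12;2e_t-1]$; remove from it, for each $1\le i\le l$, the up-pointing triangle with base from $[s_{2i-1};0]$ to $[s_{2i};0]$. $K(\mathbf t)$ is the number of tilings of the resulting region; if $e_t=0$, $K(\mathbf t)=1$. The region $H^{(2)}_{x,y,z}(\mathbf a;\mathbf b)$. Let $L=x+y+a+b$, $A=2(y+o_a+o_b)-1$, $B=2(y+z+e_a+e_b)-1$, and let $\ell$ be the line $k=0$. Upper part (empty if $A=-1$): bounded by $\ell$ between $[0;0]$ and $[L;0]$, the segment from $[L;0]$ to $[L-\frac A2;A]$, the horizontal north side at height $k=A$, and the west zigzag through the points $[\alpha(k);k]$, $0\le k\le A$, with $\alpha(k)=0$ for $k$ even and $\frac12$ for $k$ odd. Lower part (empty if $B=-1$): bounded by $\ell$ between $[0;0]$ and $[L;0]$, the segments from $[L;0]$ to $[L+\frac z2;-z]$ and from there to $[L+z-\frac B2;-B]$, the horizontal south side at $k=-B$, and the west zigzag through $[\beta(k);-k]$, $0\le k\le B$, with $\beta(k)=0$ for $k$ even and $\frac12$ for $k$ odd. The region is the union of the two parts (lozenges may cross $\ell$) after removing: (i) from the upper part, everything at points $[u;k]$ with $u<a_1-k/2$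 (an up-pointing half triangle of side $2a_1$); (ii) for $2\le i\le m$, the triangle of side $a_i$ having a side on $\ell$ from $[a_1+\dots+a_{i-1};0]$ to $[a_1+\dots+a_i;0]$, down-pointing (below $\ell$) if $i$ is even, up-pointing (above $\ell$) if $i$ is odd; (iii) for $1\le j\le n$, the triangle of side $b_j$ having a side on $\ell$ from $[L-b_1-\dots-b_j;0]$ to $[L-b_1-\dots-b_{j-1};0]$, up-pointing (above $\ell$) if $j$ is odd, down-pointing (below $\ell$) if $j$ is even. (The underlying halved hexagon has north, northeast, southeast, south sides $x+e_a+e_b$, $2y+z+2o_a+2o_b-1$, $2y+z+2e_a+2e_b-1$, $x+o_a+o_b$.) *)

theory Defs
  imports Complex_Main "HOL-Library.Disjoint_Sets"
begin

section \<open>The triangular lattice, lozenges and tilings\<close>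

text \<open>
  The pair \<open>(u, k)\<close> stands for the point \<open>[u;k]\<close> of the plane with Cartesian coordinates
  \<open>(u, sqrt 3 / 2 * k)\<close>.  Only lattice vertices matter, so the second component is an integer.
  A unit triangle is represented by the set of its three vertices, and a region (a finite union of
  unit triangles) by the set of the unit triangles it consists of.
\<close>

type_synonym point = "real \<times> int"
type_synonym face = "point set"

definition lattice :: "point set" where
  "lattice = {(u, k). u - real_of_int k / 2 \<in> \<int>}"

definition up_face :: "real \<Rightarrow> int \<Rightarrow> face" where
  "up_face u k = {(u, k), (u + 1, k), (u + 1/2, k + 1)}"

definition down_face :: "real \<Rightarrow> int \<Rightarrow> face" where
  "down_face u k = {(u, k), (u + 1, k), (u + 1/2, k - 1)}"

definition faces :: "face set" where
  "faces = {up_face u k | u k. (u, k) \<in> lattice} \<union> {down_face u k | u k. (u, k) \<in> lattice}"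

text \<open>Two distinct unit triangles share an edge iff they have exactly two vertices in common.\<close>

definition lozenge :: "face set \<Rightarrow> bool" where
  "lozenge p \<longleftrightarrow> (\<exists>f\<in>faces. \<exists>g\<in>faces. p = {f, g} \<and> card (f \<inter> g) = 2)"

definition tiling :: "face set \<Rightarrow> face set set \<Rightarrow> bool" where
  "tiling R P \<longleftrightarrow> partition_on R P \<and> (\<forall>p\<in>P. lozenge p)"

definition num_tilings :: "face set \<Rightarrow> nat" where
  "num_tilings R = card {P. tiling R P}"

text \<open>
  The unit triangles contained in a closed part of the plane.  It is used for intersections of closed
  half-planes, and for parts which in addition lie to the right of the west zigzag.  That zigzag is
  straight between consecutive integer heights.  So a unit triangle is contained in such a part iff
  its three vertices are, and it suffices to describe the part at integer heights \<open>k\<close>.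
\<close>

definition faces_within :: "point set \<Rightarrow> face set" where
  "faces_within Q = {f \<in> faces. f \<subseteq> Q}"

text \<open>The unit triangles in the triangle of side \<open>s\<close> with horizontal side from \<open>[p;0]\<close> to
  \<open>[p + s;0]\<close>, pointing up or down; there are none if \<open>s = 0\<close>.\<close>

definition up_triangle :: "real \<Rightarrow> real \<Rightarrow> face set" where
  "up_triangle p s =
     faces_within {(u, k). 0 \<le> k \<and> p + real_of_int k / 2 \<le> u \<and> u \<le> p + s - real_of_int k / 2}"

definition down_triangle :: "real \<Rightarrow> real \<Rightarrow> face set" where
  "down_triangle p s =
     faces_within {(u, k). k \<le> 0 \<and> p - real_of_int k / 2 \<le> u \<and> u \<le> p + s + real_of_int k / 2}"

text \<open>First coordinate of the west zigzag at height \<open>k\<close>, both above and below the line \<open>k = 0\<close>.\<close>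

definition zigzag :: "int \<Rightarrow> real" where
  "zigzag k = (if even k then 0 else 1/2)"

section \<open>Sequences\<close>

text \<open>Lists are indexed from 1, and entries beyond the end are 0.\<close>

definition entry :: "nat list \<Rightarrow> nat \<Rightarrow> nat" where
  "entry a i = (if 1 \<le> i \<and> i \<le> length a then a ! (i - 1) else 0)"

definition odd_sum :: "nat list \<Rightarrow> nat" where
  "odd_sum a = (\<Sum>i | i \<in> {1..length a} \<and> odd i. entry a i)"

definition even_sum :: "nat list \<Rightarrow> nat" where
  "even_sum a = (\<Sum>i | i \<in> {1..length a} \<and> even i. entry a i)"

definition psum :: "nat list \<Rightarrow> nat \<Rightarrow> nat" where
  "psum a i = sum_list (take i a)"

text \<open>An empty sequence counts as the one-term sequence \<open>(0)\<close>, so its number of terms is 1.\<close>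

definition num_terms :: "nat list \<Rightarrow> nat" where
  "num_terms a = max 1 (length a)"

section \<open>Quartered hexagons\<close>

definition quartered_hexagon :: "nat list \<Rightarrow> face set" where
  "quartered_hexagon t =
     faces_within {(u, k). 0 \<le> k \<and> k \<le> 2 * int (even_sum t) - 1 \<and> zigzag k \<le> u \<and>
                     u \<le> real (odd_sum t + even_sum t) - real_of_int k / 2}
     - (\<Union>i\<in>{1..length t div 2}. up_triangle (real (psum t (2*i - 1))) (real (entry t (2*i))))"

definition K_count :: "nat list \<Rightarrow> nat" where
  "K_count t = (if even_sum t = 0 then 1 else num_tilings (quartered_hexagon t))"

section \<open>The halved hexagon with two ferns removed\<close>

definition base_length :: "nat \<Rightarrow> nat \<Rightarrow> nat list \<Rightarrow> nat list \<Rightarrow> nat" where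
  "base_length x y a b = x + y + sum_list a + sum_list b"

definition upper_height :: "nat \<Rightarrow> nat list \<Rightarrow> nat list \<Rightarrow> int" where
  "upper_height y a b = 2 * int (y + odd_sum a + odd_sum b) - 1"

definition lower_height :: "nat \<Rightarrow> nat \<Rightarrow> nat list \<Rightarrow> nat list \<Rightarrow> int" where
  "lower_height y z a b = 2 * int (y + z + even_sum a + even_sum b) - 1"

definition upper_part :: "nat \<Rightarrow> nat \<Rightarrow> nat list \<Rightarrow> nat list \<Rightarrow> face set" where
  "upper_part x y a b =
     faces_within {(u, k). 0 \<le> k \<and> k \<le> upper_height y a b \<and> zigzag k \<le> u \<and>
                     u \<le> real (base_length x y a b) - real_of_int k / 2}"

text \<open>The two upper bounds on \<open>u\<close> are the lines through the segments from \<open>[L;0]\<close> to \<open>[L + z/2;-z]\<close>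
  and from there to \<open>[L + z - B/2;-B]\<close>, with \<open>L\<close> the base length and \<open>B\<close> the lower height.\<close>

definition lower_part :: "nat \<Rightarrow> nat \<Rightarrow> nat \<Rightarrow> nat list \<Rightarrow> nat list \<Rightarrow> face set" where
  "lower_part x y z a b =
     faces_within {(u, k). - lower_height y z a b \<le> k \<and> k \<le> 0 \<and> zigzag k \<le> u \<and>
                     u \<le> real (base_length x y a b) - real_of_int k / 2 \<and>
                     u \<le> real (base_length x y a b) + real z + real_of_int k / 2}"

text \<open>Within the upper part, the half-plane below cuts out the right half of an up-pointing triangle
  of side \<open>2 * a\<^sub>1\<close>; it is removed from the upper part only.\<close>

definition half_triangle :: "nat list \<Rightarrow> face set" where
  "half_triangle a = faces_within {(u, k). u \<le> real (entry a 1) - real_of_int k / 2}"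

definition left_fern :: "nat list \<Rightarrow> face set" where
  "left_fern a =
     (\<Union>i\<in>{2..length a}.
        (if even i then down_triangle else up_triangle) (real (psum a (i - 1))) (real (entry a i)))"

definition right_fern :: "nat \<Rightarrow> nat list \<Rightarrow> face set" where
  "right_fern L b =
     (\<Union>j\<in>{1..length b}.
        (if odd j then up_triangle else down_triangle) (real L - real (psum b j)) (real (entry b j)))"

definition H2_region :: "nat \<Rightarrow> nat \<Rightarrow> nat \<Rightarrow> nat list \<Rightarrow> nat list \<Rightarrow> face set" where
  "H2_region x y z a b =
     ((upper_part x y a b - half_triangle a) \<union> lower_part x y z a b)
     - left_fern a - right_fern (base_length x y a b) b"

section \<open>Product functions\<close>

definition hyperfact :: "nat \<Rightarrow> real" where
  "hyperfact n = (\<Prod>i<n. fact i)"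

definition hyperfact2 :: "nat \<Rightarrow> real" where
  "hyperfact2 n = (\<Prod>i=1..n div 2. fact (n - 2*i))"

definition skip_pochhammer :: "real \<Rightarrow> nat \<Rightarrow> real" where
  "skip_pochhammer x n = (\<Prod>i<n. x + 2 * real i)"

text \<open>The truncated subtractions in the next two definitions are only meant for \<open>n \<ge> 2 * (m - 1)\<close>
  (or \<open>m = 0\<close>, when the products are empty).\<close>

definition T_prod :: "real \<Rightarrow> nat \<Rightarrow> nat \<Rightarrow> real" where
  "T_prod x n m = (\<Prod>i<m. pochhammer (x + real i) (n - 2*i))"

definition V_prod :: "real \<Rightarrow> nat \<Rightarrow> nat \<Rightarrow> real" where
  "V_prod x n m = (\<Prod>i<m. skip_pochhammer (x + 2 * real i) (n - 2*i))"

text \<open>\<open>odd_double_fact n\<close> is \<open>(2n - 1)!!\<close>, in particular \<open>(-1)!! = 1\<close> for \<open>n = 0\<close>.\<close>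

definition odd_double_fact :: "nat \<Rightarrow> real" where
  "odd_double_fact n = (\<Prod>i<n. real (2*i + 1))"

section \<open>The sequences of the two quartered hexagons\<close>

definition t_plus :: "nat \<Rightarrow> nat \<Rightarrow> nat list \<Rightarrow> nat list \<Rightarrow> nat list" where
  "t_plus x y a b =
     (let \<mu> = 2 * ((num_terms a + 1) div 2); \<nu> = 2 * ((num_terms b + 1) div 2)
      in [0] @ map (entry a) [1..<\<mu>] @ [entry a \<mu> + x + y + entry b \<nu>]
         @ rev (map (entry b) [1..<\<nu>]))"

definition t_minus :: "nat \<Rightarrow> nat \<Rightarrow> nat \<Rightarrow> nat list \<Rightarrow> nat list \<Rightarrow> nat list" where
  "t_minus x y z a b =
     (let \<mu>' = 2 * nat \<lceil>(real (num_terms a) - 1) / 2\<rceil>; \<nu>' = 2 * nat \<lceil>(real (num_terms b) - 1) / 2\<rceil>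
      in map (entry a) [1..<\<mu>' + 1] @ [entry a (\<mu>' + 1) + x + y + entry b (\<nu>' + 1)]
         @ rev (map (entry b) [1..<\<nu>' + 1]) @ [z])"

end

theory Submission
  imports Defs "Jordan_Normal_Form.Determinant"
begin

text \<open>
  Cut the region along \<open>k = 0\<close>. A tiling is determined by the set \<open>S\<close> of the positions of the vertical
  lozenges crossing the cut, which lie in the gap between the ferns, and by tilings of the two halves.
  After removal of forced lozenges each half is a trapezoid with a zigzag side and unit dents on its base,
  the dents being the fern segments on its side together with \<open>S\<close> (below the cut, the northeast
  corner of the region accounts for a further segment of length \<open>z\<close>). Adding the lozenges row by row turns the
  number of tilings of such a trapezoid into a determinant, whence it is a constant times the
  Vandermonde product of the values \<open>X s = s * (s + 1)\<close> over the dents \<open>s\<close>.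

  Since the segments above and below the cut together fill the complement of the gap, the factor by which
  \<open>S\<close> contributes does not depend on how they are distributed. Hence the sum over \<open>S\<close> is the Vandermonde
  product of the ferns, which is the product of two quartered hexagon counts, times a discrete Selberg
  sum on the quadratic lattice \<open>X\<close>. In suitable Newton bases this sum is a determinant of
  moments which are evaluated by induction, and the determinant reduces to the Hankel
  determinant of quotients of Pochhammer symbols. This gives the dependence on \<open>x\<close>; for \<open>x = 0\<close> the sum
  has a single term.
\<close>

section \<open>Perfect matchings\<close>

text \<open>The quadratic variable comes from the zigzag. A row on an odd height behaves like a row
  with one more dent, at the zigzag itself, so only every second row loses a dent; \<open>n\<close>
  dents therefore go with height \<open>2 * n - 1\<close>, and iterated hockey-stick summation
  yields \<open>(s + j) choose (2 * j)\<close>, whose factors pair up to a polynomial of degree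
  \<open>j\<close> in \<open>s * (s + 1)\<close>. In the Selberg sum the Newton nodes continue the
  weight on either side of the gap: \<open>a, a + 1, ...\<close> for one Vandermonde factor and
  \<open>B + c, B + c + 1, ...\<close> for the other. Hence each matrix entry is a moment of the
  same family with shifted parameters. Once row and column factors are pulled out, there remains
  \<open>pochhammer p (i + j) / pochhammer q (i + j)\<close> with \<open>p = B + a + c + 1\<close>
  and \<open>q = a + c + 3/2\<close>. Here \<open>B = a + x + y\<close>, so that \<open>x\<close>
  enters the Hankel determinant through \<open>p\<close> alone. It suffices to know that determinant
  up to a factor free of \<open>p\<close>, which is why the constants are only shown to exist:
  comparison with \<open>x = 0\<close> determines them.\<close>

definition matching :: "('a \<Rightarrow> 'a \<Rightarrow> bool) \<Rightarrow> 'a set \<Rightarrow> 'a set set \<Rightarrow> bool" where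
  "matching A C P \<longleftrightarrow> partition_on C P \<and> (\<forall>p\<in>P. \<exists>c d. A c d \<and> p = {c, d})"

definition matchings :: "('a \<Rightarrow> 'a \<Rightarrow> bool) \<Rightarrow> 'a set \<Rightarrow> nat" where
  "matchings A C = card {P. matching A C P}"

lemma matching_empty_iff: "matching A {} P \<longleftrightarrow> P = {}"
  by (auto simp: matching_def partition_on_empty)

lemma matchings_empty [simp]: "matchings A {} = 1"
  by (simp add: matchings_def matching_empty_iff)

lemma finite_matching: "finite C \<Longrightarrow> finite {P. matching A C P}"
  by (rule finite_subset[of _ "Pow (Pow C)"]) (unfold matching_def partition_on_def, blast, simp)

lemma matching_Un:
  assumes "matching A C1 P1" "matching A C2 P2" "C1 \<inter> C2 = {}"
  shows "matching A (C1 \<union> C2) (P1 \<union> P2)"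
proof -
  have sub: "p \<subseteq> C1" if "p \<in> P1" for p using assms(1) that by (auto simp: matching_def partition_on_def)
  have sub': "p \<subseteq> C2" if "p \<in> P2" for p using assms(2) that by (auto simp: matching_def partition_on_def)
  have "p \<inter> q = {}" if "p \<in> P1" "q \<in> P2" for p q using sub[OF that(1)] sub'[OF that(2)] assms(3) by blast
  then have "disjoint (P1 \<union> P2)"
    using assms(1,2) unfolding matching_def partition_on_def disjoint_def
    by (metis Int_commute UnE)
  then show ?thesis using assms by (auto simp: matching_def partition_on_def)
qed

lemma matching_subset:
  assumes "matching A C P" "M \<subseteq> P"
  shows "matching A (\<Union>M) M"
  using assms unfolding matching_def
  by (auto simp: partition_on_def disjoint_def)

lemma matching_Diff:
  assumes "matching A C P" "M \<subseteq> P"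
  shows "matching A (C - \<Union>M) (P - M)"
proof -
  have "\<Union>(P - M) = C - \<Union>M"
  proof (intro equalityI subsetI)
    fix c assume "c \<in> \<Union>(P - M)"
    then obtain p where p: "p \<in> P" "p \<notin> M" "c \<in> p" by blast
    have "c \<notin> q" if "q \<in> M" for q
      using p that assms unfolding matching_def partition_on_def disjoint_def by (metis IntI empty_iff subsetD)
    with p assms(1) show "c \<in> C - \<Union>M" unfolding matching_def partition_on_def by blast
  next
    fix c assume "c \<in> C - \<Union>M"
    then show "c \<in> \<Union>(P - M)" using assms(1) unfolding matching_def partition_on_def by blast
  qed
  with matching_subset[OF assms(1), of "P - M"] show ?thesis by simp
qed

lemma matching_pair:
  assumes "matching A C P" "c \<in> C" "symp A"
  shows "\<exists>d. A c d \<and> {c, d} \<in> P \<and> d \<in> C"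
proof -
  from assms obtain p where p: "p \<in> P" "c \<in> p" unfolding matching_def partition_on_def by auto
  with assms obtain e d where ed: "A e d" "p = {e, d}" unfolding matching_def by blast
  have "p \<subseteq> C" using assms(1) p unfolding matching_def partition_on_def by auto
  with ed p assms(3) show ?thesis by (auto simp: insert_commute dest: sympD)
qed

lemma matching_transport:
  assumes inj: "inj_on \<phi> C" and adj: "\<And>c d. c \<in> C \<Longrightarrow> d \<in> C \<Longrightarrow> A c d \<longleftrightarrow> A' (\<phi> c) (\<phi> d)"
    and P: "matching A C P"
  shows "matching A' (\<phi> ` C) ((`) \<phi> ` P)"
proof -
  have sub: "\<And>p. p \<in> P \<Longrightarrow> p \<subseteq> C" and ne: "{} \<notin> P"
    using P by (auto simp: matching_def partition_on_def)
  have "partition_on (\<phi> ` C) ((`) \<phi> ` P - {{}})"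
    using partition_on_inj_image[OF _ inj] P by (auto simp: matching_def)
  moreover have "(`) \<phi> ` P - {{}} = (`) \<phi> ` P" using ne by auto
  moreover have "\<exists>c d. A' c d \<and> \<phi> ` p = {c, d}" if "p \<in> P" for p
  proof -
    from P that obtain c d where cd: "A c d" "p = {c, d}" unfolding matching_def by blast
    with sub[OF that] adj[of c d] have "A' (\<phi> c) (\<phi> d)" by auto
    with cd show ?thesis by auto
  qed
  ultimately show ?thesis unfolding matching_def by auto
qed

lemma matchings_transport:
  assumes inj: "inj_on \<phi> C" and adj: "\<And>c d. c \<in> C \<Longrightarrow> d \<in> C \<Longrightarrow> A c d \<longleftrightarrow> A' (\<phi> c) (\<phi> d)"
  shows "matchings A' (\<phi> ` C) = matchings A C"
proof -
  let ?\<psi> = "the_inv_into C \<phi>"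
  have inv: "?\<psi> ` \<phi> ` X = X" if "X \<subseteq> C" for X
    using that inj by (force simp: the_inv_into_f_f image_image subset_iff)
  have inv': "\<phi> ` ?\<psi> ` Y = Y" if "Y \<subseteq> \<phi> ` C" for Y
    using that inj by (force simp: f_the_inv_into_f image_image subset_iff)
  have inj': "inj_on ?\<psi> (\<phi> ` C)" using inj by (simp add: inj_on_the_inv_into)
  have sub: "p \<subseteq> D" if "matching B D P" "p \<in> P" for B D and P :: "'c set set" and p
    using that by (auto simp: matching_def partition_on_def)
  have "bij_betw ((`) ((`) \<phi>)) {P. matching A C P} {P. matching A' (\<phi> ` C) P}"
  proof (rule bij_betw_byWitness[where f' = "(`) ((`) ?\<psi>)"])
    show "\<forall>P\<in>{P. matching A C P}. (`) ?\<psi> ` (`) \<phi> ` P = P"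
      using sub inv by (force simp: image_image)
    show "\<forall>P\<in>{P. matching A' (\<phi> ` C) P}. (`) \<phi> ` (`) ?\<psi> ` P = P"
      using sub inv' by (force simp: image_image)
    show "(`) ((`) \<phi>) ` {P. matching A C P} \<subseteq> {P. matching A' (\<phi> ` C) P}"
      using matching_transport[OF inj, of A A'] adj by auto
    have "matching A (?\<psi> ` \<phi> ` C) ((`) ?\<psi> ` P)" if "matching A' (\<phi> ` C) P" for P
      using that adj inj by (intro matching_transport[OF inj', of A']) (auto simp: the_inv_into_f_f)
    then show "(`) ((`) ?\<psi>) ` {P. matching A' (\<phi> ` C) P} \<subseteq> {P. matching A C P}"
      using inv[of C] by auto
  qed
  then show ?thesis unfolding matchings_def by (rule bij_betw_same_card[symmetric])
qed

text \<open>Taking \<open>M\<close> out of a matching of \<open>C\<close> and putting it back are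
  mutually inverse. Leaves of a path and forced lozenges over a triangle are both instances.\<close>

lemma matchings_remove_forced:
  assumes M: "matching A D M" and D: "D \<subseteq> C" and forced: "\<And>P. matching A C P \<Longrightarrow> M \<subseteq> P"
  shows "matchings A C = matchings A (C - D)"
proof -
  have UM: "\<Union>M = D" using M by (simp add: matching_def partition_on_def)
  have disj: "P \<inter> M = {}" if "matching A (C - D) P" for P
    using that M unfolding matching_def partition_on_def by fastforce
  have "bij_betw (\<lambda>P. P - M) {P. matching A C P} {P. matching A (C - D) P}"
  proof (rule bij_betw_byWitness[where f' = "\<lambda>P. P \<union> M"])
    show "\<forall>P\<in>{P. matching A C P}. P - M \<union> M = P" using forced by auto
    show "\<forall>P\<in>{P. matching A (C - D) P}. P \<union> M - M = P" using disj by auto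
    show "(\<lambda>P. P - M) ` {P. matching A C P} \<subseteq> {P. matching A (C - D) P}"
      using matching_Diff[of A C _ M] forced UM by auto
    show "(\<lambda>P. P \<union> M) ` {P. matching A (C - D) P} \<subseteq> {P. matching A C P}"
      using matching_Un[OF _ M, of "C - D"] D by (auto simp: Un_absorb2)
  qed
  then show ?thesis unfolding matchings_def by (rule bij_betw_same_card)
qed

lemma matchings_leaf:
  assumes sym: "symp A" and c: "c \<in> C" and d: "d \<in> C" "A c d"
    and unique: "\<And>e. e \<in> C \<Longrightarrow> A c e \<Longrightarrow> e = d"
  shows "matchings A C = matchings A (C - {c, d})"
proof (rule matchings_remove_forced)
  show "matching A {c, d} {{c, d}}"
    using d by (auto simp: matching_def partition_on_def)
  show "{{c, d}} \<subseteq> P" if P: "matching A C P" for P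
    using matching_pair[OF P c sym] unique by auto
qed (use c d in auto)

lemma matchings_isolated:
  assumes "symp A" "c \<in> C" "\<And>e. e \<in> C \<Longrightarrow> \<not> A c e"
  shows "matchings A C = 0"
proof -
  have "{P. matching A C P} = {}" using matching_pair[of A C _ c] assms by auto
  then show ?thesis by (simp add: matchings_def)
qed

text \<open>The edges between the two sides are the pairs \<open>{f j, g j}\<close>, at most one at
  each vertex. A matching is thus the set \<open>S\<close> of crossing pairs in use together with a
  matching of what each side has left. This serves twice: for peeling a row off a trapezoid and for
  cutting the hexagon along the line.\<close>

lemma matchings_split:
  fixes A :: "'a \<Rightarrow> 'a \<Rightarrow> bool" and f g :: "'b \<Rightarrow> 'a"
  assumes sym: "symp A" and fin: "finite C1" "finite C2" and disj: "C1 \<inter> C2 = {}"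
    and f: "inj_on f J" "f ` J \<subseteq> C1" and g: "inj_on g J" "g ` J \<subseteq> C2"
    and cross: "\<And>c d. c \<in> C1 \<Longrightarrow> d \<in> C2 \<Longrightarrow> A c d \<longleftrightarrow> (\<exists>j\<in>J. c = f j \<and> d = g j)"
  shows "matchings A (C1 \<union> C2)
    = (\<Sum>S\<in>Pow J. matchings A (C1 - f ` S) * matchings A (C2 - g ` S))"
proof -
  define X where "X S = (\<lambda>j. {f j, g j}) ` S" for S
  define W where "W S = {P. matching A (C1 - f ` S) P} \<times> {P. matching A (C2 - g ` S) P}" for S
  define F where "F = (\<lambda>(S, P1, P2). P1 \<union> P2 \<union> X S)"
  have finJ: "finite J" using f fin finite_imageD finite_subset by metis
  have UX: "\<Union>(X S) = f ` S \<union> g ` S" for S by (auto simp: X_def)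
  have mX: "matching A (f ` S \<union> g ` S) (X S)" if S: "S \<subseteq> J" for S
  proof -
    have in1: "f j \<in> C1" "g j \<in> C2" if "j \<in> S" for j using S f g that by auto
    have ne: "f i \<noteq> g j" if "i \<in> S" "j \<in> S" for i j using in1[OF that(1)] in1[OF that(2)] disj by auto
    have eqs: "f i = f j \<longleftrightarrow> i = j" "g i = g j \<longleftrightarrow> i = j" if "i \<in> S" "j \<in> S" for i j
      using inj_on_eq_iff[OF f(1), of i j] inj_on_eq_iff[OF g(1), of i j] that S by auto
    have "disjoint (X S)"
      unfolding disjoint_def X_def using ne eqs by (auto; metis)
    moreover have "\<exists>c d. A c d \<and> p = {c, d}" if "p \<in> X S" for p
      using that S cross in1 unfolding X_def by blast
    ultimately show ?thesis using UX by (auto simp: matching_def partition_on_def X_def)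
  qed
  have memX: "{c, d} \<in> X J" if "A c d" "c \<in> C1" "d \<in> C2" for c d
    using cross[of c d] that by (auto simp: X_def)
  have sub: "p \<subseteq> D" if "matching A D P" "p \<in> P" for D P p
    using that by (auto simp: matching_def partition_on_def)
  have ne: "p \<noteq> {}" if "matching A D P" "p \<in> P" for D P p
    using that by (auto simp: matching_def partition_on_def)
  \<comment> \<open>The inverse of \<open>F\<close>: a pair that lies in neither side must be one of
    the crossing pairs, so these three parts exhaust a matching.\<close>
  define G where "G P = ({j\<in>J. {f j, g j} \<in> P}, {p\<in>P. p \<subseteq> C1}, {p\<in>P. p \<subseteq> C2})" for P
  have GF: "G (F (S, P1, P2)) = (S, P1, P2)" if S: "S \<subseteq> J" and "(P1, P2) \<in> W S" for S P1 P2
  proof -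
    from that
    have P1: "matching A (C1 - f ` S) P1" and P2: "matching A (C2 - g ` S) P2"
      by (auto simp: W_def)
    have a: "p \<subseteq> C1" "p \<noteq> {}" "\<not> p \<subseteq> C2" if "p \<in> P1" for p
      using sub[OF P1 that] ne[OF P1 that] disj by auto
    have b: "p \<subseteq> C2" "p \<noteq> {}" "\<not> p \<subseteq> C1" if "p \<in> P2" for p
      using sub[OF P2 that] ne[OF P2 that] disj by auto
    have c: "\<not> {f j, g j} \<subseteq> C1" "\<not> {f j, g j} \<subseteq> C2" if "j \<in> J" for j
      using that f g disj by auto
    have d: "{f i, g i} = {f j, g j} \<longleftrightarrow> i = j" if "i \<in> J" "j \<in> J" for i j
    proof -
      have "f i \<noteq> g j" using that f g disj by auto
      then show ?thesis using inj_on_eq_iff[OF f(1) that] by (auto simp: doubleton_eq_iff)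
    qed
    have eq: "F (S, P1, P2) = P1 \<union> P2 \<union> X S" by (simp add: F_def)
    show ?thesis
      unfolding eq G_def prod.inject
    proof (intro conjI)
      show "{j \<in> J. {f j, g j} \<in> P1 \<union> P2 \<union> X S} = S"
      proof (intro equalityI subsetI CollectI conjI)
        fix j assume j: "j \<in> {j \<in> J. {f j, g j} \<in> P1 \<union> P2 \<union> X S}"
        then have "{f j, g j} \<in> X S" using a(1)[of "{f j, g j}"] b(1)[of "{f j, g j}"] c[of j] by blast
        then obtain i where "i \<in> S" "{f j, g j} = {f i, g i}" unfolding X_def by blast
        then show "j \<in> S" using d[of j i] j S by blast
      qed (use S in \<open>auto simp: X_def\<close>)
      have e: "\<not> p \<subseteq> C1" "\<not> p \<subseteq> C2" if "p \<in> X S" for p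
      proof -
        from that obtain j where "j \<in> S" "p = {f j, g j}" unfolding X_def by blast
        with c[of j] S show "\<not> p \<subseteq> C1" "\<not> p \<subseteq> C2" by (simp_all add: subset_iff)
      qed
      show "{p \<in> P1 \<union> P2 \<union> X S. p \<subseteq> C1} = P1"
      proof (rule Set.set_eqI)
        fix p show "p \<in> {p \<in> P1 \<union> P2 \<union> X S. p \<subseteq> C1} \<longleftrightarrow> p \<in> P1"
          using a(1)[of p] b(3)[of p] e(1)[of p] by (simp only: mem_Collect_eq Un_iff) blast
      qed
      show "{p \<in> P1 \<union> P2 \<union> X S. p \<subseteq> C2} = P2"
      proof (rule Set.set_eqI)
        fix p show "p \<in> {p \<in> P1 \<union> P2 \<union> X S. p \<subseteq> C2} \<longleftrightarrow> p \<in> P2"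
          using a(3)[of p] b(1)[of p] e(2)[of p] by (simp only: mem_Collect_eq Un_iff) blast
      qed
    qed
  qed
  have FG: "F (G P) = P \<and> G P \<in> Sigma (Pow J) W" if P: "matching A (C1 \<union> C2) P" for P
  proof -
    have "p \<subseteq> C1 \<or> p \<subseteq> C2 \<or> p \<in> X {j\<in>J. {f j, g j} \<in> P}" if p: "p \<in> P" for p
    proof -
      obtain c d where cd: "A c d" "p = {c, d}" using P p unfolding matching_def by blast
      have "c \<in> C1 \<union> C2" "d \<in> C1 \<union> C2" using sub[OF P p] cd by auto
      then consider "c \<in> C1 \<and> d \<in> C1" | "c \<in> C2 \<and> d \<in> C2" | "c \<in> C1 \<and> d \<in> C2" | "c \<in> C2 \<and> d \<in> C1"
        by blast
      then show ?thesis
      proof cases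
        case 3
        then show ?thesis using cross[of c d] cd p by (auto simp: X_def)
      next
        case 4
        then show ?thesis using cross[of d c] cd p sympD[OF sym, of c d]
          by (auto simp: X_def insert_commute)
      qed (use cd in auto)
    qed
    then have "F (G P) = P" by (auto simp: F_def G_def X_def)
    moreover from this have PF: "P = {p \<in> P. p \<subseteq> C1} \<union> {p \<in> P. p \<subseteq> C2} \<union> X {j \<in> J. {f j, g j} \<in> P}"
      by (simp add: F_def G_def)
    let ?S = "{j \<in> J. {f j, g j} \<in> P}"
    have UP: "\<Union>P = C1 \<union> C2" and dP: "disjoint P" using P by (auto simp: matching_def partition_on_def)
    have XP: "X ?S \<subseteq> P" by (auto simp: X_def)
    have fS: "f ` ?S \<subseteq> C1" "g ` ?S \<subseteq> C2" using f g by auto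
    have nsub: "\<not> p \<subseteq> C1 \<and> \<not> p \<subseteq> C2" if "p \<in> X ?S" for p
      using that f g disj by (auto simp: X_def)
    \<comment> \<open>A pair inside one side differs from every crossing pair in use, hence is
      disjoint from it. So the pairs inside a side cover exactly the endpoints that no crossing pair
      uses.\<close>
    have key: "p \<inter> \<Union>(X ?S) = {}" if "p \<in> P" "p \<subseteq> C1 \<or> p \<subseteq> C2" for p
    proof -
      have "p \<inter> q = {}" if q: "q \<in> X ?S" for q
        using dP \<open>p \<in> P\<close> q XP nsub[OF q] \<open>p \<subseteq> C1 \<or> p \<subseteq> C2\<close> unfolding disjoint_def by blast
      then show ?thesis by blast
    qed
    have U1: "\<Union>{p \<in> P. p \<subseteq> C1} = C1 - f ` ?S"
    proof (intro equalityI subsetI)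
      fix c assume "c \<in> \<Union>{p \<in> P. p \<subseteq> C1}"
      then show "c \<in> C1 - f ` ?S" using key unfolding UX by blast
    next
      fix c assume c: "c \<in> C1 - f ` ?S"
      then obtain p where p: "p \<in> P" "c \<in> p" using UP by blast
      moreover have "p \<notin> X ?S" using p c g fS disj unfolding X_def by blast
      moreover have "\<not> p \<subseteq> C2" using p c disj by blast
      ultimately show "c \<in> \<Union>{p \<in> P. p \<subseteq> C1}" using PF by blast
    qed
    have U2: "\<Union>{p \<in> P. p \<subseteq> C2} = C2 - g ` ?S"
    proof (intro equalityI subsetI)
      fix c assume "c \<in> \<Union>{p \<in> P. p \<subseteq> C2}"
      then show "c \<in> C2 - g ` ?S" using key unfolding UX by blast
    next
      fix c assume c: "c \<in> C2 - g ` ?S"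
      then obtain p where p: "p \<in> P" "c \<in> p" using UP by blast
      moreover have "p \<notin> X ?S" using p c g fS disj unfolding X_def by blast
      moreover have "\<not> p \<subseteq> C1" using p c disj by blast
      ultimately show "c \<in> \<Union>{p \<in> P. p \<subseteq> C2}" using PF by blast
    qed
    have "({p \<in> P. p \<subseteq> C1}, {p \<in> P. p \<subseteq> C2}) \<in> W ?S"
      using matching_subset[OF P, of "{p \<in> P. p \<subseteq> C1}"] matching_subset[OF P, of "{p \<in> P. p \<subseteq> C2}"]
      unfolding U1 U2 W_def by auto
    ultimately show ?thesis by (auto simp: G_def)
  qed
  have FW: "matching A (C1 \<union> C2) (F (S, P1, P2))" if S: "S \<subseteq> J" and "(P1, P2) \<in> W S" for S P1 P2
  proof -
    from that have P1: "matching A (C1 - f ` S) P1" and P2: "matching A (C2 - g ` S) P2"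
      by (auto simp: W_def)
    have fS: "f ` S \<subseteq> C1" "g ` S \<subseteq> C2"
      using image_mono[OF S, of f] image_mono[OF S, of g] f(2) g(2) by blast+
    have "matching A ((C1 - f ` S) \<union> (C2 - g ` S)) (P1 \<union> P2)"
      by (rule matching_Un[OF P1 P2]) (use disj in auto)
    from matching_Un[OF this mX[OF S]]
    have "matching A ((C1 - f ` S) \<union> (C2 - g ` S) \<union> (f ` S \<union> g ` S)) (P1 \<union> P2 \<union> X S)"
      using disj fS by blast
    moreover have "(C1 - f ` S) \<union> (C2 - g ` S) \<union> (f ` S \<union> g ` S) = C1 \<union> C2" using fS by auto
    ultimately show ?thesis by (simp add: F_def)
  qed
  have "bij_betw F (Sigma (Pow J) W) {P. matching A (C1 \<union> C2) P}"
  proof (rule bij_betw_byWitness[where f' = G])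
    show "\<forall>x\<in>Sigma (Pow J) W. G (F x) = x" using GF by auto
    show "\<forall>P\<in>{P. matching A (C1 \<union> C2) P}. F (G P) = P" using FG by auto
    show "F ` Sigma (Pow J) W \<subseteq> {P. matching A (C1 \<union> C2) P}" using FW by auto
    show "G ` {P. matching A (C1 \<union> C2) P} \<subseteq> Sigma (Pow J) W" using FG by blast
  qed
  then have "matchings A (C1 \<union> C2) = card (Sigma (Pow J) W)"
    unfolding matchings_def by (rule bij_betw_same_card[symmetric])
  also have "\<dots> = (\<Sum>S\<in>Pow J. card (W S))"
    using finJ fin by (intro card_SigmaI) (auto simp: W_def intro: finite_matching)
  finally show ?thesis by (simp add: W_def card_cartesian_product matchings_def)
qed

section \<open>Matchings of a path with removed vertices\<close>

definition path_adj :: "nat \<Rightarrow> nat \<Rightarrow> bool" where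
  "path_adj i j \<longleftrightarrow> i = Suc j \<or> j = Suc i"

lemma symp_path_adj: "symp path_adj"
  by (auto simp: symp_def path_adj_def)

definition evens_below :: "nat set \<Rightarrow> nat \<Rightarrow> nat" where
  "evens_below Q M = card {q \<in> Q. q < M \<and> even q}"

definition odds_below :: "nat set \<Rightarrow> nat \<Rightarrow> nat" where
  "odds_below Q M = card {q \<in> Q. q < M \<and> odd q}"

lemma evens_below_0 [simp]: "evens_below Q 0 = 0" and odds_below_0 [simp]: "odds_below Q 0 = 0"
  by (auto simp: evens_below_def odds_below_def)

lemma evens_below_Suc: "evens_below Q (Suc M) = (if M \<in> Q \<and> even M then Suc (evens_below Q M) else evens_below Q M)"
proof -
  have "{q \<in> Q. q < Suc M \<and> even q} =
    (if M \<in> Q \<and> even M then insert M {q \<in> Q. q < M \<and> even q} else {q \<in> Q. q < M \<and> even q})"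
    by (auto simp: less_Suc_eq)
  then show ?thesis by (simp add: evens_below_def)
qed

lemma odds_below_Suc: "odds_below Q (Suc M) = (if M \<in> Q \<and> odd M then Suc (odds_below Q M) else odds_below Q M)"
proof -
  have "{q \<in> Q. q < Suc M \<and> odd q} =
    (if M \<in> Q \<and> odd M then insert M {q \<in> Q. q < M \<and> odd q} else {q \<in> Q. q < M \<and> odd q})"
    by (auto simp: less_Suc_eq)
  then show ?thesis by (simp add: odds_below_def)
qed

text \<open>Read in increasing order, the removed vertices below \<open>M\<close> are even, odd,
  even, and so on. Equivalently, each run of remaining vertices in front of a removed one has even
  length. Prefix counts express this without an enumeration of \<open>Q\<close>.\<close>

definition alternating :: "nat set \<Rightarrow> nat \<Rightarrow> bool" where
  "alternating Q M \<longleftrightarrow>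
     (\<forall>i\<le>M. evens_below Q i = odds_below Q i \<or> evens_below Q i = Suc (odds_below Q i))"

lemma alternating_Suc:
  "alternating Q (Suc M) \<longleftrightarrow> alternating Q M \<and>
     (evens_below Q (Suc M) = odds_below Q (Suc M) \<or> evens_below Q (Suc M) = Suc (odds_below Q (Suc M)))"
  by (auto simp: alternating_def le_Suc_eq)

lemma alternating_last:
  "alternating Q M \<Longrightarrow> evens_below Q M = odds_below Q M \<or> evens_below Q M = Suc (odds_below Q M)"
  by (auto simp: alternating_def)

text \<open>A path has a perfect matching only if all runs of remaining vertices have even length,
  and then just one. The equation with \<open>M mod 2\<close> takes care of the last run. In the
  induction the last vertex is either removed or can only be matched with its predecessor.\<close>

lemma matchings_path:
  "matchings path_adj ({..<M} - Q) =
    (if alternating Q M \<and> evens_below Q M = odds_below Q M + M mod 2 then 1 else 0)"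
proof (induction M rule: less_induct)
  case (less M)
  show ?case
  proof (cases M)
    case 0
    then show ?thesis by (simp add: alternating_def)
  next
    case (Suc K)
    show ?thesis
    proof (cases "K \<in> Q")
      case True
      then have "{..<M} - Q = {..<K} - Q" using Suc by (auto simp: less_Suc_eq)
      then show ?thesis
        using less.IH[of K] Suc True alternating_last[of Q K]
        by (auto simp: alternating_Suc evens_below_Suc odds_below_Suc mod_Suc even_iff_mod_2_eq_zero)
    next
      case False
      show ?thesis
      proof (cases K)
        case 0
        have "matchings path_adj ({..<M} - Q) = 0"
          by (rule matchings_isolated[OF symp_path_adj, of K])
            (use Suc 0 False in \<open>auto simp: path_adj_def\<close>)
        then show ?thesis using Suc 0 False by (simp add: evens_below_Suc odds_below_Suc)
      next
        case (Suc N)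
        note K = this
        show ?thesis
        proof (cases "N \<in> Q")
          case True
          have "matchings path_adj ({..<M} - Q) = 0"
            by (rule matchings_isolated[OF symp_path_adj, of K])
              (use \<open>M = Suc K\<close> K True False in \<open>auto simp: path_adj_def less_Suc_eq\<close>)
          then show ?thesis using \<open>M = Suc K\<close> K False True alternating_last[of Q N]
            by (auto simp: alternating_Suc evens_below_Suc odds_below_Suc mod_Suc even_iff_mod_2_eq_zero)
        next
          case N: False
          have "matchings path_adj ({..<M} - Q) = matchings path_adj ({..<M} - Q - {K, N})"
            by (rule matchings_leaf[OF symp_path_adj])
              (use \<open>M = Suc K\<close> K N False in \<open>auto simp: path_adj_def less_Suc_eq\<close>)
          also have "{..<M} - Q - {K, N} = {..<N} - Q"
            using \<open>M = Suc K\<close> K by (auto simp: less_Suc_eq)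
          finally show ?thesis using less.IH[of N] \<open>M = Suc K\<close> K N False
            by (auto simp: alternating_Suc evens_below_Suc odds_below_Suc mod_Suc)
        qed
      qed
    qed
  qed
qed

section \<open>Interlacing\<close>

text \<open>A row of triangles is a path in which the two orientations alternate; position \<open>s\<close> of the first
  one becomes the vertex \<open>2 * s\<close>, position \<open>s\<close> of the second one \<open>2 * s + 1\<close>.\<close>

definition row_set :: "nat set \<Rightarrow> nat set \<Rightarrow> nat set" where
  "row_set P S = (*) 2 ` P \<union> (\<lambda>s. 2 * s + 1) ` S"

lemma evens_below_row:
  "evens_below (row_set P S) (2 * t) = card (P \<inter> {..<t})"
  "evens_below (row_set P S) (Suc (2 * t)) = card (P \<inter> {..t})"
proof -
  have "{q \<in> row_set P S. q < 2 * t \<and> even q} = (*) 2 ` (P \<inter> {..<t})"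
    "{q \<in> row_set P S. q < Suc (2 * t) \<and> even q} = (*) 2 ` (P \<inter> {..t})"
    by (auto simp: row_set_def image_iff)
  then show "evens_below (row_set P S) (2 * t) = card (P \<inter> {..<t})"
    "evens_below (row_set P S) (Suc (2 * t)) = card (P \<inter> {..t})"
    by (simp_all add: evens_below_def card_image inj_on_def)
qed

lemma odds_below_row:
  "odds_below (row_set P S) (2 * t) = card (S \<inter> {..<t})"
  "odds_below (row_set P S) (Suc (2 * t)) = card (S \<inter> {..<t})"
proof -
  have "{q \<in> row_set P S. q < 2 * t \<and> odd q} = (\<lambda>s. 2 * s + 1) ` (S \<inter> {..<t})"
    "{q \<in> row_set P S. q < Suc (2 * t) \<and> odd q} = (\<lambda>s. 2 * s + 1) ` (S \<inter> {..<t})"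
    by (auto simp: row_set_def image_iff)
  then show "odds_below (row_set P S) (2 * t) = card (S \<inter> {..<t})"
    "odds_below (row_set P S) (Suc (2 * t)) = card (S \<inter> {..<t})"
    by (simp_all add: odds_below_def card_image inj_on_def)
qed

text \<open>A Galois connection between the counting function of a set and its increasing
  enumeration; it translates the prefix counts of \<open>alternating\<close> into inequalities
  between enumerations.\<close>

lemma strict_mono_card_below:
  fixes p :: "nat \<Rightarrow> nat"
  assumes p: "strict_mono_on {..<n} p"
  shows "card (p ` {..<n} \<inter> {..<t}) \<le> i \<longleftrightarrow> (i < n \<longrightarrow> t \<le> p i)"
proof -
  have inj: "inj_on p {..<n}" using p by (rule strict_mono_on_imp_inj_on)
  have "p ` {..<n} \<inter> {..<t} = p ` {k. k < n \<and> p k < t}" by auto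
  then have c: "card (p ` {..<n} \<inter> {..<t}) = card {k. k < n \<and> p k < t}"
    using inj by (simp add: card_image inj_on_def)
  show ?thesis
  proof (cases "i < n \<and> p i < t")
    case True
    have "p k < t" if "k \<le> i" for k
      using that True strict_mono_onD[OF p, of k i] by (cases "k = i") auto
    then have "{..i} \<subseteq> {k. k < n \<and> p k < t}" using True by auto
    from card_mono[OF _ this] have "Suc i \<le> card {k. k < n \<and> p k < t}" by simp
    with True c show ?thesis by auto
  next
    case False
    have "k < i" if "k < n" "p k < t" for k
    proof (rule ccontr)
      assume "\<not> k < i"
      with that have "p i \<le> p k" "i < n"
        using strict_mono_onD[OF p, of i k] by (cases "k = i"; auto)+
      with that False show False by auto
    qed
    then have "{k. k < n \<and> p k < t} \<subseteq> {..<i}" by auto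
    from card_mono[OF _ this] have "card {k. k < n \<and> p k < t} \<le> i" by simp
    with False c show ?thesis by auto
  qed
qed

lemma strict_mono_enum:
  fixes S :: "nat set"
  assumes "finite S"
  obtains s where "strict_mono_on {..<card S} s" "S = s ` {..<card S}"
proof
  let ?l = "sorted_list_of_set S"
  show "strict_mono_on {..<card S} ((!) ?l)"
    using strict_sorted_list_of_set[of S] assms
    by (auto simp: strict_mono_on_def sorted_wrt_nth_less)
  have "set ?l = (!) ?l ` {..<length ?l}" by (auto simp: set_conv_nth)
  then show "S = (!) ?l ` {..<card S}" using assms by simp
qed

lemma strict_mono_on_image_eq:
  fixes s s' :: "nat \<Rightarrow> nat"
  assumes "strict_mono_on {..<n} s" "strict_mono_on {..<n} s'" "s ` {..<n} = s' ` {..<n}" "i < n"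
  shows "s i = s' i"
proof -
  have "s i \<ge> t \<longleftrightarrow> s' i \<ge> t" for t
    using strict_mono_card_below[OF assms(1), of t i] strict_mono_card_below[OF assms(2), of t i] assms(3,4)
    by auto
  then show ?thesis by (meson order.refl order_antisym)
qed

lemma interlace_mono:
  assumes "s \<in> (\<Pi>\<^sub>E i\<in>{..<n}. {p i..<p (Suc i)})" and p: "strict_mono_on {..<Suc n} (p :: nat \<Rightarrow> nat)"
  shows "strict_mono_on {..<n} s"
proof (rule strict_mono_onI)
  fix i j assume ij: "i \<in> {..<n}" "j \<in> {..<n}" "i < j"
  then have "s i < p (Suc i)" "p j \<le> s j" using assms(1) by (auto simp: PiE_iff)
  moreover have "p (Suc i) \<le> p j"
    using strict_mono_onD[OF p, of "Suc i" j] ij by (cases "Suc i = j") auto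
  ultimately show "s i < s j" by simp
qed

text \<open>Since \<open>2 * s + 1\<close> lies between \<open>2 * p i\<close> and
  \<open>2 * p (Suc i)\<close> iff \<open>p i \<le> s < p (Suc i)\<close>, alternation of parities
  is interlacing of \<open>S\<close> with the \<open>p i\<close>. A row of odd length
  \<open>2 * l - 1\<close> begins and ends with an even vertex, so \<open>S\<close> has one element
  less.\<close>

lemma card_interlace_iff:
  assumes p: "strict_mono_on {..<Suc n} (p :: nat \<Rightarrow> nat)" and l: "\<And>i. i \<le> n \<Longrightarrow> p i < l"
    and S: "S \<subseteq> {..<l - 1}"
  shows "(let Q = row_set (p ` {..<Suc n}) S; M = 2 * l - 1
      in alternating Q M \<and> evens_below Q M = odds_below Q M + M mod 2)
    \<longleftrightarrow> S \<in> (\<lambda>s. s ` {..<n}) ` (\<Pi>\<^sub>E i\<in>{..<n}. {p i..<p (Suc i)})"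
proof -
  let ?P = "p ` {..<Suc n}"
  let ?Q = "row_set ?P S"
  have l0: "l > 0" using l[of 0] by simp
  then have M: "2 * l - 1 = Suc (2 * (l - 1))" by simp
  have Pl: "?P \<inter> {..l - 1} = ?P" using l by (force simp: less_Suc_eq_le)
  have cP: "card ?P = Suc n" using strict_mono_on_imp_inj_on[OF p] by (simp add: card_image)
  have Sl: "S \<inter> {..<l - 1} = S" using S by auto
  have atMost: "{..t} = {..<Suc t}" for t :: nat by auto
  have e_end: "evens_below ?Q (2 * l - 1) = Suc n" and o_end: "odds_below ?Q (2 * l - 1) = card S"
    unfolding M evens_below_row odds_below_row Pl Sl cP by simp_all
  have mod: "(2 * l - 1) mod 2 = 1" using M by presburger
  have Pb: "card (?P \<inter> {..<t}) \<le> i \<longleftrightarrow> (i < Suc n \<longrightarrow> t \<le> p i)" for t i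
    by (rule strict_mono_card_below[OF p])
  have fS: "finite S" using S finite_subset by blast
  show ?thesis unfolding Let_def e_end o_end mod
  proof
    assume A: "alternating ?Q (2 * l - 1) \<and> Suc n = card S + 1"
    then have cS: "card S = n" by simp
    obtain s where s: "strict_mono_on {..<n} s" "S = s ` {..<n}"
      using strict_mono_enum[OF fS] cS by metis
    have Sb: "card (S \<inter> {..<t}) \<le> i \<longleftrightarrow> (i < n \<longrightarrow> t \<le> s i)" for t i
      using strict_mono_card_below[OF s(1)] s(2) by simp
    \<comment> \<open>At the vertex \<open>2 * p i\<close> the even count jumps from
      \<open>i\<close> to \<open>Suc i\<close> while the odd count stays. Alternation before and
      after the jump leaves \<open>i\<close> as the only value of the odd count.\<close>
    have eq: "card (S \<inter> {..<p i}) = i" if "i \<le> n" for i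
    proof -
      have "p i \<le> l - 1" using l[OF that] by simp
      then have "2 * p i \<le> 2 * l - 1" "Suc (2 * p i) \<le> 2 * l - 1" using M by auto
      with A have 1: "card (?P \<inter> {..<p i}) = card (S \<inter> {..<p i}) \<or> card (?P \<inter> {..<p i}) = Suc (card (S \<inter> {..<p i}))"
        and 2: "card (?P \<inter> {..p i}) = card (S \<inter> {..<p i}) \<or> card (?P \<inter> {..p i}) = Suc (card (S \<inter> {..<p i}))"
        unfolding alternating_def by (metis evens_below_row odds_below_row)+
      have "card (?P \<inter> {..<p i}) \<le> i" using Pb[of "p i" i] by simp
      moreover have "\<not> card (?P \<inter> {..p i}) \<le> i" using Pb[of "Suc (p i)" i] that by (simp add: atMost)
      ultimately show ?thesis using 1 2 by auto
    qed
    have "p i \<le> s i" "s i < p (Suc i)" if "i < n" for i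
    proof -
      show "p i \<le> s i" using Sb[of "p i" i] eq[of i] that by simp
      show "s i < p (Suc i)" using Sb[of "p (Suc i)" i] eq[of "Suc i"] that by simp
    qed
    then have "restrict s {..<n} \<in> (\<Pi>\<^sub>E i\<in>{..<n}. {p i..<p (Suc i)})" by auto
    moreover have "S = restrict s {..<n} ` {..<n}" using s by auto
    ultimately show "S \<in> (\<lambda>s. s ` {..<n}) ` (\<Pi>\<^sub>E i\<in>{..<n}. {p i..<p (Suc i)})" by blast
  next
    assume "S \<in> (\<lambda>s. s ` {..<n}) ` (\<Pi>\<^sub>E i\<in>{..<n}. {p i..<p (Suc i)})"
    then obtain s where s: "s \<in> (\<Pi>\<^sub>E i\<in>{..<n}. {p i..<p (Suc i)})" and Ss: "S = s ` {..<n}" by blast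
    have sm: "strict_mono_on {..<n} s" by (rule interlace_mono[OF s p])
    have cS: "card S = n" using strict_mono_on_imp_inj_on[OF sm] Ss by (simp add: card_image)
    have Sb: "card (S \<inter> {..<t}) \<le> i \<longleftrightarrow> (i < n \<longrightarrow> t \<le> s i)" for t i
      using strict_mono_card_below[OF sm] Ss by simp
    have si: "p i \<le> s i" "s i < p (Suc i)" if "i < n" for i using s that by (auto simp: PiE_iff)
    have a: "card (S \<inter> {..<t}) \<le> card (?P \<inter> {..<t})" for t
    proof -
      have "card (?P \<inter> {..<t}) < n \<Longrightarrow> t \<le> s (card (?P \<inter> {..<t}))"
        using Pb[of t "card (?P \<inter> {..<t})"] si by fastforce
      then show ?thesis using Sb by blast
    qed
    have b: "card (?P \<inter> {..t}) \<le> Suc (card (S \<inter> {..<t}))" for t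
    proof -
      have "card (S \<inter> {..<t}) < n \<Longrightarrow> t < p (Suc (card (S \<inter> {..<t})))"
        using Sb[of t "card (S \<inter> {..<t})"] si by fastforce
      then show ?thesis using Pb[of "Suc t" "Suc (card (S \<inter> {..<t}))"] by (auto simp: atMost)
    qed
    have c: "card (?P \<inter> {..<t}) \<le> card (?P \<inter> {..t})" for t by (rule card_mono) auto
    have "evens_below ?Q i = odds_below ?Q i \<or> evens_below ?Q i = Suc (odds_below ?Q i)" for i
    proof (cases "even i")
      case True
      then obtain t where "i = 2 * t" by (elim evenE)
      then show ?thesis using a[of t] b[of t] c[of t] by (simp add: evens_below_row odds_below_row) arith
    next
      case False
      then obtain t where "i = Suc (2 * t)" by (elim oddE) auto
      then show ?thesis using a[of t] b[of t] c[of t] by (simp add: evens_below_row odds_below_row) arith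
    qed
    then show "alternating ?Q (2 * l - 1) \<and> Suc n = card S + 1" using cS by (simp add: alternating_def)
  qed
qed

text \<open>Interlacing confines each \<open>s i\<close> to its own interval, independently of the
  other coordinates, and the intervals force \<open>s\<close> to increase. The sum thereby takes the
  product form that \<open>sum_PiE_det\<close> needs.\<close>

lemma sum_matchings_row:
  fixes \<Phi> :: "nat set \<Rightarrow> 'a :: comm_semiring_1"
  assumes p: "strict_mono_on {..<Suc n} (p :: nat \<Rightarrow> nat)" and l: "\<And>i. i \<le> n \<Longrightarrow> p i < l"
  shows "(\<Sum>S\<in>Pow {..<l - 1}.
            of_nat (matchings path_adj ({..<2 * l - 1} - row_set (p ` {..<Suc n}) S)) * \<Phi> S)
    = (\<Sum>s\<in>(\<Pi>\<^sub>E i\<in>{..<n}. {p i..<p (Suc i)}). \<Phi> (s ` {..<n}))"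
proof -
  let ?X = "\<Pi>\<^sub>E i\<in>{..<n}. {p i..<p (Suc i)}"
  let ?I = "(\<lambda>s. s ` {..<n}) ` ?X"
  have inj: "inj_on (\<lambda>s. s ` {..<n}) ?X"
  proof (rule inj_onI)
    fix s s' assume s: "s \<in> ?X" "s' \<in> ?X" and eq: "s ` {..<n} = s' ` {..<n}"
    have "s i = s' i" if "i < n" for i
      using strict_mono_on_image_eq[OF interlace_mono[OF s(1) p] interlace_mono[OF s(2) p] eq that] .
    then show "s = s'" using s by (intro PiE_ext[of s _ _ s']) auto
  qed
  have sub: "?I \<subseteq> Pow {..<l - 1}"
  proof safe
    fix s i assume s: "s \<in> ?X" and i: "i < n"
    then have "s i < p (Suc i)" by (auto simp: PiE_iff)
    then show "s i < l - 1" using l[of "Suc i"] i by simp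
  qed
  have "(\<Sum>S\<in>Pow {..<l - 1}.
            of_nat (matchings path_adj ({..<2 * l - 1} - row_set (p ` {..<Suc n}) S)) * \<Phi> S)
    = (\<Sum>S\<in>Pow {..<l - 1}. if S \<in> ?I then \<Phi> S else 0)"
  proof (rule sum.cong[OF refl])
    fix S assume "S \<in> Pow {..<l - 1}"
    then have "S \<subseteq> {..<l - 1}" by simp
    from card_interlace_iff[OF p l this]
    show "of_nat (matchings path_adj ({..<2 * l - 1} - row_set (p ` {..<Suc n}) S)) * \<Phi> S
      = (if S \<in> ?I then \<Phi> S else 0)"
      unfolding matchings_path Let_def by auto
  qed
  also have "\<dots> = (\<Sum>S\<in>?I. \<Phi> S)"
    using sub by (simp add: sum.inter_restrict[symmetric] Int_absorb1)
  also have "\<dots> = (\<Sum>s\<in>?X. \<Phi> (s ` {..<n}))"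
    by (rule sum.reindex[OF inj, unfolded o_def])
  finally show ?thesis .
qed

section \<open>Determinants\<close>

lemma det_cong:
  assumes "\<And>i j. i < n \<Longrightarrow> j < n \<Longrightarrow> f i j = g i j"
  shows "det (mat n n (\<lambda>(i, j). f i j)) = det (mat n n (\<lambda>(i, j). g i j))"
  using assms by (intro arg_cong[of _ _ det] cong_mat) auto

lemma det_mat:
  "det (mat n n (\<lambda>(i, j). f i j :: 'a :: comm_ring_1))
    = (\<Sum>\<pi> | \<pi> permutes {0..<n}. signof \<pi> * (\<Prod>i = 0..<n. f i (\<pi> i)))"
proof -
  have "\<pi> i < n" if "\<pi> permutes {0..<n}" "i < n" for \<pi> i
    using permutes_in_image[OF that(1), of i] that(2) by simp
  then show ?thesis
    by (subst det_def'[of _ n]) (auto intro!: sum.cong prod.cong arg_cong2[where f = "(*)"])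
qed

lemma det_scale:
  fixes M :: "nat \<Rightarrow> nat \<Rightarrow> 'a :: comm_ring_1"
  shows "det (mat n n (\<lambda>(i, j). r i * c j * M i j)) = (\<Prod>i<n. r i) * (\<Prod>j<n. c j) * det (mat n n (\<lambda>(i, j). M i j))"
proof -
  have "signof \<pi> * (\<Prod>i = 0..<n. r i * c (\<pi> i) * M i (\<pi> i))
      = (\<Prod>i<n. r i) * (\<Prod>j<n. c j) * (signof \<pi> * (\<Prod>i = 0..<n. M i (\<pi> i)))"
    if "\<pi> permutes {0..<n}" for \<pi>
  proof -
    have "(\<Prod>i = 0..<n. c (\<pi> i)) = (\<Prod>j = 0..<n. c j)"
      using prod.permute[OF that, of c] by (simp add: o_def)
    then show ?thesis by (simp add: prod.distrib atLeast0LessThan algebra_simps)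
  qed
  then show ?thesis unfolding det_mat by (simp add: sum_distrib_left)
qed

text \<open>Multilinearity in the rows: row \<open>i\<close> depends on the coordinate
  \<open>s i\<close> only, and the coordinates vary independently.\<close>

lemma sum_PiE_det:
  fixes g :: "nat \<Rightarrow> 'b \<Rightarrow> nat \<Rightarrow> 'a :: comm_ring_1"
  assumes "\<And>i. i < n \<Longrightarrow> finite (B i)"
  shows "(\<Sum>s\<in>(\<Pi>\<^sub>E i\<in>{..<n}. B i). det (mat n n (\<lambda>(i, j). g i (s i) j)))
    = det (mat n n (\<lambda>(i, j). \<Sum>t\<in>B i. g i t j))"
proof -
  have "(\<Sum>s\<in>(\<Pi>\<^sub>E i\<in>{..<n}. B i). det (mat n n (\<lambda>(i, j). g i (s i) j)))
    = (\<Sum>\<pi> | \<pi> permutes {0..<n}. signof \<pi> * (\<Sum>s\<in>(\<Pi>\<^sub>E i\<in>{..<n}. B i). \<Prod>i<n. g i (s i) (\<pi> i)))"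
    unfolding det_mat by (subst sum.swap) (simp add: sum_distrib_left atLeast0LessThan)
  also have "\<dots> = (\<Sum>\<pi> | \<pi> permutes {0..<n}. signof \<pi> * (\<Prod>i<n. \<Sum>t\<in>B i. g i t (\<pi> i)))"
  proof (intro sum.cong refl arg_cong2[where f = "(*)"])
    fix \<pi> show "(\<Sum>s\<in>(\<Pi>\<^sub>E i\<in>{..<n}. B i). \<Prod>i<n. g i (s i) (\<pi> i)) = (\<Prod>i<n. \<Sum>t\<in>B i. g i t (\<pi> i))"
      using assms by (intro prod_sum_PiE[symmetric]) auto
  qed
  also have "\<dots> = det (mat n n (\<lambda>(i, j). \<Sum>t\<in>B i. g i t j))"
    unfolding det_mat by (simp add: atLeast0LessThan)
  finally show ?thesis .
qed

text \<open>Subtracting \<open>r i\<close> times row \<open>i\<close> from row \<open>Suc i\<close>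
  clears the first column below the entry 1. Read from right to left with \<open>r i = 1\<close>, it
  turns differences of consecutive rows into a determinant of size one larger; with quotients as
  \<open>r i\<close> it is the recursion for the Hankel determinant.\<close>

lemma det_eliminate:
  fixes H :: "nat \<Rightarrow> nat \<Rightarrow> 'a :: comm_ring_1"
  assumes H: "H 0 0 = 1" and elim: "\<And>i. i < n \<Longrightarrow> H (Suc i) 0 = r i * H i 0"
  shows "det (mat (Suc n) (Suc n) (\<lambda>(i, j). H i j))
    = det (mat n n (\<lambda>(i, j). H (Suc i) (Suc j) - r i * H i (Suc j)))"
proof -
  let ?N = "Suc n"
  \<comment> \<open>This unipotent bidiagonal matrix performs all row operations at once, each with
    the original preceding row.\<close>
  define L where "L = mat ?N ?N (\<lambda>(i, j). if i = j then 1 else if i = Suc j then - r j else 0)"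
  define R where "R = mat ?N ?N (\<lambda>(i, j). H i j - (case i of 0 \<Rightarrow> 0 | Suc k \<Rightarrow> r k * H k j))"
  have L: "L \<in> carrier_mat ?N ?N" by (simp add: L_def)
  have "det L = prod_list (diag_mat L)"
    by (rule det_lower_triangular[OF _ L]) (auto simp: L_def)
  also have "diag_mat L = map (\<lambda>i. 1) [0..<?N]"
    by (auto simp: diag_mat_def L_def simp del: upt_Suc)
  also have "prod_list \<dots> = 1" by (induction n) auto
  finally have detL: "det L = 1" .
  have "L * mat ?N ?N (\<lambda>(i, j). H i j) = R"
  proof (rule eq_matI)
    fix i j assume "i < dim_row R" "j < dim_col R"
    then have ij: "i < ?N" "j < ?N" by (auto simp: R_def)
    have "(L * mat ?N ?N (\<lambda>(i, j). H i j)) $$ (i, j)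
      = (\<Sum>k<?N. (if i = k then 1 else if i = Suc k then - r k else 0) * H k j)"
      using ij by (simp add: L_def scalar_prod_def atLeast0LessThan del: sum.lessThan_Suc sum.op_ivl_Suc)
    also have "\<dots> = (\<Sum>k<?N. (if i = k then H k j else 0) + (if i = Suc k then - r k * H k j else 0))"
      by (intro sum.cong) auto
    also have "\<dots> = H i j + (\<Sum>k<?N. if i = Suc k then - r k * H k j else 0)"
      using ij by (simp add: sum.distrib del: sum.lessThan_Suc)
    also have "(\<Sum>k<?N. if i = Suc k then - r k * H k j else 0) = - (case i of 0 \<Rightarrow> 0 | Suc k \<Rightarrow> r k * H k j)"
      using ij by (cases i) (auto simp del: sum.lessThan_Suc)
    finally show "(L * mat ?N ?N (\<lambda>(i, j). H i j)) $$ (i, j) = R $$ (i, j)"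
      using ij by (simp add: R_def)
  qed (auto simp: L_def R_def)
  with det_mult[OF L, of "mat ?N ?N (\<lambda>(i, j). H i j)"] detL
  have "det (mat ?N ?N (\<lambda>(i, j). H i j)) = det R" by simp
  also have "\<dots> = (\<Sum>i<?N. R $$ (i, 0) * cofactor R i 0)"
    by (rule laplace_expansion_column) (auto simp: R_def)
  also have "\<dots> = (\<Sum>i<?N. if i = 0 then cofactor R 0 0 else 0)"
    by (rule sum.cong) (auto simp: R_def H elim split: nat.splits)
  also have "\<dots> = cofactor R 0 0" by (simp del: sum.lessThan_Suc)
  also have "\<dots> = det (mat_delete R 0 0)" by (simp add: cofactor_def)
  also have "mat_delete R 0 0 = mat n n (\<lambda>(i, j). H (Suc i) (Suc j) - r i * H i (Suc j))"
    by (rule eq_matI) (auto simp: mat_delete_def R_def)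
  finally show ?thesis .
qed

text \<open>For every choice of nodes the \<open>j\<close>-th Newton polynomial is monic of degree
  \<open>j\<close>, so a unitriangular change of basis leads to the nodes \<open>X\<close>. With
  these the matrix is lower triangular and its diagonal carries the Vandermonde factors.\<close>

lemma det_newton:
  fixes X c :: "nat \<Rightarrow> 'a :: comm_ring_1"
  shows "det (mat n n (\<lambda>(i, j). \<Prod>v<j. X i - c v)) = (\<Prod>i<n. \<Prod>k<i. X i - X k)"
proof -
  have ex: "\<exists>t. t j = 1 \<and> (\<forall>x. (\<Prod>v<j. x - c v) = (\<Sum>k\<le>j. t k * (\<Prod>v<k. x - X v)))" for j
  proof (induction j)
    case 0
    show ?case by (rule exI[of _ "\<lambda>_. 1"]) simp
  next
    case (Suc j)
    then obtain t where t: "t j = 1" "\<And>x. (\<Prod>v<j. x - c v) = (\<Sum>k\<le>j. t k * (\<Prod>v<k. x - X v))" by blast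
    \<comment> \<open>From \<open>x - c j = (x - X k) + (X k - c j)\<close>: the first summand
      passes from basis element \<open>k\<close> to \<open>Suc k\<close>, the second stays at
      \<open>k\<close>.\<close>
    define u where "u k = (case k of 0 \<Rightarrow> 0 | Suc l \<Rightarrow> t l) + (if k \<le> j then t k * (X k - c j) else 0)" for k
    have "(\<Prod>v<Suc j. x - c v) = (\<Sum>k\<le>Suc j. u k * (\<Prod>v<k. x - X v))" for x
    proof -
      have "(\<Prod>v<Suc j. x - c v) = (\<Sum>k\<le>j. t k * (\<Prod>v<k. x - X v) * (x - c j))"
        by (simp add: t(2) sum_distrib_right)
      also have "\<dots> = (\<Sum>k\<le>j. t k * (\<Prod>v<Suc k. x - X v)) + (\<Sum>k\<le>j. t k * (X k - c j) * (\<Prod>v<k. x - X v))"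
        unfolding sum.distrib[symmetric] by (intro sum.cong) (auto simp: algebra_simps)
      also have "(\<Sum>k\<le>j. t k * (\<Prod>v<Suc k. x - X v))
          = (\<Sum>k\<le>Suc j. (case k of 0 \<Rightarrow> 0 | Suc l \<Rightarrow> t l) * (\<Prod>v<k. x - X v))"
        by (simp add: sum.atMost_Suc_shift del: sum.atMost_Suc prod.lessThan_Suc)
      also have "(\<Sum>k\<le>j. t k * (X k - c j) * (\<Prod>v<k. x - X v))
          = (\<Sum>k\<le>Suc j. (if k \<le> j then t k * (X k - c j) else 0) * (\<Prod>v<k. x - X v))"
        by simp
      also have "(\<Sum>k\<le>Suc j. (case k of 0 \<Rightarrow> 0 | Suc l \<Rightarrow> t l) * (\<Prod>v<k. x - X v)) + \<dots>
          = (\<Sum>k\<le>Suc j. u k * (\<Prod>v<k. x - X v))"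
        unfolding sum.distrib[symmetric] by (intro sum.cong) (auto simp: u_def algebra_simps)
      finally show ?thesis .
    qed
    moreover have "u (Suc j) = 1" by (simp add: u_def t)
    ultimately show ?case by blast
  qed
  then obtain t where t: "\<And>j. t j j = 1"
    "\<And>j x. (\<Prod>v<j. x - c v) = (\<Sum>k\<le>j. t j k * (\<Prod>v<k. x - X v))" by metis
  define N where "N = mat n n (\<lambda>(i, k). \<Prod>v<k. X i - X v)"
  define U where "U = mat n n (\<lambda>(k, j). if k \<le> j then t j k else 0)"
  have N: "N \<in> carrier_mat n n" and U: "U \<in> carrier_mat n n" by (auto simp: N_def U_def)
  have "mat n n (\<lambda>(i, j). \<Prod>v<j. X i - c v) = N * U"
  proof (rule eq_matI)
    fix i j assume "i < dim_row (N * U)" "j < dim_col (N * U)"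
    then have ij: "i < n" "j < n" by (auto simp: N_def U_def)
    have "(N * U) $$ (i, j) = (\<Sum>k<n. (\<Prod>v<k. X i - X v) * (if k \<le> j then t j k else 0))"
      using ij by (simp add: N_def U_def scalar_prod_def atLeast0LessThan)
    also have "\<dots> = (\<Sum>k\<le>j. t j k * (\<Prod>v<k. X i - X v))"
      using ij by (intro sum.mono_neutral_cong_right) auto
    finally show "mat n n (\<lambda>(i, j). \<Prod>v<j. X i - c v) $$ (i, j) = (N * U) $$ (i, j)"
      using ij by (simp add: t(2))
  qed (auto simp: N_def U_def)
  then have "det (mat n n (\<lambda>(i, j). \<Prod>v<j. X i - c v)) = det N * det U"
    using det_mult[OF N U] by simp
  also have "det U = prod_list (diag_mat U)"
    by (rule det_upper_triangular[OF _ U]) (auto simp: U_def)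
  also have "diag_mat U = map (\<lambda>i. 1) [0..<n]" by (auto simp: diag_mat_def U_def t)
  also have "prod_list \<dots> = 1" by (induction n) auto
  also have "det N = prod_list (diag_mat N)"
    by (rule det_lower_triangular[OF _ N]) (auto simp: N_def intro!: prod_zero)
  also have "diag_mat N = map (\<lambda>i. \<Prod>k<i. X i - X k) [0..<n]" by (auto simp: diag_mat_def N_def)
  also have "prod_list \<dots> = (\<Prod>i<n. \<Prod>k<i. X i - X k)"
    by (simp add: prod.distinct_set_conv_list[symmetric] atLeast0LessThan)
  finally show ?thesis by simp
qed

text \<open>A discrete Andreief (Cauchy-Binet) identity. Expanding the determinant of sums by rows
  gives a sum over all maps into \<open>X\<close>. Maps that are not injective produce two equal
  rows; an injective map amounts to its image \<open>S\<close> and a permutation, and summing over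
  the permutations restores the second determinant.\<close>

lemma sum_det_mult_det:
  fixes P Q :: "nat \<Rightarrow> nat \<Rightarrow> 'a :: {comm_ring_1}" and D E :: "nat set \<Rightarrow> 'a"
  assumes X: "finite X"
    and D: "\<And>s. strict_mono_on {..<n} s \<Longrightarrow> s ` {..<n} \<subseteq> X \<Longrightarrow> det (mat n n (\<lambda>(i, j). P j (s i))) = D (s ` {..<n})"
    and E: "\<And>s. strict_mono_on {..<n} s \<Longrightarrow> s ` {..<n} \<subseteq> X \<Longrightarrow> det (mat n n (\<lambda>(i, j). Q j (s i))) = E (s ` {..<n})"
  shows "(\<Sum>S | S \<subseteq> X \<and> card S = n. D S * E S * (\<Prod>t\<in>S. w t))
    = det (mat n n (\<lambda>(i, j). \<Sum>t\<in>X. w t * P i t * Q j t))"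
proof -
  define F where "F f = det (mat n n (\<lambda>(i, j). w (f i) * P i (f i) * Q j (f i)))" for f
  define G where "G = (\<lambda>(S :: nat set, \<pi> :: nat \<Rightarrow> nat). restrict (\<lambda>i. sorted_list_of_set S ! \<pi> i) {..<n})"
  let ?SP = "{S. S \<subseteq> X \<and> card S = n} \<times> {\<pi>. \<pi> permutes {0..<n}}"
  let ?PE = "\<Pi>\<^sub>E i\<in>{..<n}. X"
  have enum: "strict_mono_on {..<n} ((!) (sorted_list_of_set S))" "(!) (sorted_list_of_set S) ` {..<n} = S"
    if "S \<subseteq> X" "card S = n" for S
  proof -
    have fin: "finite S" using that X finite_subset by blast
    show "strict_mono_on {..<n} ((!) (sorted_list_of_set S))"
      using strict_sorted_list_of_set[of S] that fin
      by (auto simp: strict_mono_on_def sorted_wrt_nth_less)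
    have "set (sorted_list_of_set S) = (!) (sorted_list_of_set S) ` {..<length (sorted_list_of_set S)}"
      by (auto simp: set_conv_nth)
    then show "(!) (sorted_list_of_set S) ` {..<n} = S" using that fin by simp
  qed
  have pl: "\<pi> i < n \<longleftrightarrow> i < n" if "\<pi> permutes {0..<n}" for \<pi> i
    using permutes_in_image[OF that, of i] by simp
  have img: "G (S, \<pi>) ` {..<n} = S" if "S \<subseteq> X" "card S = n" "\<pi> permutes {0..<n}" for S \<pi>
  proof -
    have "G (S, \<pi>) ` {..<n} = (!) (sorted_list_of_set S) ` \<pi> ` {..<n}" by (force simp: G_def)
    also have "\<pi> ` {..<n} = {..<n}" using permutes_image[OF that(3)] by (simp add: atLeast0LessThan)
    finally show ?thesis using enum(2)[OF that(1,2)] by simp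
  qed
  have inj: "inj_on G ?SP"
  proof (rule inj_onI)
    fix x y assume "x \<in> ?SP" "y \<in> ?SP" "G x = G y"
    then obtain S \<pi> S' \<pi>' where x: "x = (S, \<pi>)" and y: "y = (S', \<pi>')"
      and S: "S \<subseteq> X" "card S = n" and S': "S' \<subseteq> X" "card S' = n"
      and pi: "\<pi> permutes {0..<n}" "\<pi>' permutes {0..<n}" and eq: "G (S, \<pi>) = G (S', \<pi>')"
      by auto
    from img[OF S pi(1)] img[OF S' pi(2)] eq have SS: "S = S'" by simp
    have "\<pi> i = \<pi>' i" for i
    proof (cases "i < n")
      case True
      from fun_cong[OF eq, of i] True SS
      have "sorted_list_of_set S ! \<pi> i = sorted_list_of_set S ! \<pi>' i" by (simp add: G_def)
      then show ?thesis
        using inj_onD[OF strict_mono_on_imp_inj_on[OF enum(1)[OF S]]] True pl[OF pi(1)] pl[OF pi(2)] by auto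
    next
      case False
      then show ?thesis using permutes_not_in[OF pi(1), of i] permutes_not_in[OF pi(2), of i] by simp
    qed
    with SS x y show "x = y" by auto
  qed
  have ran: "G ` ?SP = {f \<in> ?PE. inj_on f {..<n}}"
  proof (intro equalityI subsetI)
    fix f assume "f \<in> G ` ?SP"
    then obtain S \<pi> where f: "f = G (S, \<pi>)" and S: "S \<subseteq> X" "card S = n" and pi: "\<pi> permutes {0..<n}"
      by auto
    have "f ` {..<n} = S" using img[OF S pi] f by simp
    moreover from this S have "inj_on f {..<n}" by (intro eq_card_imp_inj_on) auto
    moreover have "f \<in> extensional {..<n}" by (auto simp: f G_def)
    ultimately show "f \<in> {f \<in> ?PE. inj_on f {..<n}}" using S by (auto simp: PiE_iff)
  next
    fix f assume f: "f \<in> {f \<in> ?PE. inj_on f {..<n}}"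
    define S where "S = f ` {..<n}"
    have S: "S \<subseteq> X" "card S = n" using f by (auto simp: S_def card_image)
    let ?s = "(!) (sorted_list_of_set S)"
    have bs: "bij_betw ?s {..<n} S"
      using strict_mono_on_imp_inj_on[OF enum(1)[OF S]] enum(2)[OF S] by (simp add: bij_betw_def)
    have bf: "bij_betw f {..<n} S" using f by (simp add: bij_betw_def S_def)
    \<comment> \<open>The position of \<open>f i\<close> in the sorted list of \<open>S\<close>;
      outside the range it is the identity, as \<open>permutes\<close> demands.\<close>
    define \<pi> where "\<pi> i = (if i < n then the_inv_into {..<n} ?s (f i) else i)" for i
    have "bij_betw (the_inv_into {..<n} ?s \<circ> f) {..<n} {..<n}"
      by (rule bij_betw_trans[OF bf bij_betw_the_inv_into[OF bs]])
    then have "bij_betw \<pi> {0..<n} {0..<n}"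
      unfolding atLeast0LessThan by (subst bij_betw_cong[of _ _ "the_inv_into {..<n} ?s \<circ> f"]) (auto simp: \<pi>_def)
    then have pi: "\<pi> permutes {0..<n}" by (rule bij_imp_permutes) (auto simp: \<pi>_def)
    have "f = G (S, \<pi>)"
    proof (rule ext)
      fix i show "f i = G (S, \<pi>) i"
      proof (cases "i < n")
        case True
        then have "?s (\<pi> i) = f i"
          using f_the_inv_into_f_bij_betw[OF bs, of "f i"] by (auto simp: \<pi>_def S_def)
        with True show ?thesis by (simp add: G_def)
      next
        case False
        then show ?thesis using f by (auto simp: G_def PiE_iff extensional_def)
      qed
    qed
    then show "f \<in> G ` ?SP" using S pi by auto
  qed
  have F: "F f = (\<Prod>i<n. w (f i)) * (\<Prod>i<n. P i (f i)) * det (mat n n (\<lambda>(i, j). Q j (f i)))" for f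
    using det_scale[of n "\<lambda>i. w (f i) * P i (f i)" "\<lambda>_. 1" "\<lambda>i j. Q j (f i)"]
    by (simp add: F_def prod.distrib)
  have noninj: "F f = 0" if "\<not> inj_on f {..<n}" for f
  proof -
    from that obtain i j where "i < n" "j < n" "i \<noteq> j" "f i = f j" by (auto simp: inj_on_def)
    then have "det (mat n n (\<lambda>(i, j). Q j (f i))) = 0"
      by (intro det_identical_rows[of _ n i j]) (auto simp: row_def)
    then show ?thesis by (simp add: F)
  qed
  have "det (mat n n (\<lambda>(i, j). \<Sum>t\<in>X. w t * P i t * Q j t)) = (\<Sum>f\<in>?PE. F f)"
    using sum_PiE_det[of n "\<lambda>_. X" "\<lambda>i t j. w t * P i t * Q j t"] X by (simp add: F_def)
  also have "\<dots> = (\<Sum>f\<in>{f \<in> ?PE. inj_on f {..<n}}. F f)"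
    using X noninj by (intro sum.mono_neutral_right) (auto intro!: finite_PiE)
  also have "\<dots> = (\<Sum>x\<in>?SP. F (G x))"
    unfolding ran[symmetric] by (rule sum.reindex[OF inj, unfolded o_def])
  also have "\<dots> = (\<Sum>S | S \<subseteq> X \<and> card S = n. \<Sum>\<pi> | \<pi> permutes {0..<n}. F (G (S, \<pi>)))"
    by (subst sum.cartesian_product) simp
  also have "\<dots> = (\<Sum>S | S \<subseteq> X \<and> card S = n. D S * E S * (\<Prod>t\<in>S. w t))"
  proof (rule sum.cong[OF refl])
    fix S assume "S \<in> {S. S \<subseteq> X \<and> card S = n}"
    then have S: "S \<subseteq> X" "card S = n" by auto
    let ?s = "(!) (sorted_list_of_set S)"
    note en = enum[OF S]
    have W: "(\<Prod>i<n. w (?s i)) = (\<Prod>t\<in>S. w t)"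
      using prod.reindex[OF strict_mono_on_imp_inj_on[OF en(1)], of w] en(2) by (simp add: o_def)
    have "F (G (S, \<pi>)) = (\<Prod>t\<in>S. w t) * (signof \<pi> * (\<Prod>i=0..<n. P i (?s (\<pi> i)))) * E S"
      if pi: "\<pi> permutes {0..<n}" for \<pi>
    proof -
      have Gi: "G (S, \<pi>) i = ?s (\<pi> i)" if "i < n" for i using that by (simp add: G_def)
      have "(\<Prod>i<n. w (G (S, \<pi>) i)) = (\<Prod>i=0..<n. w (?s (\<pi> i)))"
        unfolding atLeast0LessThan by (intro prod.cong) (auto simp: Gi)
      also have "\<dots> = (\<Prod>t\<in>S. w t)"
        using prod.permute[OF pi, of "\<lambda>i. w (?s i)"] W by (simp add: o_def atLeast0LessThan)
      finally have 1: "(\<Prod>i<n. w (G (S, \<pi>) i)) = (\<Prod>t\<in>S. w t)" .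
      have 2: "(\<Prod>i<n. P i (G (S, \<pi>) i)) = (\<Prod>i=0..<n. P i (?s (\<pi> i)))"
        unfolding atLeast0LessThan by (intro prod.cong) (auto simp: Gi)
      have "det (mat n n (\<lambda>(i, j). Q j (G (S, \<pi>) i)))
        = det (mat n n (\<lambda>(i, j). mat n n (\<lambda>(i, j). Q j (?s i)) $$ (\<pi> i, j)))"
        using pl[OF pi] by (intro det_cong) (auto simp: Gi)
      also have "\<dots> = signof \<pi> * E S"
        using det_permute_rows[OF _ pi, of "mat n n (\<lambda>(i, j). Q j (?s i))"] E[OF en(1)] en(2) S by simp
      finally show ?thesis unfolding F 1 2 by (simp add: algebra_simps)
    qed
    then have "(\<Sum>\<pi> | \<pi> permutes {0..<n}. F (G (S, \<pi>)))
      = (\<Prod>t\<in>S. w t) * det (mat n n (\<lambda>(i, j). P i (?s j))) * E S"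
      unfolding det_mat by (simp add: sum_distrib_left sum_distrib_right)
    also have "det (mat n n (\<lambda>(i, j). P i (?s j))) = det (mat n n (\<lambda>(i, j). P j (?s i)))"
    proof -
      have "transpose_mat (mat n n (\<lambda>(i, j). P j (?s i))) = mat n n (\<lambda>(i, j). P i (?s j))"
        by (rule eq_matI) auto
      then show ?thesis using det_transpose[of "mat n n (\<lambda>(i, j). P j (?s i))" n] by simp
    qed
    also have "\<dots> = D S" using D[OF en(1)] en(2) S by simp
    finally show "(\<Sum>\<pi> | \<pi> permutes {0..<n}. F (G (S, \<pi>))) = D S * E S * (\<Prod>t\<in>S. w t)"
      by (simp add: algebra_simps)
  qed
  finally show ?thesis by simp
qed

section \<open>A discrete Selberg sum on a quadratic lattice\<close>

text \<open>Up to an additive constant this is \<open>(s + 1/2)\<^sup>2\<close>.\<close>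

definition qlat :: "nat \<Rightarrow> real" where
  "qlat s = real s * (real s + 1)"

lemma qlat_diff: "qlat s - qlat t = (real s - real t) * (real s + real t + 1)"
  by (simp add: qlat_def algebra_simps)

section \<open>Moments on the quadratic lattice and a Hankel determinant\<close>

definition qmoment :: "nat \<Rightarrow> nat \<Rightarrow> nat \<Rightarrow> real" where
  "qmoment a B c = (\<Sum>s<B. (\<Prod>v<a. qlat s - qlat v) * (\<Prod>v<c. qlat (B + v) - qlat s))"

text \<open>The factors \<open>(s - v) * (s + v + 1)\<close> fill a run of consecutive numbers that
  is symmetric about \<open>s + 1/2\<close>.\<close>

lemma prod_qlat_pochhammer:
  "(\<Prod>v<a. qlat s - qlat v) = pochhammer (real s + 1 - real a) (2 * a)"
proof (induction a)
  case (Suc a)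
  have "pochhammer (real s + 1 - real (Suc a)) (2 * Suc a)
    = (real s - real a) * pochhammer (real s + 1 - real a) (2 * a + 1)"
    using pochhammer_rec[of "real s - real a" "2 * a + 1"] by (simp add: algebra_simps)
  also have "\<dots> = (real s - real a) * (pochhammer (real s + 1 - real a) (2 * a) * (real s + 1 + real a))"
    using pochhammer_Suc[of "real s + 1 - real a" "2 * a"] by (simp add: algebra_simps)
  finally show ?case using Suc by (simp add: qlat_diff algebra_simps)
qed simp

text \<open>The terms are Pochhammer symbols of fixed length with arguments in steps of 1, so the
  sum telescopes.\<close>

lemma qmoment_0: "qmoment a B 0 = pochhammer (real B - real a) (2 * a + 1) / (2 * real a + 1)"
proof -
  have "(\<Sum>s<B. pochhammer (real s + 1 - real a) (2 * a)) * (2 * real a + 1)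
      = pochhammer (real B - real a) (2 * a + 1)"
  proof (induction B)
    case 0
    have "pochhammer (0 - real a) (2 * a + 1) = 0"
      by (subst pochhammer_eq_0_iff) (auto intro!: exI[of _ a])
    then show ?case by simp
  next
    case (Suc B)
    let ?p = "pochhammer (real B + 1 - real a) (2 * a)"
    have "pochhammer (real B - real a) (2 * a + 1) = (real B - real a) * ?p"
      using pochhammer_rec[of "real B - real a" "2 * a"] by (simp add: algebra_simps)
    moreover have "pochhammer (real (Suc B) - real a) (2 * a + 1) = ?p * (real B + 1 + real a)"
      using pochhammer_Suc[of "real B + 1 - real a" "2 * a"] by (simp add: algebra_simps)
    ultimately show ?case using Suc by (simp add: algebra_simps)
  qed
  then show ?thesis by (simp add: qmoment_def prod_qlat_pochhammer field_simps)
qed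

text \<open>Write \<open>qlat (B + c) - qlat s\<close> as
  \<open>(qlat (B + c) - qlat a) - (qlat s - qlat a)\<close>; the last bracket is the next factor of
  the left product.\<close>

lemma qmoment_Suc: "qmoment a B (Suc c) = (qlat (B + c) - qlat a) * qmoment a B c - qmoment (Suc a) B c"
  unfolding qmoment_def sum_distrib_left sum_subtractf[symmetric]
  by (intro sum.cong) (simp_all add: algebra_simps)

text \<open>Induction on \<open>c\<close> for all \<open>a\<close> at once, because
  \<open>qmoment_Suc\<close> trades a factor on the right for one on the left. The symbols at
  \<open>1/2\<close> collect the denominators \<open>2 * a + 1\<close> of the base case; the step
  boils down to the polynomial identity \<open>key\<close>.\<close>

lemma qmoment_eq:
  "qmoment a B c = fact c * pochhammer (1/2) a * pochhammer (real B + 1/2) c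
     * pochhammer (real B - real a) (2 * a + 1) * pochhammer (real B + real a + 1) c
     / (2 * pochhammer (1/2) (a + c + 1))"
proof (induction c arbitrary: a)
  case 0
  have "pochhammer (1/2 :: real) a \<noteq> 0" by (simp add: pochhammer_eq_0_iff) 
  moreover have "2 * pochhammer (1/2 :: real) (a + 0 + 1) = pochhammer (1/2) a * (2 * real a + 1)"
    using pochhammer_Suc[of "1/2 :: real" a] by (simp add: algebra_simps)
  ultimately show ?case unfolding qmoment_0 by simp
next
  case (Suc c)
  define b where "b = real B"
  define \<alpha> where "\<alpha> = real a"
  define \<gamma> where "\<gamma> = real c"
  let ?p = "pochhammer (1/2 :: real) a" and ?q = "pochhammer (b + 1/2) c"
  let ?u = "pochhammer (b - \<alpha>) (2 * a + 1)" and ?v = "pochhammer (b + \<alpha> + 1) c"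
  let ?w = "pochhammer (1/2 :: real) (a + c + 1)"
  have w0: "?w \<noteq> 0" by (simp add: pochhammer_eq_0_iff)
  have den: "\<alpha> + \<gamma> + 3/2 \<noteq> 0" using of_nat_0_le_iff[of a] of_nat_0_le_iff[of c] unfolding \<alpha>_def \<gamma>_def by linarith
  have w1: "pochhammer (1/2 :: real) (a + Suc c + 1) = ?w * (\<alpha> + \<gamma> + 3/2)"
    using pochhammer_Suc[of "1/2 :: real" "a + c + 1"] by (simp add: \<alpha>_def \<gamma>_def algebra_simps)
  have w2: "pochhammer (1/2 :: real) (Suc a + c + 1) = ?w * (\<alpha> + \<gamma> + 3/2)"
    using w1 by simp
  have p1: "pochhammer (1/2 :: real) (Suc a) = ?p * (\<alpha> + 1/2)"
    using pochhammer_Suc[of "1/2 :: real" a] by (simp add: \<alpha>_def algebra_simps)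
  have q1: "pochhammer (b + 1/2) (Suc c) = ?q * (b + \<gamma> + 1/2)"
    using pochhammer_Suc[of "b + 1/2" c] by (simp add: \<gamma>_def algebra_simps)
  have v1: "pochhammer (b + \<alpha> + 1) (Suc c) = ?v * (b + \<alpha> + \<gamma> + 1)"
    using pochhammer_Suc[of "b + \<alpha> + 1" c] by (simp add: \<gamma>_def algebra_simps)
  \<comment> \<open>Both products are a single run of consecutive factors, and passing from
    \<open>a\<close> to \<open>Suc a\<close> lengthens the run by one factor at each end.\<close>
  have uv: "pochhammer (b - real (Suc a)) (2 * Suc a + 1) * pochhammer (b + real (Suc a) + 1) c
      = ?u * ?v * ((b - \<alpha> - 1) * (b + \<alpha> + \<gamma> + 1))"
  proof -
    have "pochhammer (b - real (Suc a)) (2 * Suc a + 1) = (b - \<alpha> - 1) * pochhammer (b - \<alpha>) (2 * a + 2)"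
      using pochhammer_rec[of "b - \<alpha> - 1" "2 * a + 2"] by (simp add: \<alpha>_def algebra_simps)
    also have "pochhammer (b - \<alpha>) (2 * a + 2) = ?u * (b + \<alpha> + 1)"
      using pochhammer_Suc[of "b - \<alpha>" "2 * a + 1"] by (simp add: \<alpha>_def algebra_simps)
    finally have 1: "pochhammer (b - real (Suc a)) (2 * Suc a + 1) = (b - \<alpha> - 1) * (?u * (b + \<alpha> + 1))" .
    have 2: "(b + \<alpha> + 1) * pochhammer (b + real (Suc a) + 1) c = ?v * (b + \<alpha> + \<gamma> + 1)"
      using pochhammer_rec[of "b + \<alpha> + 1" c] v1 by (simp add: \<alpha>_def algebra_simps)
    have "pochhammer (b - real (Suc a)) (2 * Suc a + 1) * pochhammer (b + real (Suc a) + 1) c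
        = (b - \<alpha> - 1) * ?u * ((b + \<alpha> + 1) * pochhammer (b + real (Suc a) + 1) c)"
      unfolding 1 by (simp only: mult_ac)
    then show ?thesis unfolding 2 by (simp only: mult_ac)
  qed
  define C where "C = fact c * ?p * ?q * ?u * ?v / (2 * ?w)"
  have m0: "qmoment a B c = C" using Suc[of a] by (simp add: C_def b_def \<alpha>_def)
  have "qmoment (Suc a) B c = fact c * pochhammer (1/2) (Suc a) * ?q
      * (pochhammer (b - real (Suc a)) (2 * Suc a + 1) * pochhammer (b + real (Suc a) + 1) c)
      / (2 * pochhammer (1/2) (Suc a + c + 1))"
    using Suc[of "Suc a"] by (simp only: b_def mult_ac)
  also have "\<dots> = C * ((\<alpha> + 1/2) * (b - \<alpha> - 1) * (b + \<alpha> + \<gamma> + 1) / (\<alpha> + \<gamma> + 3/2))"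
    unfolding uv p1 w2 C_def using w0 den by (simp add: divide_simps)
  finally have m1: "qmoment (Suc a) B c = C * ((\<alpha> + 1/2) * (b - \<alpha> - 1) * (b + \<alpha> + \<gamma> + 1) / (\<alpha> + \<gamma> + 3/2))" .
  have x: "qlat (B + c) - qlat a = (b + \<gamma> - \<alpha>) * (b + \<alpha> + \<gamma> + 1)"
    by (simp add: qlat_diff b_def \<alpha>_def \<gamma>_def algebra_simps)
  have key: "(b + \<gamma> - \<alpha>) * (\<alpha> + \<gamma> + 3/2) - (\<alpha> + 1/2) * (b - \<alpha> - 1) = (\<gamma> + 1) * (b + \<gamma> + 1/2)"
    by (simp add: field_simps)
  have "qmoment a B (Suc c) = C * (b + \<alpha> + \<gamma> + 1)
      * ((b + \<gamma> - \<alpha>) * (\<alpha> + \<gamma> + 3/2) - (\<alpha> + 1/2) * (b - \<alpha> - 1)) / (\<alpha> + \<gamma> + 3/2)"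
    unfolding qmoment_Suc m0 m1 x using den by (simp add: field_simps)
  also have "\<dots> = C * (b + \<alpha> + \<gamma> + 1) * ((\<gamma> + 1) * (b + \<gamma> + 1/2)) / (\<alpha> + \<gamma> + 3/2)"
    unfolding key ..
  also have "\<dots> = fact (Suc c) * ?p * pochhammer (b + 1/2) (Suc c) * ?u * pochhammer (b + \<alpha> + 1) (Suc c)
      / (2 * pochhammer (1/2) (a + Suc c + 1))"
    unfolding q1 v1 w1 C_def using w0 den by (simp add: divide_simps \<gamma>_def)
  finally show ?case by (simp only: b_def \<alpha>_def)
qed

text \<open>Elimination with \<open>r i = (p + i) / (q + i)\<close> reproduces the same shape with
  \<open>p + 1\<close> and \<open>q + 2\<close>, up to factors that depend on the row or on the
  column only; note \<open>(q + 2) - (p + 1) = (q - p) + 1\<close>. The order of the quantifiers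
  matters: \<open>\<kappa>\<close> depends on \<open>q\<close> and \<open>n\<close> but is the same
  for all \<open>p\<close>.\<close>

lemma det_pochhammer_hankel:
  fixes q :: real
  assumes "q > 0"
  shows "\<exists>\<kappa>. \<forall>p. det (mat n n (\<lambda>(i, j). pochhammer p (i + j) / pochhammer q (i + j)))
    = \<kappa> * (\<Prod>k<n. pochhammer p k * pochhammer (q - p) k)"
  using assms
proof (induction n arbitrary: q)
  case 0
  show ?case by (rule exI[of _ 1]) simp
next
  case (Suc n)
  have q2: "q + 2 > 0" using Suc.prems by simp
  from Suc.IH[OF q2] obtain \<kappa> where \<kappa>: "\<And>p. det (mat n n (\<lambda>(i, j). pochhammer p (i + j) / pochhammer (q + 2) (i + j)))
    = \<kappa> * (\<Prod>k<n. pochhammer p k * pochhammer (q + 2 - p) k)" by blast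
  have pos: "pochhammer q k > 0" "pochhammer (q + 2) k > 0" for k
    using Suc.prems by (auto intro: pochhammer_pos)
  define \<kappa>' where "\<kappa>' = \<kappa> * (\<Prod>i<n. real (Suc i) / (q * (q + 1))) * (\<Prod>j<n. 1 / (q + real j))"
  have "det (mat (Suc n) (Suc n) (\<lambda>(i, j). pochhammer p (i + j) / pochhammer q (i + j)))
    = \<kappa>' * (\<Prod>k<Suc n. pochhammer p k * pochhammer (q - p) k)" for p
  proof -
    have qj: "q + real j \<noteq> 0" for j using Suc.prems by (smt (verit) of_nat_0_le_iff)
    have "det (mat (Suc n) (Suc n) (\<lambda>(i, j). pochhammer p (i + j) / pochhammer q (i + j)))
      = det (mat n n (\<lambda>(i, j). pochhammer p (Suc i + Suc j) / pochhammer q (Suc i + Suc j)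
          - (p + real i) / (q + real i) * (pochhammer p (i + Suc j) / pochhammer q (i + Suc j))))"
      by (rule det_eliminate) (use qj pos(1) in \<open>auto simp: pochhammer_Suc mult.commute\<close>)
    also have "\<dots> = det (mat n n (\<lambda>(i, j). (p * (q - p) / (q * (q + 1) * (q + real i))) * real (Suc j)
        * (pochhammer (p + 1) (i + j) / pochhammer (q + 2) (i + j))))"
    proof (rule det_cong)
      fix i j
      have p1: "pochhammer p (Suc (i + j)) = p * pochhammer (p + 1) (i + j)" by (rule pochhammer_rec)
      have q1: "pochhammer q (Suc (Suc (i + j))) = q * (q + 1) * pochhammer (q + 2) (i + j)"
        using pochhammer_rec[of q "Suc (i + j)"] pochhammer_rec[of "q + 1" "i + j"] by (simp add: add.assoc)
      have q2: "pochhammer q (Suc (Suc (i + j))) = pochhammer q (Suc (i + j)) * (q + real (Suc (i + j)))"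
        by (rule pochhammer_Suc)
      have p2: "pochhammer p (Suc (Suc (i + j))) = pochhammer p (Suc (i + j)) * (p + real (Suc (i + j)))"
        by (rule pochhammer_Suc)
      have gen: "P * A / (Q * N) - r * (P / Q) = P * (A - r * N) / (Q * N)"
        if "Q \<noteq> 0" "N \<noteq> 0" for P A Q N r :: real
        using that by (simp add: field_simps)
      have "pochhammer p (Suc i + Suc j) / pochhammer q (Suc i + Suc j)
          - (p + real i) / (q + real i) * (pochhammer p (i + Suc j) / pochhammer q (i + Suc j))
        = pochhammer p (Suc (i + j)) * ((p + real (Suc (i + j))) - (p + real i) / (q + real i) * (q + real (Suc (i + j))))
          / pochhammer q (Suc (Suc (i + j)))"
        unfolding add_Suc add_Suc_right q2 p2
        by (rule gen[OF _ qj]) (use pos(1)[of "Suc (i + j)"] in simp)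
      also have "(p + real (Suc (i + j))) - (p + real i) / (q + real i) * (q + real (Suc (i + j)))
        = (q - p) * real (Suc j) / (q + real i)"
        using qj[of i] by (simp add: field_simps)
      also have "pochhammer p (Suc (i + j)) * ((q - p) * real (Suc j) / (q + real i)) / pochhammer q (Suc (Suc (i + j)))
        = (p * (q - p) / (q * (q + 1) * (q + real i))) * real (Suc j)
        * (pochhammer (p + 1) (i + j) / pochhammer (q + 2) (i + j))"
        unfolding p1 q1 by (simp add: mult_ac)
      finally show "pochhammer p (Suc i + Suc j) / pochhammer q (Suc i + Suc j)
          - (p + real i) / (q + real i) * (pochhammer p (i + Suc j) / pochhammer q (i + Suc j))
        = (p * (q - p) / (q * (q + 1) * (q + real i))) * real (Suc j)
        * (pochhammer (p + 1) (i + j) / pochhammer (q + 2) (i + j))" .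
    qed
    also have "\<dots> = (\<Prod>i<n. p * (q - p) / (q * (q + 1) * (q + real i))) * (\<Prod>j<n. real (Suc j))
        * (\<kappa> * (\<Prod>k<n. pochhammer (p + 1) k * pochhammer (q - p + 1) k))"
      unfolding det_scale \<kappa> by (simp add: algebra_simps)
    also have "\<dots> = \<kappa>' * (\<Prod>k<n. (p * pochhammer (p + 1) k) * ((q - p) * pochhammer (q - p + 1) k))"
      unfolding \<kappa>'_def by (simp add: prod.distrib prod_dividef divide_simps)
    also have "\<dots> = \<kappa>' * (\<Prod>k<n. pochhammer p (Suc k) * pochhammer (q - p) (Suc k))"
      by (simp add: pochhammer_rec)
    finally show ?thesis unfolding prod.lessThan_Suc_shift by simp
  qed
  then show ?case by blast
qed

section \<open>Vandermonde products and the sum over the points of the gap\<close>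

definition vand :: "nat set \<Rightarrow> real" where
  "vand S = (\<Prod>t\<in>S. \<Prod>s\<in>{s\<in>S. s < t}. qlat t - qlat s)"

lemma strict_mono_image_below:
  fixes s :: "nat \<Rightarrow> nat"
  assumes s: "strict_mono_on {..<n} s" and i: "i < n"
  shows "{u \<in> s ` {..<n}. u < s i} = s ` {..<i}"
proof -
  have "s k < s i \<longleftrightarrow> k < i" if "k < n" for k
    using strict_mono_onD[OF s, of k i] strict_mono_onD[OF s, of i k] that i
    by (cases k i rule: linorder_cases) auto
  then show ?thesis using i by auto
qed

lemma det_newton_vand:
  assumes s: "strict_mono_on {..<n} s"
  shows "det (mat n n (\<lambda>(i, j). \<Prod>v<j. qlat (s i) - c v)) = vand (s ` {..<n})"
proof -
  have inj: "inj_on s {..<n}" using s by (rule strict_mono_on_imp_inj_on)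
  have "vand (s ` {..<n}) = (\<Prod>i<n. \<Prod>u\<in>{u \<in> s ` {..<n}. u < s i}. qlat (s i) - qlat u)"
    unfolding vand_def by (rule prod.reindex[OF inj, unfolded o_def])
  also have "\<dots> = (\<Prod>i<n. \<Prod>k<i. qlat (s i) - qlat (s k))"
  proof (rule prod.cong[OF refl])
    fix i assume "i \<in> {..<n}"
    then have i: "i < n" by simp
    have "inj_on s {..<i}" using inj by (rule inj_on_subset) (use i in auto)
    then show "(\<Prod>u\<in>{u \<in> s ` {..<n}. u < s i}. qlat (s i) - qlat u) = (\<Prod>k<i. qlat (s i) - qlat (s k))"
      unfolding strict_mono_image_below[OF s i] by (simp add: prod.reindex)
  qed
  finally show ?thesis by (simp add: det_newton)
qed

text \<open>A discrete analogue of Selberg's integral. The weight of \<open>t\<close> consists of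
  its differences to the fixed points \<open>{..<a}\<close> and \<open>{B..<B + c}\<close>. Points
  \<open>t < a\<close> have weight 0, so \<open>S\<close> effectively lies in the gap; admitting
  them matches the summation range of \<open>qmoment\<close>.\<close>

definition selberg_sum :: "nat \<Rightarrow> nat \<Rightarrow> nat \<Rightarrow> nat \<Rightarrow> real" where
  "selberg_sum y a B c = (\<Sum>S | S \<subseteq> {..<B} \<and> card S = y. vand S * vand S *
      (\<Prod>t\<in>S. (\<Prod>v<a. qlat t - qlat v) * (\<Prod>v<c. qlat (B + v) - qlat t)))"

text \<open>The two Vandermonde factors are expanded in Newton bases whose nodes start at
  \<open>a\<close> and at \<open>B + c\<close>, where the two products of the weight stop. Hence
  each entry of the Andreief determinant is again a moment. The second basis uses reversed
  differences, which accounts for the signs.\<close>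

lemma selberg_sum_det:
  "selberg_sum y a B c * (\<Prod>j<y. (-1) ^ j) = det (mat y y (\<lambda>(i, j). qmoment (a + i) B (c + j)))"
proof -
  define \<sigma> :: real where "\<sigma> = (\<Prod>j<y. (-1) ^ j)"
  define P Q where "P j t = (\<Prod>v<j. qlat t - qlat (a + v))"
    and "Q j t = (\<Prod>v<j. qlat (B + (c + v)) - qlat t)" for j t
  define w where "w t = (\<Prod>v<a. qlat t - qlat v) * (\<Prod>v<c. qlat (B + v) - qlat t)" for t
  have "det (mat y y (\<lambda>(i, j). P j (s i))) = vand (s ` {..<y})" if "strict_mono_on {..<y} s" for s
    unfolding P_def by (rule det_newton_vand[OF that])
  moreover have "det (mat y y (\<lambda>(i, j). Q j (s i))) = \<sigma> * vand (s ` {..<y})"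
    if s: "strict_mono_on {..<y} s" for s
  proof -
    have "Q j t = 1 * (-1) ^ j * (\<Prod>v<j. qlat t - qlat (B + (c + v)))" for j t
      by (induction j) (simp_all add: Q_def algebra_simps)
    then show ?thesis
      using det_scale[of y "\<lambda>_. 1" "\<lambda>j. (-1) ^ j" "\<lambda>i j. \<Prod>v<j. qlat (s i) - qlat (B + (c + v))"]
        det_newton_vand[OF s] by (simp add: \<sigma>_def)
  qed
  ultimately have "(\<Sum>S | S \<subseteq> {..<B} \<and> card S = y. vand S * (\<sigma> * vand S) * (\<Prod>t\<in>S. w t))
    = det (mat y y (\<lambda>(i, j). \<Sum>t<B. w t * P i t * Q j t))"
    by (intro sum_det_mult_det) auto
  moreover have "(\<Sum>t<B. w t * P i t * Q j t) = qmoment (a + i) B (c + j)" for i j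
    unfolding qmoment_def
  proof (rule sum.cong[OF refl])
    fix t
    have "(\<Prod>v<a + i. qlat t - qlat v) = (\<Prod>v<a. qlat t - qlat v) * P i t" for t
      by (induction i) (simp_all add: P_def)
    moreover have "(\<Prod>v<c + j. qlat (B + v) - qlat t) = (\<Prod>v<c. qlat (B + v) - qlat t) * Q j t"
      by (induction j) (simp_all add: Q_def)
    ultimately show "w t * P i t * Q j t
      = (\<Prod>v<a + i. qlat t - qlat v) * (\<Prod>v<c + j. qlat (B + v) - qlat t)"
      by (simp add: w_def)
  qed
  moreover have "(\<Sum>S | S \<subseteq> {..<B} \<and> card S = y. vand S * (\<sigma> * vand S) * (\<Prod>t\<in>S. w t))
    = selberg_sum y a B c * \<sigma>"
    unfolding selberg_sum_def w_def sum_distrib_right by (intro sum.cong) auto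
  ultimately show ?thesis by (simp add: \<sigma>_def)
qed

lemma skip_pochhammer_eq: "skip_pochhammer x n = 2 ^ n * pochhammer (x / 2) n"
  by (induction n) (simp_all add: skip_pochhammer_def pochhammer_Suc algebra_simps)

text \<open>In reverse order the factors of \<open>T_prod\<close> are runs with a common midpoint,
  each longer by one at both ends than the one before; this is the form in which the moments produce
  them. Since \<open>i < y\<close>, no subtraction is truncated.\<close>

lemma T_prod_rev:
  assumes "B = a + x + y"
  shows "T_prod (real x + 1) (2 * a + c + 2 * y - 1) y
    = (\<Prod>i<y. pochhammer (real B - real a - real i) (2 * a + c + 1 + 2 * i))"
  unfolding T_prod_def
proof (subst prod.nat_diff_reindex[symmetric], rule prod.cong[OF refl])
  fix i assume "i \<in> {..<y}"
  then have i: "i < y" by simp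
  then have 1: "2 * a + c + 2 * y - 1 - 2 * (y - Suc i) = 2 * a + c + 1 + 2 * i" by arith
  have 2: "real x + 1 + real (y - Suc i) = real B - real a - real i" using i assms by (simp add: of_nat_diff)
  show "pochhammer (real x + 1 + real (y - Suc i)) (2 * a + c + 2 * y - 1 - 2 * (y - Suc i)) =
         pochhammer (real B - real a - real i) (2 * a + c + 1 + 2 * i)"
    unfolding 1 2 ..
qed

text \<open>Halving the argument turns a product in steps of 2 into a Pochhammer symbol, at the cost
  of a power of 2 that does not involve \<open>x\<close>.\<close>

lemma V_prod_rev:
  assumes "B = a + x + y"
  shows "V_prod (2 * real x + 2 * real a + 3) (c + 2 * y - 2) y
    = (\<Prod>i<y. 2 ^ (c + 2 * i)) * (\<Prod>i<y. pochhammer (real B + 1/2 - real i) (c + 2 * i))"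
  unfolding V_prod_def prod.distrib[symmetric]
proof (subst prod.nat_diff_reindex[symmetric], rule prod.cong[OF refl])
  fix i assume "i \<in> {..<y}"
  then have i: "i < y" by simp
  then have 1: "c + 2 * y - 2 - 2 * (y - Suc i) = c + 2 * i" by arith
  have 2: "(2 * real x + 2 * real a + 3 + 2 * real (y - Suc i)) / 2 = real B + 1/2 - real i"
    using i assms by (simp add: of_nat_diff field_simps)
  show "skip_pochhammer (2 * real x + 2 * real a + 3 + 2 * real (y - Suc i)) (c + 2 * y - 2 - 2 * (y - Suc i)) =
         2 ^ (c + 2 * i) * pochhammer (real B + 1/2 - real i) (c + 2 * i)"
    unfolding skip_pochhammer_eq 1 2 ..
qed

text \<open>The run of factors from \<open>B - a - i\<close> up to \<open>B + a + c + i + j\<close>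
  is cut in front of \<open>B + a + c + 1\<close>, so that its upper piece has length
  \<open>i + j\<close>; the symbol at \<open>1/2\<close> in the denominator is cut likewise. Row
  factor, column factor and Hankel entry are thereby separated.\<close>

lemma qmoment_factor:
  "qmoment (a + i) B (c + j)
    = (pochhammer (1/2) (a + i) * pochhammer (real B - real a - real i) (2 * a + c + 1 + i) / (2 * pochhammer (1/2) (a + c + 1)))
    * (fact (c + j) * pochhammer (real B + 1/2) (c + j))
    * (pochhammer (real B + real a + real c + 1) (i + j) / pochhammer (real a + real c + 3/2) (i + j))"
proof -
  let ?u = "real B - real a - real i"
  have 1: "pochhammer (1/2 :: real) (a + i + (c + j) + 1)
      = pochhammer (1/2) (a + c + 1) * pochhammer (real a + real c + 3/2) (i + j)"
    using pochhammer_product'[of "1/2 :: real" "a + c + 1" "i + j"] by (simp add: algebra_simps)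
  have "pochhammer (real B - real (a + i)) (2 * (a + i) + 1) * pochhammer (real B + real (a + i) + 1) (c + j)
    = pochhammer ?u ((2 * (a + i) + 1) + (c + j))"
    using pochhammer_product'[of ?u "2 * (a + i) + 1" "c + j"] by (simp add: algebra_simps)
  also have "(2 * (a + i) + 1) + (c + j) = (2 * a + c + 1 + i) + (i + j)" by simp
  also have "pochhammer ?u \<dots> = pochhammer ?u (2 * a + c + 1 + i) * pochhammer (real B + real a + real c + 1) (i + j)"
    using pochhammer_product'[of ?u "2 * a + c + 1 + i" "i + j"] by (simp add: algebra_simps)
  finally have 2: "pochhammer (real B - real (a + i)) (2 * (a + i) + 1) * pochhammer (real B + real (a + i) + 1) (c + j) = \<dots>" .
  have "qmoment (a + i) B (c + j) = fact (c + j) * pochhammer (1/2) (a + i) * pochhammer (real B + 1/2) (c + j)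
     * (pochhammer (real B - real (a + i)) (2 * (a + i) + 1) * pochhammer (real B + real (a + i) + 1) (c + j))
     / (2 * pochhammer (1/2) (a + i + (c + j) + 1))"
    unfolding qmoment_eq by (simp only: mult_ac)
  then show ?thesis unfolding 1 2 by (simp add: mult_ac)
qed

text \<open>The row factors join with \<open>pochhammer p i\<close> to the runs of
  \<open>T_prod\<close>, and the column factors with \<open>pochhammer (q - p) k\<close>, which
  descends from \<open>1/2 - B\<close>, to those of \<open>V_prod\<close>. Everything else is free
  of \<open>x\<close>.\<close>

lemma selberg_sum_TV:
  "\<exists>\<kappa>. \<forall>x. selberg_sum y a (a + x + y) c
    = \<kappa> * (T_prod (real x + 1) (2 * a + c + 2 * y - 1) y * V_prod (2 * real x + 2 * real a + 3) (c + 2 * y - 2) y)"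
proof -
  define q where "q = real a + real c + 3/2"
  have "q > 0" unfolding q_def using of_nat_0_le_iff[of a] of_nat_0_le_iff[of c] by linarith
  then obtain \<kappa> where \<kappa>: "\<And>p. det (mat y y (\<lambda>(i, j). pochhammer p (i + j) / pochhammer q (i + j)))
    = \<kappa> * (\<Prod>k<y. pochhammer p k * pochhammer (q - p) k)"
    using det_pochhammer_hankel by blast
  define \<sigma> :: real where "\<sigma> = (\<Prod>j<y. (-1) ^ j)"
  have \<sigma>0: "\<sigma> \<noteq> 0" by (simp add: \<sigma>_def)
  define \<kappa>' where "\<kappa>' = \<kappa> * (\<Prod>i<y. pochhammer (1/2) (a + i) / (2 * pochhammer (1/2) (a + c + 1)))
     * (\<Prod>j<y. fact (c + j))"
  define \<tau> :: real where "\<tau> = (\<Prod>i<y. 2 ^ (c + 2 * i))"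
  have \<tau>0: "\<tau> \<noteq> 0" by (simp add: \<tau>_def)
  have "selberg_sum y a (a + x + y) c
      = (\<kappa>' / \<tau>) * (T_prod (real x + 1) (2 * a + c + 2 * y - 1) y * V_prod (2 * real x + 2 * real a + 3) (c + 2 * y - 2) y)"
    for x
  proof -
    define B where "B = a + x + y"
    define b where "b = real B"
    define p where "p = b + real a + real c + 1"
    have qp: "q - p = - (b - 1/2)" by (simp add: q_def p_def)
    \<comment> \<open>These signs multiply to \<open>\<sigma>\<close>, the sign that
      \<open>selberg_sum_det\<close> attaches to the sum.\<close>
    have neg: "pochhammer (q - p) k = (-1) ^ k * pochhammer (b + 1/2 - real k) k" for k
      unfolding qp pochhammer_minus by (simp add: algebra_simps)
    have T1: "pochhammer (b - real a - real i) (2 * a + c + 1 + i) * pochhammer p i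
        = pochhammer (b - real a - real i) (2 * a + c + 1 + 2 * i)" for i
      using pochhammer_product'[of "b - real a - real i" "2 * a + c + 1 + i" i]
      by (simp add: p_def algebra_simps mult_2)
    have V1: "pochhammer (b + 1/2 - real k) k * pochhammer (b + 1/2) (c + k)
        = pochhammer (b + 1/2 - real k) (c + 2 * k)" for k
    proof -
      have e: "c + 2 * k = k + (c + k)" by simp
      show ?thesis
        unfolding e using pochhammer_product'[of "b + 1/2 - real k" k "c + k"] by (simp add: mult.commute)
    qed
    have "selberg_sum y a B c * \<sigma> = det (mat y y (\<lambda>(i, j). qmoment (a + i) B (c + j)))"
      unfolding \<sigma>_def by (rule selberg_sum_det)
    also have "\<dots> = (\<Prod>i<y. pochhammer (1/2) (a + i) * pochhammer (b - real a - real i) (2 * a + c + 1 + i) / (2 * pochhammer (1/2) (a + c + 1)))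
        * (\<Prod>j<y. fact (c + j) * pochhammer (b + 1/2) (c + j))
        * (\<kappa> * (\<Prod>k<y. pochhammer p k * pochhammer (q - p) k))"
      unfolding qmoment_factor det_scale b_def[symmetric] p_def[symmetric] q_def[symmetric] \<kappa> ..
    also have "\<dots> = \<kappa>' * \<sigma> * ((\<Prod>i<y. pochhammer (b - real a - real i) (2 * a + c + 1 + i) * pochhammer p i)
        * (\<Prod>k<y. pochhammer (b + 1/2 - real k) k * pochhammer (b + 1/2) (c + k)))"
      unfolding \<kappa>'_def \<sigma>_def neg prod.distrib prod_dividef by (simp add: mult_ac)
    finally have "selberg_sum y a B c
        = \<kappa>' * ((\<Prod>i<y. pochhammer (b - real a - real i) (2 * a + c + 1 + 2 * i))
        * (\<Prod>k<y. pochhammer (b + 1/2 - real k) (c + 2 * k)))"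
      unfolding T1 V1 using \<sigma>0 by (simp add: mult_ac)
    then show ?thesis
      unfolding T_prod_rev[OF B_def] V_prod_rev[OF B_def] B_def[symmetric] \<tau>_def[symmetric]
      using \<tau>0 by (simp add: b_def)
  qed
  then show ?thesis by blast
qed

section \<open>The value at \<open>x = 0\<close>, where the gap has exactly \<open>y\<close>
  points\<close>

lemma prod_qlat_above:
  assumes "t < M"
  shows "(\<Prod>s\<in>{t<..<M}. qlat s - qlat t) = fact (M - 1 - t) * fact (M + t) / fact (2 * t + 1)"
proof -
  obtain d where M: "M = Suc (t + d)" using assms less_iff_Suc_add by auto
  have "(\<Prod>s\<in>{t<..<Suc (t + d)}. qlat s - qlat t) * fact (2 * t + 1) = fact d * fact (2 * t + 1 + d)"
  proof (induction d)
    case (Suc d)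
    have "{t<..<Suc (t + Suc d)} = insert (Suc (t + d)) {t<..<Suc (t + d)}" by auto
    then have "(\<Prod>s\<in>{t<..<Suc (t + Suc d)}. qlat s - qlat t) * fact (2 * t + 1)
      = (qlat (Suc (t + d)) - qlat t) * (fact d * fact (2 * t + 1 + d))"
      using Suc by (simp add: mult.assoc del: fact_Suc)
    also have "qlat (Suc (t + d)) - qlat t = real (Suc d) * real (2 * t + 1 + Suc d)"
      by (simp add: qlat_diff)
    finally show ?case by (simp add: algebra_simps)
  qed (simp add: atLeastSucLessThan_greaterThanLessThan[symmetric])
  then show ?thesis unfolding M by (simp add: eq_divide_eq mult_2 add_ac del: fact_Suc)
qed

lemma prod_qlat_below: "(\<Prod>s<t. qlat t - qlat s) = fact (2 * t)"
  by (simp add: prod_qlat_pochhammer pochhammer_fact)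

text \<open>Any other set of \<open>y\<close> points contains some \<open>t < a\<close> and has
  weight 0. For the full gap, the squared Vandermonde product and the weight together give each
  \<open>t\<close> its differences to all other points below \<open>M\<close>. These are factorials,
  and the quotients \<open>(2 * t)! / (2 * t + 1)!\<close> leave the odd numbers of the double
  factorials.\<close>

lemma selberg_sum_0:
  "selberg_sum y a (a + y) c = odd_double_fact a / odd_double_fact (a + y)
    * ((hyperfact (2 * a + c + 2 * y) * hyperfact (c + y)) / (hyperfact (2 * a + c + y) * hyperfact c))"
proof -
  define M where "M = a + y + c"
  let ?I = "{a..<a + y}"
  let ?w = "\<lambda>t. (\<Prod>v<a. qlat t - qlat v) * (\<Prod>v<c. qlat (a + y + v) - qlat t)"
  have "vand S * vand S * (\<Prod>t\<in>S. ?w t) = 0"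
    if S: "S \<subseteq> {..<a + y}" "card S = y" "S \<noteq> ?I" for S
  proof -
    have fin: "finite S" using S finite_subset by blast
    have "\<not> S \<subseteq> ?I"
    proof
      assume "S \<subseteq> ?I"
      then have "S = ?I" using S(2) by (intro card_subset_eq) auto
      with S(3) show False by simp
    qed
    then obtain t where t: "t \<in> S" "t < a" using S(1) by (auto simp: subset_iff)
    then have "?w t = 0" by auto
    then have "(\<Prod>t\<in>S. ?w t) = 0" using fin t by (intro prod_zero) auto
    then show ?thesis by simp
  qed
  then have "selberg_sum y a (a + y) c = (\<Sum>S\<in>{?I}. vand S * vand S * (\<Prod>t\<in>S. ?w t))"
    unfolding selberg_sum_def by (intro sum.mono_neutral_right) auto
  also have "\<dots> = vand ?I * vand ?I * (\<Prod>t\<in>?I. ?w t)" by simp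
  \<comment> \<open>The second Vandermonde factor is regrouped by the smaller element of each pair,
    so that \<open>t\<close> meets the points of the gap on both sides.\<close>
  also have "\<dots> = (\<Prod>t\<in>?I. \<Prod>s\<in>{s \<in> ?I. s < t}. qlat t - qlat s)
      * (\<Prod>t\<in>?I. \<Prod>s\<in>{s \<in> ?I. t < s}. qlat s - qlat t) * (\<Prod>t\<in>?I. ?w t)"
    unfolding vand_def by (subst (2) prod.swap_restrict) auto
  also have "\<dots> = (\<Prod>t\<in>?I. (\<Prod>s<t. qlat t - qlat s) * (\<Prod>s\<in>{t<..<M}. qlat s - qlat t))"
    unfolding prod.distrib[symmetric]
  proof (rule prod.cong[OF refl])
    fix t assume t: "t \<in> ?I"
    have "{..<t} = {..<a} \<union> {s \<in> ?I. s < t}" using t by auto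
    then have 1: "(\<Prod>s<t. qlat t - qlat s) = (\<Prod>v<a. qlat t - qlat v) * (\<Prod>s\<in>{s \<in> ?I. s < t}. qlat t - qlat s)"
      by (simp add: prod.union_disjoint Int_def)
    have "{t<..<M} = {s \<in> ?I. t < s} \<union> {a + y..<a + y + c}" using t by (auto simp: M_def)
    then have "(\<Prod>s\<in>{t<..<M}. qlat s - qlat t)
      = (\<Prod>s\<in>{s \<in> ?I. t < s}. qlat s - qlat t) * (\<Prod>s\<in>{a + y..<a + y + c}. qlat s - qlat t)"
      by (simp add: prod.union_disjoint Int_def)
    also have "(\<Prod>s\<in>{a + y..<a + y + c}. qlat s - qlat t) = (\<Prod>v<c. qlat (a + y + v) - qlat t)"
      by (rule prod.reindex_bij_witness[of _ "\<lambda>v. a + y + v" "\<lambda>s. s - (a + y)"]) auto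
    finally show "(\<Prod>s\<in>{s \<in> ?I. s < t}. qlat t - qlat s) * (\<Prod>s\<in>{s \<in> ?I. t < s}. qlat s - qlat t) * ?w t
      = (\<Prod>s<t. qlat t - qlat s) * (\<Prod>s\<in>{t<..<M}. qlat s - qlat t)"
      unfolding 1 by (simp only: mult_ac)
  qed
  also have "\<dots> = (\<Prod>t\<in>?I. fact (M - 1 - t) * fact (M + t) / real (2 * t + 1))"
    by (rule prod.cong[OF refl]) (auto simp: prod_qlat_below prod_qlat_above M_def)
  also have "\<dots> = (\<Prod>i<y. fact (M - 1 - (a + i)) * fact (M + (a + i)) / real (2 * (a + i) + 1))"
    by (rule prod.reindex_bij_witness[of _ "\<lambda>i. a + i" "\<lambda>t. t - a"]) auto
  also have "\<dots> = (\<Prod>i<y. fact (M - 1 - (a + i))) * (\<Prod>i<y. fact (M + (a + i))) / (\<Prod>i<y. real (2 * (a + i) + 1))"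
    by (simp only: prod.distrib prod_dividef)
  also have "(\<Prod>i<y. fact (M - 1 - (a + i)) :: real) = (\<Prod>i<y. fact (c + i))"
    by (subst prod.nat_diff_reindex[symmetric], rule prod.cong)
      (auto simp: M_def intro!: arg_cong[of _ _ fact])
  also have "\<dots> = hyperfact (c + y) / hyperfact c"
    by (induction y) (auto simp: hyperfact_def)
  also have "(\<Prod>i<y. fact (M + (a + i)) :: real) = hyperfact (2 * a + c + 2 * y) / hyperfact (2 * a + c + y)"
  proof -
    have "(\<Prod>i<k. fact (n + i) :: real) = hyperfact (n + k) / hyperfact n" for n k
      by (induction k) (auto simp: hyperfact_def)
    from this[of "2 * a + c + y" y] show ?thesis by (simp add: M_def mult_2 add_ac)
  qed
  also have "(\<Prod>i<y. real (2 * (a + i) + 1)) = odd_double_fact (a + y) / odd_double_fact a"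
  proof -
    have "odd_double_fact a \<noteq> 0" by (auto simp: odd_double_fact_def)
    then show ?thesis by (induction y) (auto simp: odd_double_fact_def)
  qed
  finally show ?thesis by (simp add: mult_ac)
qed

text \<open>Setting \<open>x = 0\<close> fixes the constant of proportionality, as
  \<open>T_prod\<close> and \<open>V_prod\<close> are positive there.\<close>

lemma selberg_sum_eq:
  "selberg_sum y a (a + x + y) c = odd_double_fact a / odd_double_fact (a + y)
    * ((hyperfact (2 * a + c + 2 * y) * hyperfact (c + y)) / (hyperfact (2 * a + c + y) * hyperfact c))
    * ((T_prod (real x + 1) (2 * a + c + 2 * y - 1) y * V_prod (2 * real x + 2 * real a + 3) (c + 2 * y - 2) y)
      / (T_prod 1 (2 * a + c + 2 * y - 1) y * V_prod (2 * real a + 3) (c + 2 * y - 2) y))"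
proof -
  obtain \<kappa> where \<kappa>: "\<And>x. selberg_sum y a (a + x + y) c
    = \<kappa> * (T_prod (real x + 1) (2 * a + c + 2 * y - 1) y * V_prod (2 * real x + 2 * real a + 3) (c + 2 * y - 2) y)"
    using selberg_sum_TV by blast
  have "T_prod 1 (2 * a + c + 2 * y - 1) y > 0"
    unfolding T_prod_def by (intro prod_pos) (auto intro!: pochhammer_pos)
  moreover have "V_prod (2 * real a + 3) (c + 2 * y - 2) y > 0"
    unfolding V_prod_def skip_pochhammer_def by (intro prod_pos ballI) (auto intro!: add_nonneg_pos add_pos_nonneg)
  ultimately have ne: "T_prod 1 (2 * a + c + 2 * y - 1) y * V_prod (2 * real a + 3) (c + 2 * y - 2) y \<noteq> 0" by simp
  from \<kappa>[of 0] have "\<kappa> = selberg_sum y a (a + y) c / (T_prod 1 (2 * a + c + 2 * y - 1) y * V_prod (2 * real a + 3) (c + 2 * y - 2) y)"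
    using ne by simp
  then show ?thesis unfolding \<kappa>[of x] selberg_sum_0 by simp
qed

section \<open>Cells of a zigzag trapezoid\<close>

text \<open>\<open>Up k j\<close> has its horizontal edge at height \<open>k\<close>, its first vertex at distance \<open>j\<close> from the zigzag,
  and lies above this edge; \<open>Dn k j\<close> is its mirror image below the edge. So \<open>Up k j\<close> is in the row of
  \<open>Dn (k + 1) i\<close>; which of the latter it touches depends on the parity of \<open>k\<close>.\<close>

datatype cell = Up nat nat | Dn nat nat

fun touches :: "cell \<Rightarrow> cell \<Rightarrow> bool" where
  "touches (Up k j) (Dn l i) \<longleftrightarrow>
     l = k \<and> i = j \<or> l = Suc k \<and> (i = j \<or> (if even k then j = Suc i else i = Suc j))"
| "touches _ _ \<longleftrightarrow> False"

definition cell_adj :: "cell \<Rightarrow> cell \<Rightarrow> bool" where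
  "cell_adj c d \<longleftrightarrow> touches c d \<or> touches d c"

lemma symp_cell_adj: "symp cell_adj"
  by (auto simp: symp_def cell_adj_def)

lemma cell_adj_simps [simp]:
  "cell_adj (Up k j) (Dn l i) \<longleftrightarrow> touches (Up k j) (Dn l i)"
  "cell_adj (Dn l i) (Up k j) \<longleftrightarrow> touches (Up k j) (Dn l i)"
  "\<not> cell_adj (Up k j) (Up l i)" "\<not> cell_adj (Dn k j) (Dn l i)"
  by (auto simp: cell_adj_def)

text \<open>The bound on \<open>j\<close> is the slanted east side, expressed in distances from the
  zigzag. The parameter \<open>k\<^sub>0\<close> admits the trapezoids that remain after the lower
  rows have been peeled off.\<close>

definition layers :: "nat \<Rightarrow> nat \<Rightarrow> nat \<Rightarrow> cell set" where
  "layers L h k\<^sub>0 = {Up k j | k j. k\<^sub>0 \<le> k \<and> k < h \<and> j + (k + 1) div 2 < L}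
     \<union> {Dn k j | k j. k\<^sub>0 < k \<and> k \<le> h \<and> j + (k + 1) div 2 < L}"

lemma Up_layers [simp]: "Up k j \<in> layers L h k\<^sub>0 \<longleftrightarrow> k\<^sub>0 \<le> k \<and> k < h \<and> j + (k + 1) div 2 < L"
  and Dn_layers [simp]: "Dn k j \<in> layers L h k\<^sub>0 \<longleftrightarrow> k\<^sub>0 < k \<and> k \<le> h \<and> j + (k + 1) div 2 < L"
  by (auto simp: layers_def)

lemma finite_layers [simp]: "finite (layers L h k\<^sub>0)"
proof -
  have "layers L h k\<^sub>0 \<subseteq> case_prod Up ` ({..h} \<times> {..L}) \<union> case_prod Dn ` ({..h} \<times> {..L})"
    by (auto simp: layers_def image_iff)
  then show ?thesis by (rule finite_subset) auto
qed

abbreviation dented :: "nat \<Rightarrow> nat \<Rightarrow> nat \<Rightarrow> nat set \<Rightarrow> nat" where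
  "dented L h k P \<equiv> matchings cell_adj (layers L h k - Up k ` P)"

definition bottom_row :: "nat \<Rightarrow> nat \<Rightarrow> cell set" where
  "bottom_row L k = {Up k j | j. j + (k + 1) div 2 < L} \<union> {Dn (Suc k) j | j. j + (k + 2) div 2 < L}"

lemma layers_Suc:
  assumes "k < h"
  shows "layers L h k = bottom_row L k \<union> layers L h (Suc k)"
proof (rule Set.set_eqI)
  fix c show "c \<in> layers L h k \<longleftrightarrow> c \<in> bottom_row L k \<union> layers L h (Suc k)"
    using assms by (cases c) (auto simp: bottom_row_def Suc_le_eq le_less)
qed

text \<open>The bottom row meets the rest only along the edges at height \<open>Suc k\<close>. The
  vertical lozenges across these edges become the dents \<open>S\<close> of the next layer. Above
  the top row there is nothing to cross into, whence the condition \<open>Suc k < h\<close>.\<close>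

lemma matchings_peel:
  assumes "k < h"
  shows "dented L h k P
    = (\<Sum>S\<in>Pow {j. Suc k < h \<and> j + (k + 2) div 2 < L}.
        matchings cell_adj (bottom_row L k - Up k ` P - Dn (Suc k) ` S)
          * dented L h (Suc k) S)"
proof -
  let ?J = "{j. Suc k < h \<and> j + (k + 2) div 2 < L}"
  have "bottom_row L k - Up k ` P \<subseteq> layers L h k" using layers_Suc[OF assms, of L] by auto
  then have fin: "finite (bottom_row L k - Up k ` P)" by (rule finite_subset) simp
  have "layers L h k - Up k ` P = (bottom_row L k - Up k ` P) \<union> layers L h (Suc k)"
    unfolding layers_Suc[OF assms] by (auto simp: layers_def)
  moreover have "matchings cell_adj ((bottom_row L k - Up k ` P) \<union> layers L h (Suc k))
    = (\<Sum>S\<in>Pow ?J. matchings cell_adj (bottom_row L k - Up k ` P - Dn (Suc k) ` S)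
        * dented L h (Suc k) S)"
  proof (rule matchings_split[OF symp_cell_adj fin])
    show "(bottom_row L k - Up k ` P) \<inter> layers L h (Suc k) = {}"
      by (auto simp: bottom_row_def)
    show "Dn (Suc k) ` ?J \<subseteq> bottom_row L k - Up k ` P" by (auto simp: bottom_row_def)
    show "Up (Suc k) ` ?J \<subseteq> layers L h (Suc k)" by auto
    fix c d assume "c \<in> bottom_row L k - Up k ` P" "d \<in> layers L h (Suc k)"
    then show "cell_adj c d \<longleftrightarrow> (\<exists>j\<in>?J. c = Dn (Suc k) j \<and> d = Up (Suc k) j)"
      by (cases d) (auto simp: bottom_row_def)
  qed (auto simp: inj_on_def)
  ultimately show ?thesis by simp
qed

text \<open>Over an even height the row has an \<open>Up\<close> cell at the zigzag and one at the
  east side: \<open>L - k div 2\<close> of them, with a \<open>Dn\<close> cell between any two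
  neighbours.\<close>

lemma matchings_row_even:
  assumes "even k" and S: "S \<subseteq> {..<L - k div 2 - 1}"
  shows "matchings cell_adj (bottom_row L k - Up k ` P - Dn (Suc k) ` S)
    = matchings path_adj ({..<2 * (L - k div 2) - 1} - row_set P S)"
proof -
  define r where "r i = (if even i then Up k (i div 2) else Dn (Suc k) (i div 2))" for i
  let ?C = "{..<2 * (L - k div 2) - 1} - row_set P S"
  have k: "(k + 1) div 2 = k div 2" "(k + 2) div 2 = Suc (k div 2)" using assms by auto
  have Ups: "Up k j \<in> r ` ?C \<longleftrightarrow> j < L - k div 2 \<and> j \<notin> P" for j
  proof
    assume "Up k j \<in> r ` ?C"
    then obtain i where "i \<in> ?C" "even i" "j = i div 2" by (auto simp: r_def split: if_splits)
    then show "j < L - k div 2 \<and> j \<notin> P" by (auto simp: row_set_def elim!: evenE)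
  next
    assume "j < L - k div 2 \<and> j \<notin> P"
    then have "2 * j \<in> ?C" by (auto simp: row_set_def) presburger
    then have "r (2 * j) \<in> r ` ?C" by (rule imageI)
    then show "Up k j \<in> r ` ?C" by (simp add: r_def)
  qed
  have Dns: "Dn (Suc k) j \<in> r ` ?C \<longleftrightarrow> j < L - k div 2 - 1 \<and> j \<notin> S" for j
  proof
    assume "Dn (Suc k) j \<in> r ` ?C"
    then obtain i where "i \<in> ?C" "odd i" "j = i div 2" by (auto simp: r_def split: if_splits)
    then show "j < L - k div 2 - 1 \<and> j \<notin> S" by (auto simp: row_set_def elim!: oddE)
  next
    assume "j < L - k div 2 - 1 \<and> j \<notin> S"
    then have "2 * j + 1 \<in> ?C" by (auto simp: row_set_def) presburger
    then have "r (2 * j + 1) \<in> r ` ?C" by (rule imageI)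
    then show "Dn (Suc k) j \<in> r ` ?C" by (simp add: r_def)
  qed
  have other: "c \<notin> r ` ?C" if "\<And>j. c \<noteq> Up k j" "\<And>j. c \<noteq> Dn (Suc k) j" for c
    using that by (auto simp: r_def)
  have "bottom_row L k - Up k ` P - Dn (Suc k) ` S = r ` ?C"
  proof (rule Set.set_eqI)
    fix c show "c \<in> bottom_row L k - Up k ` P - Dn (Suc k) ` S \<longleftrightarrow> c \<in> r ` ?C"
    proof -
      consider (up) j where "c = Up k j" | (dn) j where "c = Dn (Suc k) j"
        | (none) "\<And>j. c \<noteq> Up k j" "\<And>j. c \<noteq> Dn (Suc k) j" by blast
      then show ?thesis
      proof cases
        case up
        show ?thesis unfolding up Ups using k by (auto simp: bottom_row_def)
      next
        case dn
        show ?thesis unfolding dn Dns using k by (auto simp: bottom_row_def)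
      next
        case none
        then show ?thesis using other[of c] by (auto simp: bottom_row_def)
      qed
    qed
  qed
  moreover have "matchings cell_adj (r ` ?C) = matchings path_adj ?C"
  proof (rule matchings_transport)
    show "inj_on r ?C"
      by (rule inj_onI) (auto simp: r_def split: if_splits elim!: evenE oddE)
    show "path_adj i j \<longleftrightarrow> cell_adj (r i) (r j)" for i j
      using \<open>even k\<close> 
      by (cases "even i"; cases "even j"; auto simp: path_adj_def r_def elim!: evenE oddE; presburger)
  qed
  ultimately show ?thesis by simp
qed

text \<open>An odd row becomes an even one by putting a removed cell in front of it.\<close>

lemma matchings_row_odd:
  assumes "odd k" and S: "S \<subseteq> {..<L - (k + 1) div 2}"
  shows "matchings cell_adj (bottom_row L k - Up k ` P - Dn (Suc k) ` S)
    = matchings path_adj ({..<2 * Suc (L - (k + 1) div 2) - 1} - row_set (insert 0 (Suc ` P)) S)"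
proof -
  define r where "r i = (if even i then Up k (i div 2 - 1) else Dn (Suc k) (i div 2))" for i
  let ?l = "L - (k + 1) div 2"
  let ?C = "{..<2 * Suc ?l - 1} - row_set (insert 0 (Suc ` P)) S"
  have k: "(k + 2) div 2 = (k + 1) div 2" using assms by (auto elim!: oddE)
  have pos: "i > 0" if "i \<in> ?C" for i using that by (cases i) (auto simp: row_set_def)
  have Ups: "Up k j \<in> r ` ?C \<longleftrightarrow> j < ?l \<and> j \<notin> P" for j
  proof
    assume "Up k j \<in> r ` ?C"
    then obtain i where i: "i \<in> ?C" "even i" "j = i div 2 - 1" by (auto simp: r_def split: if_splits)
    with pos[OF i(1)] have "i = 2 * Suc j" by (auto elim!: evenE)
    with i(1) show "j < ?l \<and> j \<notin> P" by (auto simp: row_set_def image_iff)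
  next
    assume "j < ?l \<and> j \<notin> P"
    then have "2 * Suc j \<in> ?C" by (auto simp: row_set_def) presburger
    then have "r (2 * Suc j) \<in> r ` ?C" by (rule imageI)
    then show "Up k j \<in> r ` ?C" by (simp add: r_def)
  qed
  have Dns: "Dn (Suc k) j \<in> r ` ?C \<longleftrightarrow> j < ?l \<and> j \<notin> S" for j
  proof
    assume "Dn (Suc k) j \<in> r ` ?C"
    then obtain i where "i \<in> ?C" "odd i" "j = i div 2" by (auto simp: r_def split: if_splits)
    then show "j < ?l \<and> j \<notin> S" by (auto simp: row_set_def elim!: oddE)
  next
    assume "j < ?l \<and> j \<notin> S"
    then have "2 * j + 1 \<in> ?C" by (auto simp: row_set_def) presburger+
    then have "r (2 * j + 1) \<in> r ` ?C" by (rule imageI)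
    then show "Dn (Suc k) j \<in> r ` ?C" by (simp add: r_def)
  qed
  have other: "c \<notin> r ` ?C" if "\<And>j. c \<noteq> Up k j" "\<And>j. c \<noteq> Dn (Suc k) j" for c
    using that by (auto simp: r_def)
  have "bottom_row L k - Up k ` P - Dn (Suc k) ` S = r ` ?C"
  proof (rule Set.set_eqI)
    fix c show "c \<in> bottom_row L k - Up k ` P - Dn (Suc k) ` S \<longleftrightarrow> c \<in> r ` ?C"
    proof -
      consider (up) j where "c = Up k j" | (dn) j where "c = Dn (Suc k) j"
        | (none) "\<And>j. c \<noteq> Up k j" "\<And>j. c \<noteq> Dn (Suc k) j" by blast
      then show ?thesis
      proof cases
        case up
        show ?thesis unfolding up Ups unfolding bottom_row_def k by auto
      next
        case dn
        show ?thesis unfolding dn Dns unfolding bottom_row_def k by auto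
      next
        case none
        then show ?thesis using other[of c] by (auto simp: bottom_row_def)
      qed
    qed
  qed
  moreover have "matchings cell_adj (r ` ?C) = matchings path_adj ?C"
  proof (rule matchings_transport)
    show "inj_on r ?C"
    proof (rule inj_onI)
      fix i j assume "i \<in> ?C" "j \<in> ?C" "r i = r j"
      moreover from this have "i > 0" "j > 0" using pos by auto
      ultimately show "i = j" by (auto simp: r_def elim!: evenE oddE split: if_splits; presburger)
    qed
    show "path_adj i j \<longleftrightarrow> cell_adj (r i) (r j)" if "i \<in> ?C" "j \<in> ?C" for i j
      using \<open>odd k\<close> pos[OF that(1)] pos[OF that(2)] 
      by (cases "even i"; cases "even j"; auto simp: path_adj_def r_def elim!: evenE oddE; presburger)
  qed
  ultimately show ?thesis by simp
qed

lemma matchings_layers_even: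
  assumes k: "even k" "k < h" and n: "Suc k < h \<or> n = 0"
    and p: "strict_mono_on {..<Suc n} p" "\<And>i. i \<le> n \<Longrightarrow> p i + k div 2 < L"
  shows "real (dented L h k (p ` {..<Suc n}))
    = (\<Sum>s\<in>(\<Pi>\<^sub>E i\<in>{..<n}. {p i..<p (Suc i)}). real (dented L h (Suc k) (s ` {..<n})))"
proof -
  let ?l = "L - k div 2"
  let ?m = "\<lambda>S. matchings path_adj ({..<2 * ?l - 1} - row_set (p ` {..<Suc n}) S)"
  \<comment> \<open>In the top row only \<open>S = {}\<close> is possible. \<open>\<Phi>\<close>
    extends the summand by 0 to all \<open>S\<close>, so that \<open>sum_matchings_row\<close>
    applies there as well.\<close>
  define \<Phi> where "\<Phi> S = (if Suc k < h then real (dented L h (Suc k) S)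
    else if S = {} then 1 else 0)" for S
  define J where "J = {j. Suc k < h \<and> j + (k + 2) div 2 < L}"
  have J: "J = (if Suc k < h then {..<?l - 1} else {})" using k by (auto simp: J_def)
  have top: "layers L h h = {}" by (auto simp: layers_def)
  have m: "dented L h k (p ` {..<Suc n})
    = (\<Sum>S\<in>Pow J. ?m S * dented L h (Suc k) S)"
    unfolding matchings_peel[OF k(2)] J_def[symmetric]
    by (intro sum.cong refl arg_cong2[where f = "(*)"] matchings_row_even[OF k(1)])
      (auto simp: J split: if_splits)
  have "real (dented L h k (p ` {..<Suc n})) = (\<Sum>S\<in>Pow J. real (?m S) * \<Phi> S)"
    unfolding m of_nat_sum of_nat_mult
  proof (intro sum.cong refl arg_cong2[where f = "(*)"])
    fix S assume S: "S \<in> Pow J"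
    show "real (dented L h (Suc k) S) = \<Phi> S"
    proof (cases "Suc k < h")
      case False
      then have "Suc k = h" "S = {}" using k S by (auto simp: J)
      then show ?thesis using top by (simp add: \<Phi>_def)
    qed (simp add: \<Phi>_def)
  qed
  also have "\<dots> = (\<Sum>S\<in>Pow {..<?l - 1}. real (?m S) * \<Phi> S)"
    by (rule sum.mono_neutral_left) (auto simp: J \<Phi>_def)
  also have "\<dots> = (\<Sum>s\<in>(\<Pi>\<^sub>E i\<in>{..<n}. {p i..<p (Suc i)}). \<Phi> (s ` {..<n}))"
    using p(2) by (intro sum_matchings_row[OF p(1)]) (simp add: less_diff_conv)
  also have "\<dots> = (\<Sum>s\<in>(\<Pi>\<^sub>E i\<in>{..<n}. {p i..<p (Suc i)}). real (dented L h (Suc k) (s ` {..<n})))"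
  proof (cases "Suc k < h")
    case False
    then have "Suc k = h" "n = 0" using k n by auto
    then show ?thesis using top by (simp add: \<Phi>_def)
  qed (simp add: \<Phi>_def)
  finally show ?thesis .
qed

text \<open>The dents of an odd row after the fictitious removed cell has been put in front: that
  cell sits at 0 and moves the others by one.\<close>

definition prepend_0 :: "(nat \<Rightarrow> nat) \<Rightarrow> nat \<Rightarrow> nat" where
  "prepend_0 p i = (case i of 0 \<Rightarrow> 0 | Suc k \<Rightarrow> Suc (p k))"

lemma prepend_0_simps [simp]: "prepend_0 p 0 = 0" "prepend_0 p (Suc k) = Suc (p k)"
  by (simp_all add: prepend_0_def)

lemma matchings_layers_odd:
  assumes k: "odd k" "Suc k < h"
    and p: "strict_mono_on {..<n} p" "\<And>i. i < n \<Longrightarrow> p i + (k + 1) div 2 < L"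
  shows "real (dented L h k (p ` {..<n}))
    = (\<Sum>s\<in>(\<Pi>\<^sub>E i\<in>{..<n}. {prepend_0 p i..<prepend_0 p (Suc i)}).
        real (dented L h (Suc k) (s ` {..<n})))"
proof -
  let ?l = "Suc (L - (k + 1) div 2)"
  let ?p = "prepend_0 p"
  have mono: "strict_mono_on {..<Suc n} ?p"
    using p(1) by (auto simp: strict_mono_on_def prepend_0_def split: nat.splits)
  have img: "insert 0 (Suc ` p ` {..<n}) = ?p ` {..<Suc n}"
    unfolding lessThan_Suc_eq_insert_0 by (simp add: image_image)
  have bound: "?p i < ?l" if "i \<le> n" for i
    using that p(2)[of "i - 1"] by (cases i) auto
  define J where "J = {j. Suc k < h \<and> j + (k + 2) div 2 < L}"
  have J: "J = {..<?l - 1}" using k by (auto simp: J_def elim!: oddE)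
  let ?m = "\<lambda>S. matchings path_adj ({..<2 * ?l - 1} - row_set (?p ` {..<Suc n}) S)"
  have m: "dented L h k (p ` {..<n})
    = (\<Sum>S\<in>Pow J. ?m S * dented L h (Suc k) S)"
    unfolding matchings_peel[OF Suc_lessD[OF k(2)]] J_def[symmetric] img[symmetric]
    by (intro sum.cong refl arg_cong2[where f = "(*)"] matchings_row_odd[OF k(1)]) (auto simp: J)
  have "real (dented L h k (p ` {..<n}))
    = (\<Sum>S\<in>Pow {..<?l - 1}. real (?m S) * real (dented L h (Suc k) S))"
    unfolding m of_nat_sum of_nat_mult J ..
  also have "\<dots> = (\<Sum>s\<in>(\<Pi>\<^sub>E i\<in>{..<n}. {?p i..<?p (Suc i)}). real (dented L h (Suc k) (s ` {..<n})))"
    by (rule sum_matchings_row[OF mono bound])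
  finally show ?thesis .
qed

section \<open>Counting tilings of dented trapezoids by binomial determinants\<close>

lemma sum_binomial_shift: "(\<Sum>t<m. (t + i) choose (i + j)) = (m + i) choose Suc (i + j)"
  by (induction m) simp_all

lemma sum_interval_diff:
  fixes f :: "nat \<Rightarrow> 'a :: ab_group_add"
  assumes "a \<le> b"
  shows "(\<Sum>t\<in>{a..<b}. f t) = (\<Sum>t<b. f t) - (\<Sum>t<a. f t)"
  using sum.atLeastLessThan_concat[of 0 a b f] assms by (simp add: atLeast0LessThan algebra_simps)

lemma det_first_row_unit:
  fixes H :: "nat \<Rightarrow> nat \<Rightarrow> 'a :: comm_ring_1"
  assumes "H 0 0 = 1" "\<And>j. H 0 (Suc j) = 0"
  shows "det (mat (Suc n) (Suc n) (\<lambda>(i, j). H i j)) = det (mat n n (\<lambda>(i, j). H (Suc i) (Suc j)))"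
proof -
  have tr: "det (mat n n (\<lambda>(i, j). F i j)) = det (mat n n (\<lambda>(i, j). F j i))" for n and F :: "nat \<Rightarrow> nat \<Rightarrow> 'a"
  proof -
    have "transpose_mat (mat n n (\<lambda>(i, j). F i j)) = mat n n (\<lambda>(i, j). F j i)" by (rule eq_matI) auto
    then show ?thesis using det_transpose[of "mat n n (\<lambda>(i, j). F i j)" n] by simp
  qed
  have "det (mat (Suc n) (Suc n) (\<lambda>(i, j). H i j)) = det (mat (Suc n) (Suc n) (\<lambda>(i, j). H j i))"
    by (rule tr)
  also have "\<dots> = det (mat n n (\<lambda>(i, j). H (Suc j) (Suc i) - 0 * H (Suc j) i))"
    by (rule det_eliminate) (auto simp: assms)
  also have "\<dots> = det (mat n n (\<lambda>(i, j). H (Suc i) (Suc j)))"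
    using tr[of n "\<lambda>i j. H (Suc i) (Suc j)"] by simp
  finally show ?thesis .
qed

text \<open>By the hockey-stick identity the interval sums are differences of consecutive rows, so
  \<open>det_eliminate\<close> backwards adds a column of ones and a row for the fictitious dent at
  0. The binomials of this row vanish except for the leading 1, and it drops out again: an odd row
  keeps the number of dents.\<close>

lemma layers_matchings_step_odd:
  assumes IH: "\<And>s. strict_mono_on {..<n} s \<Longrightarrow> (\<And>i. i < n \<Longrightarrow> s i + Suc k div 2 < L) \<Longrightarrow>
      real (dented L h (Suc k) (s ` {..<n}))
        = det (mat n n (\<lambda>(i, j). real ((s i + j) choose (2 * j))))"
    and k: "odd k" "k + 2 * n = h"
    and p: "strict_mono_on {..<n} p" "\<And>i. i < n \<Longrightarrow> p i + (k + 1) div 2 < L"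
  shows "real (dented L h k (p ` {..<n}))
    = det (mat n n (\<lambda>(i, j). real ((p i + j + 1) choose (2 * j + 1))))"
proof (cases "n = 0")
  case True
  then have "layers L h k = {}" using k by (auto simp: layers_def)
  with True show ?thesis by simp
next
  case False
  let ?p = "prepend_0 p"
  have mono: "strict_mono_on {..<Suc n} ?p"
    using p(1) by (auto simp: strict_mono_on_def prepend_0_def split: nat.splits)
  have le: "?p i \<le> ?p (Suc i)" if "i < n" for i
    using strict_mono_onD[OF mono, of i "Suc i"] that by simp
  define H where "H i j = (case j of 0 \<Rightarrow> 1 | Suc l \<Rightarrow> real ((?p i + l) choose (2 * l + 1)))" for i j
  have "real (dented L h k (p ` {..<n}))
    = (\<Sum>s\<in>(\<Pi>\<^sub>E i\<in>{..<n}. {?p i..<?p (Suc i)}). real (dented L h (Suc k) (s ` {..<n})))"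
    using False k(2) by (intro matchings_layers_odd[OF k(1) _ p]) auto
  also have "\<dots> = (\<Sum>s\<in>(\<Pi>\<^sub>E i\<in>{..<n}. {?p i..<?p (Suc i)}). det (mat n n (\<lambda>(i, j). real ((s i + j) choose (2 * j)))))"
  proof (rule sum.cong[OF refl], rule IH)
    fix s assume s: "s \<in> (\<Pi>\<^sub>E i\<in>{..<n}. {?p i..<?p (Suc i)})"
    show "strict_mono_on {..<n} s" by (rule interlace_mono[OF s mono])
    fix i assume i: "i < n"
    then have "s i < ?p (Suc i)" using s by (auto simp: PiE_iff)
    then show "s i + Suc k div 2 < L" using p(2)[OF i] by simp
  qed
  also have "\<dots> = det (mat n n (\<lambda>(i, j). \<Sum>t\<in>{?p i..<?p (Suc i)}. real ((t + j) choose (2 * j))))"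
    by (rule sum_PiE_det) auto
  also have "\<dots> = det (mat n n (\<lambda>(i, j). H (Suc i) (Suc j) - 1 * H i (Suc j)))"
  proof (rule det_cong)
    fix i j assume i: "i < n"
    have "(\<Sum>t<m. real ((t + j) choose (2 * j))) = real ((m + j) choose (2 * j + 1))" for m
      unfolding of_nat_sum[symmetric] using sum_binomial_shift[of j j m] by (simp add: mult_2)
    then show "(\<Sum>t\<in>{?p i..<?p (Suc i)}. real ((t + j) choose (2 * j))) = H (Suc i) (Suc j) - 1 * H i (Suc j)"
      unfolding sum_interval_diff[OF le[OF i]] by (simp add: H_def)
  qed
  also have "\<dots> = det (mat (Suc n) (Suc n) (\<lambda>(i, j). H i j))"
    by (rule det_eliminate[symmetric]) (auto simp: H_def)
  also have "\<dots> = det (mat n n (\<lambda>(i, j). H (Suc i) (Suc j)))"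
    by (rule det_first_row_unit) (auto simp: H_def)
  also have "\<dots> = det (mat n n (\<lambda>(i, j). real ((p i + j + 1) choose (2 * j + 1))))"
    by (rule det_cong) (simp add: H_def)
  finally show ?thesis .
qed

text \<open>Here the added column of ones is the case \<open>j = 0\<close> of the new entries, and
  the determinant stays one size larger: an even row has one dent more than the row above
  it.\<close>

lemma layers_matchings_step_even:
  assumes IH: "\<And>s. strict_mono_on {..<n} s \<Longrightarrow> (\<And>i. i < n \<Longrightarrow> s i + (Suc k + 1) div 2 < L) \<Longrightarrow>
      real (dented L h (Suc k) (s ` {..<n}))
        = det (mat n n (\<lambda>(i, j). real ((s i + j + 1) choose (2 * j + 1))))"
    and k: "even k" "k + 2 * n + 1 = h"
    and p: "strict_mono_on {..<Suc n} p" "\<And>i. i < Suc n \<Longrightarrow> p i + k div 2 < L"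
  shows "real (dented L h k (p ` {..<Suc n}))
    = det (mat (Suc n) (Suc n) (\<lambda>(i, j). real ((p i + j) choose (2 * j))))"
proof -
  have le: "p i \<le> p (Suc i)" if "i < n" for i
    using strict_mono_onD[OF p(1), of i "Suc i"] that by simp
  define H where "H i j = real ((p i + j) choose (2 * j))" for i j
  have "real (dented L h k (p ` {..<Suc n}))
    = (\<Sum>s\<in>(\<Pi>\<^sub>E i\<in>{..<n}. {p i..<p (Suc i)}). real (dented L h (Suc k) (s ` {..<n})))"
    using k(2) p by (intro matchings_layers_even[OF k(1)]) auto
  also have "\<dots> = (\<Sum>s\<in>(\<Pi>\<^sub>E i\<in>{..<n}. {p i..<p (Suc i)}). det (mat n n (\<lambda>(i, j). real ((s i + j + 1) choose (2 * j + 1)))))"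
  proof (rule sum.cong[OF refl], rule IH)
    fix s assume s: "s \<in> (\<Pi>\<^sub>E i\<in>{..<n}. {p i..<p (Suc i)})"
    show "strict_mono_on {..<n} s" by (rule interlace_mono[OF s p(1)])
    fix i assume i: "i < n"
    then have "s i < p (Suc i)" using s by (auto simp: PiE_iff)
    then show "s i + (Suc k + 1) div 2 < L" using p(2)[of "Suc i"] i k(1) by (auto elim!: evenE)
  qed
  also have "\<dots> = det (mat n n (\<lambda>(i, j). \<Sum>t\<in>{p i..<p (Suc i)}. real ((t + j + 1) choose (2 * j + 1))))"
    by (rule sum_PiE_det) auto
  also have "\<dots> = det (mat n n (\<lambda>(i, j). H (Suc i) (Suc j) - 1 * H i (Suc j)))"
  proof (rule det_cong)
    fix i j assume i: "i < n"
    have "(\<Sum>t<m. real ((t + j + 1) choose (2 * j + 1))) = real ((m + Suc j) choose (2 * Suc j))" for m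
      unfolding of_nat_sum[symmetric] using sum_binomial_shift[of "Suc j" j m] by (simp add: mult_2)
    then show "(\<Sum>t\<in>{p i..<p (Suc i)}. real ((t + j + 1) choose (2 * j + 1))) = H (Suc i) (Suc j) - 1 * H i (Suc j)"
      unfolding sum_interval_diff[OF le[OF i]] by (simp only: H_def mult_1)
  qed
  also have "\<dots> = det (mat (Suc n) (Suc n) (\<lambda>(i, j). H i j))"
    by (rule det_eliminate[symmetric]) (auto simp: H_def)
  finally show ?thesis by (simp only: H_def)
qed

text \<open>The two steps alternate, and each pair of them uses up one dent. The recursion ends with
  an empty region, because \<open>n = 0\<close> means \<open>k = Suc h\<close>.\<close>

lemma matchings_layers_det:
  assumes "even k" "k + 2 * n = Suc h"
    and "strict_mono_on {..<n} p" "\<And>i. i < n \<Longrightarrow> p i + k div 2 < L"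
  shows "real (dented L h k (p ` {..<n}))
    = det (mat n n (\<lambda>(i, j). real ((p i + j) choose (2 * j))))"
  using assms
proof (induction n arbitrary: k p)
  case 0
  then have "layers L h k = {}" by (auto simp: layers_def)
  then show ?case by simp
next
  case (Suc n)
  show ?case
  proof (rule layers_matchings_step_even[OF _ Suc.prems(1) _ Suc.prems(3,4)])
    show "k + 2 * n + 1 = h" using Suc.prems(2) by simp
    fix s assume s: "strict_mono_on {..<n} s" "\<And>i. i < n \<Longrightarrow> s i + (Suc k + 1) div 2 < L"
    show "real (dented L h (Suc k) (s ` {..<n}))
        = det (mat n n (\<lambda>(i, j). real ((s i + j + 1) choose (2 * j + 1))))"
      by (rule layers_matchings_step_odd[OF _ _ _ s], rule Suc.IH) (use Suc.prems in auto)
  qed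
qed

text \<open>The numerator \<open>(p + j) * ... * (p - j + 1)\<close> pairs up into factors
  \<open>(p - v) * (p + v + 1)\<close>.\<close>

lemma binomial_qlat:
  "real ((p + j) choose (2 * j)) = (\<Prod>v<j. qlat p - qlat v) / fact (2 * j)"
proof (induction j)
  case (Suc j)
  have 1: "real ((p + Suc j) choose (2 * Suc j)) * real (2 * j + 2) = real (p + j + 1) * real ((p + j) choose (2 * j + 1))"
    using Suc_times_binomial_eq[of "p + j" "2 * j + 1"] unfolding of_nat_mult[symmetric] by simp
  have 2: "real ((p + j) choose (2 * j + 1)) * real (2 * j + 1) = real ((p + j) choose (2 * j)) * (real p - real j)"
    using gbinomial_mult_1[of "real (p + j)" "2 * j"]
    by (simp add: binomial_gbinomial algebra_simps)
  have "real ((p + Suc j) choose (2 * Suc j)) * (real (2 * j + 2) * real (2 * j + 1))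
    = real (p + j + 1) * (real ((p + j) choose (2 * j + 1)) * real (2 * j + 1))"
    using 1 by (simp only: mult_ac)
  also have "\<dots> = real ((p + j) choose (2 * j)) * (qlat p - qlat j)"
    unfolding 2 by (simp add: qlat_diff algebra_simps)
  finally have "real ((p + Suc j) choose (2 * Suc j)) * (real (2 * j + 2) * real (2 * j + 1))
    = (\<Prod>v<Suc j. qlat p - qlat v) / fact (2 * j)"
    unfolding Suc.IH by simp
  moreover have "fact (2 * Suc j) = (real (2 * j + 2) * real (2 * j + 1)) * fact (2 * j)"
    by (simp add: algebra_simps)
  moreover have "X = Y / (A * F)" if "X * A = Y / F" "A \<noteq> 0" for X Y A F :: real
    using that by (metis divide_divide_eq_left mult.commute nonzero_mult_div_cancel_right)
  ultimately show ?case by simp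
qed simp

text \<open>This is \<open>vand {..<n}\<close> by \<open>prod_qlat_below\<close>, in accordance with
  the fact that dents packed against the zigzag leave exactly one tiling.\<close>

definition dent_norm :: "nat \<Rightarrow> real" where
  "dent_norm n = (\<Prod>j<n. fact (2 * j))"

lemma dent_norm_pos: "dent_norm n > 0"
  by (auto simp: dent_norm_def intro!: prod_pos)

text \<open>Pulling the factorials out of the columns leaves a determinant of Newton polynomials
  with nodes \<open>qlat 0, qlat 1, ...\<close>.\<close>

lemma matchings_dented_trapezoid:
  assumes "P \<subseteq> {..<L}"
  shows "real (dented L (2 * card P - 1) 0 P) = vand P / dent_norm (card P)"
proof (cases "card P = 0")
  case True
  then have "P = {}" using assms finite_subset by fastforce
  moreover have "layers L 0 0 = {}" by (auto simp: layers_def)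
  ultimately show ?thesis by (simp add: vand_def dent_norm_def)
next
  case False
  let ?n = "card P"
  have "finite P" using assms finite_subset by blast
  then obtain p where p: "strict_mono_on {..<?n} p" "P = p ` {..<?n}" using strict_mono_enum by blast
  have "real (dented L (2 * ?n - 1) 0 (p ` {..<?n}))
      = det (mat ?n ?n (\<lambda>(i, j). real ((p i + j) choose (2 * j))))"
    by (rule matchings_layers_det) (use False p assms in auto)
  also have "\<dots> = det (mat ?n ?n (\<lambda>(i, j). 1 * (1 / fact (2 * j)) * (\<Prod>v<j. qlat (p i) - qlat v)))"
    by (rule det_cong) (simp add: binomial_qlat)
  also have "\<dots> = vand (p ` {..<?n}) / dent_norm ?n"
    unfolding det_scale det_newton_vand[OF p(1)] by (simp add: dent_norm_def prod_dividef)
  finally show ?thesis using p(2) by simp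
qed

section \<open>Forced lozenges\<close>

text \<open>A cell \<open>Dn k j\<close> with \<open>k = 0\<close> would lie below the trapezoid.\<close>

definition region_over :: "(nat \<times> nat) set \<Rightarrow> cell set" where
  "region_over Q = {Up k j | k j. (k, j) \<in> Q} \<union> {Dn (Suc k) j | k j. (Suc k, j) \<in> Q}"

lemma region_over_simps [simp]:
  "Up k j \<in> region_over Q \<longleftrightarrow> (k, j) \<in> Q"
  "Dn (Suc k) j \<in> region_over Q \<longleftrightarrow> (Suc k, j) \<in> Q"
  "Dn 0 j \<notin> region_over Q"
  by (auto simp: region_over_def)

text \<open>Each \<open>Dn\<close> cell over a shadow only touches cells over the shadow, so by induction on the height
  it must be matched with the \<open>Up\<close> cell of the next row.\<close>

definition shadow :: "cell set \<Rightarrow> (nat \<times> nat) set \<Rightarrow> bool" where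
  "shadow R Q \<longleftrightarrow> (\<forall>k j. (Suc k, j) \<in> Q \<longrightarrow> Dn (Suc k) j \<in> R \<and> Up (Suc k) j \<in> R \<and>
     (\<forall>i. touches (Up k i) (Dn (Suc k) j) \<longrightarrow> (k, i) \<in> Q))"

lemma shadow_Un: "shadow R Q \<Longrightarrow> shadow R Q' \<Longrightarrow> shadow R (Q \<union> Q')"
  unfolding shadow_def by blast

lemma shadow_UN: "(\<And>i. i \<in> I \<Longrightarrow> shadow R (Q i)) \<Longrightarrow> shadow R (\<Union>i\<in>I. Q i)"
  unfolding shadow_def by blast

lemma matching_unique_set:
  assumes "matching A C P" "p \<in> P" "q \<in> P" "c \<in> p" "c \<in> q"
  shows "p = q"
  using assms by (auto simp: matching_def partition_on_def disjoint_def)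

text \<open>A removed triangle standing on the base may be filled in again except for the
  \<open>Up\<close> cells of its bottom row: the new cells only admit forced lozenges. Every fern
  triangle is thus traded for a run of unit dents.\<close>

lemma matchings_shadow:
  assumes Q: "shadow R Q"
  shows "matchings cell_adj (R - region_over Q) = matchings cell_adj (R - Up 0 ` {j. (0, j) \<in> Q})"
proof -
  define M where "M = (\<lambda>(k, j). {Dn (Suc k) j, Up (Suc k) j}) ` {(k, j). (Suc k, j) \<in> Q}"
  define D where "D = {Dn (Suc k) j | k j. (Suc k, j) \<in> Q} \<union> {Up (Suc k) j | k j. (Suc k, j) \<in> Q}"
  let ?R = "R - Up 0 ` {j. (0, j) \<in> Q}"
  have M: "matching cell_adj D M"
  proof -
    have "\<Union>M = D" by (auto simp: M_def D_def)
    moreover have "disjoint M" by (auto simp: M_def disjoint_def)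
    moreover have "\<exists>c d. cell_adj c d \<and> p = {c, d}" if p: "p \<in> M" for p
    proof -
      obtain k j where "p = {Dn (Suc k) j, Up (Suc k) j}" using p by (auto simp: M_def)
      moreover have "cell_adj (Dn (Suc k) j) (Up (Suc k) j)" by simp
      ultimately show ?thesis by blast
    qed
    moreover have "{} \<notin> M" by (auto simp: M_def)
    ultimately show ?thesis by (simp add: matching_def partition_on_def)
  qed
  have sD: "Dn (Suc k) j \<in> R" if "(Suc k, j) \<in> Q" for k j
    using Q that unfolding shadow_def by blast
  have sT: "(k, i) \<in> Q" if "(Suc k, j) \<in> Q" "touches (Up k i) (Dn (Suc k) j)" for k i j
    using Q that unfolding shadow_def by blast
  have D: "D \<subseteq> ?R"
  proof
    fix c assume "c \<in> D"
    then obtain k j where kj: "(Suc k, j) \<in> Q" "c = Dn (Suc k) j \<or> c = Up (Suc k) j" unfolding D_def by blast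
    then have "Dn (Suc k) j \<in> R" "Up (Suc k) j \<in> R" using Q unfolding shadow_def by blast+
    with kj(2) show "c \<in> ?R" by auto
  qed
  have forced: "M \<subseteq> P" if P: "matching cell_adj ?R P" for P
  proof -
    have key: "{Dn (Suc k) j, Up (Suc k) j} \<in> P" if "(Suc k, j) \<in> Q" for k j
      using that
    proof (induction k arbitrary: j rule: less_induct)
      case (less k)
      then have "Dn (Suc k) j \<in> ?R" using sD by auto
      from matching_pair[OF P this symp_cell_adj] obtain d where
        d: "cell_adj (Dn (Suc k) j) d" "{Dn (Suc k) j, d} \<in> P" "d \<in> ?R" by blast
      then obtain l i where l: "d = Up l i" by (cases d) auto
      \<comment> \<open>A partner in the same row would also lie over the shadow. On the base it has
        been removed; higher up it is already taken, by the induction hypothesis, by the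
        \<open>Dn\<close> cell on the other side of its horizontal edge.\<close>
      have "l \<noteq> k"
      proof
        assume lk: "l = k"
        with d l have ki: "(k, i) \<in> Q" by (intro sT[OF less.prems]) simp
        show False
        proof (cases k)
          case 0
          with ki d(3) l lk show False by auto
        next
          case (Suc m)
          with ki less.IH[of m i] have "{Dn k i, Up k i} \<in> P" by simp
          from matching_unique_set[OF P this d(2), of "Up k i"]
          have "{Dn k i, Up k i} = {Dn (Suc k) j, Up k i}" by (simp add: l lk)
          then show False by (simp add: doubleton_eq_iff)
        qed
      qed
      with d(1) have "d = Up (Suc k) j" unfolding l by simp
      with d(2) show ?case by simp
    qed
    show ?thesis
    proof
      fix p assume "p \<in> M"
      then obtain k j where "(Suc k, j) \<in> Q" "p = {Dn (Suc k) j, Up (Suc k) j}" unfolding M_def by auto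
      with key show "p \<in> P" by simp
    qed
  qed
  have "?R - D = R - region_over Q"
  proof (rule Set.set_eqI)
    fix c
    have "c \<in> region_over Q \<longleftrightarrow> c \<in> D \<or> c \<in> Up 0 ` {j. (0, j) \<in> Q}"
    proof (cases c)
      case (Up k j)
      then show ?thesis by (cases k) (auto simp: D_def)
    next
      case (Dn k j)
      then show ?thesis by (cases k) (auto simp: D_def)
    qed
    then show "c \<in> ?R - D \<longleftrightarrow> c \<in> R - region_over Q" by auto
  qed
  with matchings_remove_forced[OF M D forced] show ?thesis by simp
qed

text \<open>The two sides of the triangle, measured from the zigzag; the zigzag's own displacement
  is what makes one side round \<open>k / 2\<close> down and the other round it up.\<close>

definition triangle_over :: "nat \<Rightarrow> nat \<Rightarrow> (nat \<times> nat) set" where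
  "triangle_over p s = {(k, j). p + k div 2 \<le> j \<and> j + (k + 1) div 2 < p + s}"

text \<open>Only the right side is a condition, since the zigzag itself bounds the half triangle on
  the left.\<close>

definition half_triangle_over :: "nat \<Rightarrow> (nat \<times> nat) set" where
  "half_triangle_over s = {(k, j). j + (k + 1) div 2 < s}"

lemma shadow_triangle_over:
  assumes "p + s \<le> L" "s \<le> n"
  shows "shadow (layers L (2 * n - 1) 0 - Up 0 ` S) (triangle_over p s)"
  unfolding shadow_def
proof (intro allI impI)
  fix k j assume kj: "(Suc k, j) \<in> triangle_over p s"
  have "Suc k div 2 + (Suc k + 1) div 2 = Suc k" by presburger
  with kj have k: "Suc k < s" "j + (Suc k + 1) div 2 < L" using assms by (auto simp: triangle_over_def)
  have "(k, i) \<in> triangle_over p s" if "touches (Up k i) (Dn (Suc k) j)" for i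
    using kj that by (cases "even k") (auto simp: triangle_over_def elim!: evenE oddE)
  then show "Dn (Suc k) j \<in> layers L (2 * n - 1) 0 - Up 0 ` S \<and> Up (Suc k) j \<in> layers L (2 * n - 1) 0 - Up 0 ` S \<and>
     (\<forall>i. touches (Up k i) (Dn (Suc k) j) \<longrightarrow> (k, i) \<in> triangle_over p s)"
    using k assms by auto
qed

lemma shadow_half_triangle_over:
  assumes "s \<le> L" "s \<le> n"
  shows "shadow (layers L (2 * n - 1) 0 - Up 0 ` S) (half_triangle_over s)"
  unfolding shadow_def
proof (intro allI impI)
  fix k j assume kj: "(Suc k, j) \<in> half_triangle_over s"
  then have k: "(Suc k + 1) div 2 < s" "j + (Suc k + 1) div 2 < L" using assms by (auto simp: half_triangle_over_def)
  have "(k, i) \<in> half_triangle_over s" if "touches (Up k i) (Dn (Suc k) j)" for i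
    using kj that by (cases "even k") (auto simp: half_triangle_over_def elim!: evenE oddE)
  moreover have "Suc k < 2 * n - 1" using k(1) assms(2) by presburger
  ultimately show "Dn (Suc k) j \<in> layers L (2 * n - 1) 0 - Up 0 ` S \<and> Up (Suc k) j \<in> layers L (2 * n - 1) 0 - Up 0 ` S \<and>
     (\<forall>i. touches (Up k i) (Dn (Suc k) j) \<longrightarrow> (k, i) \<in> half_triangle_over s)"
    using k by auto
qed

lemma matchings_layers_shadow:
  assumes "shadow (layers L h 0 - Up 0 ` S) Q"
  shows "matchings cell_adj (layers L h 0 - region_over Q - Up 0 ` S)
    = dented L h 0 ({j. (0, j) \<in> Q} \<union> S)"
proof -
  have "layers L h 0 - region_over Q - Up 0 ` S = layers L h 0 - Up 0 ` S - region_over Q" by auto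
  moreover have "layers L h 0 - Up 0 ` ({j. (0, j) \<in> Q} \<union> S) = layers L h 0 - Up 0 ` S - Up 0 ` {j. (0, j) \<in> Q}"
    by auto
  ultimately show ?thesis using matchings_shadow[OF assms] by simp
qed

section \<open>Balance\<close>

lemma matching_balanced:
  assumes P: "matching A C P" and fin: "finite C"
    and bip: "\<And>c d. A c d \<Longrightarrow> c \<in> X \<longleftrightarrow> d \<notin> X"
  shows "card (C \<inter> X) = card (C - X)"
proof -
  have one: "card (p \<inter> X) = 1 \<and> card (p - X) = 1 \<and> finite p" if "p \<in> P" for p
  proof -
    have "\<forall>p\<in>P. \<exists>c d. A c d \<and> p = {c, d}" using P unfolding matching_def by (rule conjunct2)
    with that obtain c d where "A c d" "p = {c, d}" by blast
    moreover from this have "c \<in> X \<longleftrightarrow> d \<notin> X" using bip by blast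
    ultimately show ?thesis by (cases "c \<in> X") (auto simp: Int_insert_left insert_Diff_if)
  qed
  have UP: "\<Union>P = C" and dis: "disjoint P" using P by (auto simp: matching_def partition_on_def)
  have finP: "finite P" using UP fin finite_UnionD by blast
  have "card (C \<inter> X) = card (\<Union>p\<in>P. p \<inter> X)" using UP by (intro arg_cong[of _ _ card]) auto
  also have "\<dots> = (\<Sum>p\<in>P. card (p \<inter> X))"
    using finP one dis by (intro card_UN_disjoint) (auto simp: disjoint_def)
  also have "\<dots> = (\<Sum>p\<in>P. card (p - X))" using one by simp
  also have "\<dots> = card (\<Union>p\<in>P. p - X)"
    using finP one dis by (intro card_UN_disjoint[symmetric]) (auto simp: disjoint_def)
  also have "\<dots> = card (C - X)" using UP by (intro arg_cong[of _ _ card]) auto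
  finally show ?thesis .
qed

text \<open>At each height strictly between base and top there are as many \<open>Up\<close> as
  \<open>Dn\<close> cells. This leaves the \<open>Up\<close> cells on the base,
  \<open>L - card P\<close> in number, against the \<open>L - n\<close> \<open>Dn\<close> cells at
  the top. In the hexagon it fixes the number of crossing lozenges.\<close>

lemma matchings_layers_unbalanced:
  assumes P: "Up 0 ` P \<subseteq> layers L (2 * n - 1) 0" and n: "0 < n" "n \<le> L" and card: "card P \<noteq> n"
  shows "dented L (2 * n - 1) 0 P = 0"
proof (rule ccontr)
  let ?h = "2 * n - 1"
  let ?C = "layers L ?h 0 - Up 0 ` P"
  let ?X = "{c. \<exists>k j. c = Up k j}"
  define K where "K = {(k, j). 0 < k \<and> k < ?h \<and> j + (k + 1) div 2 < L}"
  assume "matchings cell_adj ?C \<noteq> 0"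
  then obtain M where M: "matching cell_adj ?C M"
    unfolding matchings_def by (metis (mono_tags, lifting) card.empty empty_Collect_eq)
  have "card (?C \<inter> ?X) = card (?C - ?X)"
  proof (rule matching_balanced[OF M])
    show "c \<in> ?X \<longleftrightarrow> d \<notin> ?X" if "cell_adj c d" for c d
      using that by (cases c; cases d) auto
  qed simp
  have finK: "finite K"
    by (rule finite_subset[of _ "{..?h} \<times> {..L}"]) (auto simp: K_def)
  have cK: "card (case_prod Up ` K) = card K" "card (case_prod Dn ` K) = card K"
    by (auto intro!: card_image simp: inj_on_def)
  have PL: "P \<subseteq> {..<L}" using P n by auto
  have h: "(?h + 1) div 2 = n" using n by simp
  have "?C \<inter> ?X = Up 0 ` ({..<L} - P) \<union> case_prod Up ` K"
    using n by (auto simp: layers_def K_def image_iff)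
  also have "card \<dots> = card (Up 0 ` ({..<L} - P)) + card (case_prod Up ` K)"
    by (rule card_Un_disjoint) (simp add: finK, simp add: finK, auto simp: K_def)
  also have "\<dots> = (L - card P) + card K"
    using PL finite_subset[OF PL] by (simp only: cK) (simp add: card_image inj_on_def card_Diff_subset)
  finally have 1: "card (?C \<inter> ?X) = (L - card P) + card K" .
  have "?C - ?X = Dn ?h ` {..<L - n} \<union> case_prod Dn ` K"
  proof (rule Set.set_eqI)
    fix c show "c \<in> ?C - ?X \<longleftrightarrow> c \<in> Dn ?h ` {..<L - n} \<union> case_prod Dn ` K"
    proof (cases c)
      case (Dn k j)
      have "k = ?h \<Longrightarrow> (j + (k + 1) div 2 < L \<longleftrightarrow> j < L - n)" using h by auto
      then show ?thesis using Dn n by (cases "k = ?h") (auto simp: K_def image_iff)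
    qed auto
  qed
  also have "card \<dots> = card (Dn ?h ` {..<L - n}) + card (case_prod Dn ` K)"
    by (rule card_Un_disjoint) (simp add: finK, simp add: finK, auto simp: K_def)
  also have "\<dots> = (L - n) + card K" by (simp only: cK) (simp add: card_image inj_on_def)
  finally have "card (?C - ?X) = (L - n) + card K" .
  with 1 \<open>card (?C \<inter> ?X) = card (?C - ?X)\<close> have "L - card P = L - n" by simp
  moreover have "card P \<le> L" using card_mono[OF _ PL] by simp
  ultimately show False using card n by simp
qed

section \<open>Segments of a sequence\<close>

text \<open>Segments whose lengths are the terms are laid out from \<open>p\<close>; \<open>b\<close> tells whether those with odd or
  those with even index (counted from 1) are taken.\<close>

fun segs :: "bool \<Rightarrow> nat \<Rightarrow> nat list \<Rightarrow> nat set" where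
  "segs b p [] = {}"
| "segs b p (v # vs) = (if b then {p..<p + v} else {}) \<union> segs (\<not> b) (p + v) vs"

lemma segs_subset: "segs b p vs \<subseteq> {p..<p + sum_list vs}"
proof (induction vs arbitrary: b p)
  case (Cons v vs)
  have "segs b' (p + v) vs \<subseteq> {p..<p + sum_list (v # vs)}" for b'
    using Cons[of b' "p + v"] by (auto simp: subset_iff)
  then show ?case by auto
qed simp

lemma finite_segs [simp]: "finite (segs b p vs)"
  using finite_subset[OF segs_subset] by blast

lemma segs_Un: "segs b p vs \<union> segs (\<not> b) p vs = {p..<p + sum_list vs}"
proof (induction vs arbitrary: b p)
  case (Cons v vs)
  have "{p..<p + sum_list (v # vs)} = {p..<p + v} \<union> {p + v..<p + v + sum_list vs}" by auto
  then show ?case using Cons[of b "p + v"] by auto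
qed simp

lemma segs_Int: "segs b p vs \<inter> segs (\<not> b) p vs = {}"
proof (induction vs arbitrary: b p)
  case (Cons v vs)
  have "segs b' (p + v) vs \<inter> {p..<p + v} = {}" for b' using segs_subset[of b' "p + v" vs] by auto
  then show ?case using Cons[of b "p + v"] by auto
qed simp

lemma segs_append:
  "segs b p (us @ vs) = segs b p us \<union> segs (if even (length us) then b else \<not> b) (p + sum_list us) vs"
  by (induction us arbitrary: b p) (auto simp: add.assoc)

lemma segs_replicate_0 [simp]: "segs b p (replicate k 0) = {}"
  by (induction k arbitrary: b) auto

text \<open>The right fern is indexed from its right end, whereas the sequences of the quartered
  hexagons list it from the left. Reversal sends index \<open>i\<close> to
  \<open>length vs + 1 - i\<close>, so parity is kept exactly for an odd number of terms.\<close>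

lemma segs_rev:
  "(\<lambda>t. p + q + sum_list vs - 1 - t) ` segs b q vs = segs (if odd (length vs) then b else \<not> b) p (rev vs)"
proof (induction vs arbitrary: b q)
  case (Cons v vs)
  let ?M = "p + q + sum_list (v # vs)"
  have M: "?M = p + (q + v) + sum_list vs" by simp
  have "(\<lambda>t. ?M - 1 - t) ` {q..<q + v} = {p + sum_list vs..<p + sum_list vs + v}"
  proof (intro equalityI subsetI)
    fix x assume "x \<in> {p + sum_list vs..<p + sum_list vs + v}"
    then show "x \<in> (\<lambda>t. ?M - 1 - t) ` {q..<q + v}"
      by (intro image_eqI[of _ _ "?M - 1 - x"]) auto
  qed auto
  then have "(\<lambda>t. ?M - 1 - t) ` segs b q (v # vs)
      = (if b then {p + sum_list vs..<p + sum_list vs + v} else {})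
        \<union> segs (if odd (length vs) then \<not> b else b) p (rev vs)"
    using Cons[of "q + v" "\<not> b"] unfolding M by (auto simp: image_Un)
  then show ?case by (auto simp: segs_append sum_list_rev)
qed simp

lemma entry_Suc_Cons: "entry (v # vs) (Suc i) = (if i = 0 then v else entry vs i)"
  by (cases i) (auto simp: entry_def)

lemma odd_sum_Cons: "odd_sum (v # vs) = v + even_sum vs"
proof -
  have "{i \<in> {1..length (v # vs)}. odd i} = insert 1 (Suc ` {i \<in> {1..length vs}. even i})"
  proof (rule Set.set_eqI)
    fix i show "i \<in> {i \<in> {1..length (v # vs)}. odd i} \<longleftrightarrow> i \<in> insert 1 (Suc ` {i \<in> {1..length vs}. even i})"
      by (cases i) (auto simp: image_iff elim!: evenE)
  qed
  then show ?thesis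
    unfolding odd_sum_def even_sum_def
    by (simp add: sum.reindex entry_Suc_Cons[of v vs 0, simplified] entry_Suc_Cons image_iff)
qed

lemma even_sum_Cons: "even_sum (v # vs) = odd_sum vs"
proof -
  have "{i \<in> {1..length (v # vs)}. even i} = Suc ` {i \<in> {1..length vs}. odd i}"
  proof (rule Set.set_eqI)
    fix i show "i \<in> {i \<in> {1..length (v # vs)}. even i} \<longleftrightarrow> i \<in> Suc ` {i \<in> {1..length vs}. odd i}"
      by (cases i) (auto simp: image_iff Suc_le_eq odd_pos)
  qed
  then show ?thesis
    unfolding odd_sum_def even_sum_def
    by (simp add: sum.reindex) (auto intro!: sum.cong simp: entry_Suc_Cons)
qed

lemma card_segs: "card (segs b p vs) = (if b then odd_sum vs else even_sum vs)"
proof (induction vs arbitrary: b p)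
  case (Cons v vs)
  have "{p..<p + v} \<inter> segs False (p + v) vs = {}" using segs_subset[of False "p + v" vs] by auto
  then show ?case using Cons by (auto simp: odd_sum_Cons even_sum_Cons card_Un_disjoint)
qed (simp add: odd_sum_def even_sum_def)

lemma odd_even_sum: "odd_sum vs + even_sum vs = sum_list vs"
proof (induction vs)
  case Nil
  show ?case by (simp add: odd_sum_def even_sum_def)
qed (simp add: odd_sum_Cons even_sum_Cons)

lemma mem_segs_iff:
  "j \<in> segs b p vs \<longleftrightarrow> (\<exists>i\<in>{1..length vs}. odd i = b \<and> p + psum vs (i - 1) \<le> j \<and> j < p + psum vs i)"
proof (induction vs arbitrary: b p)
  case (Cons v vs)
  have "(\<exists>i\<in>{1..length (v # vs)}. odd i = b \<and> p + psum (v # vs) (i - 1) \<le> j \<and> j < p + psum (v # vs) i)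
    \<longleftrightarrow> (b \<and> p \<le> j \<and> j < p + v) \<or> (\<exists>i\<in>{1..length vs}. odd i = (\<not> b) \<and> p + v + psum vs (i - 1) \<le> j \<and> j < p + v + psum vs i)"
    (is "?l \<longleftrightarrow> ?r")
  proof
    assume ?l
    then obtain i where i: "i \<in> {1..length (v # vs)}" "odd i = b" "p + psum (v # vs) (i - 1) \<le> j" "j < p + psum (v # vs) i" by blast
    then obtain k where k: "i = Suc k" by (cases i) auto
    show ?r
    proof (cases k)
      case 0
      then show ?thesis using i k by (simp add: psum_def)
    next
      case (Suc l)
      then show ?thesis using i k by (intro disjI2 bexI[of _ k]) (auto simp: psum_def)
    qed
  next
    assume ?r
    then show ?l
    proof
      assume "b \<and> p \<le> j \<and> j < p + v"
      then show ?l by (intro bexI[of _ 1]) (auto simp: psum_def)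
    next
      assume "\<exists>i\<in>{1..length vs}. odd i = (\<not> b) \<and> p + v + psum vs (i - 1) \<le> j \<and> j < p + v + psum vs i"
      then obtain i where "i \<in> {1..length vs}" "odd i = (\<not> b)" "p + v + psum vs (i - 1) \<le> j" "j < p + v + psum vs i" by blast
      then show ?l by (intro bexI[of _ "Suc i"]; cases i) (auto simp: psum_def)
    qed
  qed
  then show ?case using Cons[of "\<not> b" "p + v"] by auto
qed simp

lemma psum_Suc: "i < length vs \<Longrightarrow> psum vs (Suc i) = psum vs i + entry vs (Suc i)"
  by (simp add: psum_def entry_def take_Suc_conv_app_nth)

lemma psum_mono: "i \<le> j \<Longrightarrow> psum vs i \<le> psum vs j"
proof (induction j)
  case (Suc j)
  have "psum vs j \<le> psum vs (Suc j)"
    by (cases "j < length vs") (simp add: psum_Suc, simp add: psum_def)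
  with Suc show ?case by (cases "i = Suc j") auto
qed simp

lemma psum_le: "psum vs i \<le> sum_list vs"
  using psum_mono[of i "max i (length vs)" vs] by (simp add: psum_def)

lemma entry_le_odd_sum: "odd i \<Longrightarrow> entry vs i \<le> odd_sum vs"
  unfolding odd_sum_def by (cases "i \<in> {1..length vs}") (auto simp: entry_def intro!: member_le_sum)

lemma entry_le_even_sum: "even i \<Longrightarrow> entry vs i \<le> even_sum vs"
  unfolding even_sum_def by (cases "i \<in> {1..length vs}") (auto simp: entry_def intro!: member_le_sum)

lemma map_entry: "length vs \<le> N \<Longrightarrow> map (entry vs) [1..<N + 1] = vs @ replicate (N - length vs) 0"
proof (rule nth_equalityI)
  fix i assume "length vs \<le> N" "i < length (map (entry vs) [1..<N + 1])"
  then show "map (entry vs) [1..<N + 1] ! i = (vs @ replicate (N - length vs) 0) ! i"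
    by (auto simp: entry_def nth_append simp del: upt_Suc)
qed simp

section \<open>From unit triangles to cells\<close>

definition face_adj :: "face \<Rightarrow> face \<Rightarrow> bool" where
  "face_adj f g \<longleftrightarrow> f \<in> faces \<and> g \<in> faces \<and> card (f \<inter> g) = 2"

lemma symp_face_adj: "symp face_adj"
  by (auto simp: symp_def face_adj_def Int_commute)

lemma num_tilings_eq_matchings: "num_tilings R = matchings face_adj R"
proof -
  have "lozenge p \<longleftrightarrow> (\<exists>f g. face_adj f g \<and> p = {f, g})" for p
    unfolding lozenge_def face_adj_def by blast
  then have "tiling R P \<longleftrightarrow> matching face_adj R P" for P
    unfolding tiling_def matching_def by simp
  then show ?thesis by (simp add: num_tilings_def matchings_def)
qed

text \<open>Integer coordinates: horizontal ones are doubled, and \<open>\<epsilon> = -1\<close> reflects in the line \<open>k = 0\<close>.\<close>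

definition pt :: "int \<Rightarrow> int \<times> int \<Rightarrow> point" where
  "pt \<epsilon> = (\<lambda>(X, K). (real_of_int X / 2, \<epsilon> * K))"

text \<open>The summand \<open>int k mod 2\<close> is twice the zigzag's coordinate at height
  \<open>k\<close>, so \<open>j\<close> counts unit steps from the zigzag.\<close>

definition corner :: "nat \<Rightarrow> nat \<Rightarrow> int" where
  "corner k j = 2 * int j + int k mod 2"

fun corners :: "cell \<Rightarrow> (int \<times> int) set" where
  "corners (Up k j) = {(corner k j, int k), (corner k j + 2, int k), (corner k j + 1, int k + 1)}"
| "corners (Dn k j) = {(corner k j, int k), (corner k j + 2, int k), (corner k j + 1, int k - 1)}"

definition face_of :: "int \<Rightarrow> cell \<Rightarrow> face" where
  "face_of \<epsilon> c = pt \<epsilon> ` corners c"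

lemma inj_pt: "\<epsilon> \<noteq> 0 \<Longrightarrow> inj_on (pt \<epsilon>) A"
  by (auto simp: inj_on_def pt_def)

lemma card_Int_triple:
  assumes "a \<noteq> b" "a \<noteq> c" "b \<noteq> c"
  shows "card ({a, b, c} \<inter> B) = of_bool (a \<in> B) + of_bool (b \<in> B) + of_bool (c \<in> B)"
  using assms by (auto simp: Int_insert_left)

lemma corner_eq_iff: "corner k j = corner k i \<longleftrightarrow> i = j"
  by (auto simp: corner_def)

lemma corner_next:
  "corner k j = corner (Suc k) i + 1 \<longleftrightarrow> (if even k then j = Suc i else i = j)"
  "corner k j + 1 = corner (Suc k) i \<longleftrightarrow> (if even k then i = j else i = Suc j)"
  unfolding corner_def by (cases "even k"; auto elim!: evenE oddE; presburger)+

lemma card_corners_Up_Dn: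
  fixes X Y k l :: int
  shows "card ({(X, k), (X + 2, k), (X + 1, k + 1)} \<inter> {(Y, l), (Y + 2, l), (Y + 1, l - 1)}) = 2
    \<longleftrightarrow> (l = k \<and> X = Y) \<or> (l = k + 1 \<and> (X = Y + 1 \<or> X + 1 = Y))"
proof -
  consider "l = k" | "l = k + 1" | "l \<noteq> k" "l \<noteq> k + 1" by blast
  then show ?thesis
  proof cases
    case 1
    have "card ({(X, k), (X + 2, k), (X + 1, k + 1)} \<inter> {(Y, k), (Y + 2, k), (Y + 1, k - 1)})
      = of_bool (X = Y \<or> X = Y + 2) + of_bool (X + 2 = Y \<or> X = Y)"
      by (subst card_Int_triple) simp_all
    then show ?thesis unfolding 1 by (simp add: of_bool_def)
  next
    case 2
    have "card ({(X, k), (X + 2, k), (X + 1, k + 1)} \<inter> {(Y, k + 1), (Y + 2, k + 1), (Y + 1, k)})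
      = of_bool (X = Y + 1) + of_bool (X + 2 = Y + 1) + of_bool (X + 1 = Y \<or> X + 1 = Y + 2)"
      by (subst card_Int_triple) simp_all
    then show ?thesis unfolding 2 by (simp add: of_bool_def)
  next
    case 3
    let ?B = "{(Y, l), (Y + 2, l), (Y + 1, l - 1)}"
    have "(X, k) \<notin> ?B" "(X + 2, k) \<notin> ?B" using 3 by auto
    then have "card ({(X, k), (X + 2, k), (X + 1, k + 1)} \<inter> ?B) = of_bool ((X + 1, k + 1) \<in> ?B)"
      by (subst card_Int_triple) (simp_all only: of_bool_eq prod.inject, simp_all)
    then have "card ({(X, k), (X + 2, k), (X + 1, k + 1)} \<inter> ?B) \<le> 1" by (simp only: of_bool_def split: if_split) simp
    then show ?thesis using 3 by simp
  qed
qed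

lemma corner_bounds:
  "int k mod 2 \<le> corner k j" "int k mod 2 \<le> corner k j + 2"
  "(int k + 1) mod 2 \<le> corner k j + 1" "(int k - 1) mod 2 \<le> corner k j + 1"
  unfolding corner_def by presburger+

lemma corner_add: "corner k j + int k = 2 * int j + 2 * int ((k + 1) div 2)"
  and corner_diff: "corner k j - int k = 2 * int j - 2 * int (k div 2)"
  unfolding corner_def by presburger+

text \<open>Two distinct cells of the same orientation share at most one vertex, so only mixed pairs
  matter; for these the displacement of the zigzag between consecutive heights explains the parity
  in \<open>touches\<close>.\<close>

lemma card_corners: "card (corners c \<inter> corners d) = 2 \<longleftrightarrow> cell_adj c d"
proof -
  have uu: "card (corners (Up k j) \<inter> corners (Up l i)) \<noteq> 2" for k j l i
    unfolding corners.simps(1)[of k j] by (subst card_Int_triple) (auto simp: of_bool_def)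
  have dd: "card (corners (Dn k j) \<inter> corners (Dn l i)) \<noteq> 2" for k j l i
    unfolding corners.simps(2)[of k j] by (subst card_Int_triple) (auto simp: of_bool_def)
  have ud: "card (corners (Up k j) \<inter> corners (Dn l i)) = 2 \<longleftrightarrow> touches (Up k j) (Dn l i)" for k j l i
  proof -
    have "card (corners (Up k j) \<inter> corners (Dn l i)) = 2 \<longleftrightarrow>
      (l = k \<and> corner k j = corner l i) \<or> (l = Suc k \<and> (corner k j = corner l i + 1 \<or> corner k j + 1 = corner l i))"
    proof -
      have "int l = int k + 1 \<longleftrightarrow> l = Suc k" by linarith
      then show ?thesis unfolding corners.simps card_corners_Up_Dn by simp
    qed
    also have "\<dots> \<longleftrightarrow> touches (Up k j) (Dn l i)"
    proof (cases "l = Suc k")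
      case True
      show ?thesis unfolding True corner_next by auto
    next
      case False
      show ?thesis using corner_eq_iff[of k j i] False by (cases "l = k") auto
    qed
    finally show ?thesis .
  qed
  have du: "card (corners (Dn l i) \<inter> corners (Up k j)) = 2 \<longleftrightarrow> touches (Up k j) (Dn l i)" for k j l i
    using ud[of k j l i] by (simp only: Int_commute)
  show ?thesis
    by (cases c; cases d) (simp_all only: uu dd ud du cell_adj_simps)
qed

lemma inj_corners: "inj corners"
proof (rule injI)
  fix c d assume eq: "corners c = corners d"
  \<comment> \<open>Modulo 3 the sum of the heights reveals the orientation, its value then the row;
    the sum of the first coordinates gives the column.\<close>
  have sums: "(\<Sum>p\<in>corners (Up k j). snd p) = 3 * int k + 1" "(\<Sum>p\<in>corners (Dn k j). snd p) = 3 * int k - 1"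
    "(\<Sum>p\<in>corners (Up k j). fst p) = 3 * corner k j + 3" "(\<Sum>p\<in>corners (Dn k j). fst p) = 3 * corner k j + 3" for k j
    by simp_all
  show "c = d"
    using arg_cong[OF eq, of "sum snd"] arg_cong[OF eq, of "sum fst"]
    by (cases c; cases d; simp only: sums; (presburger | simp add: corner_eq_iff))
qed

lemma inj_face_of: "\<epsilon> \<noteq> 0 \<Longrightarrow> inj_on (face_of \<epsilon>) A"
  unfolding face_of_def inj_on_def
  by (metis inj_corners inj_pt inj_image_eq_iff injD)

lemma face_of_cases:
  "face_of 1 (Up k j) = up_face (real_of_int (corner k j) / 2) (int k)"
  "face_of 1 (Dn k j) = down_face (real_of_int (corner k j) / 2) (int k)"
  "face_of (- 1) (Up k j) = down_face (real_of_int (corner k j) / 2) (- int k)"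
  "face_of (- 1) (Dn k j) = up_face (real_of_int (corner k j) / 2) (- int k)"
  by (simp_all add: face_of_def pt_def up_face_def down_face_def add_divide_distrib)

lemma face_of_faces:
  assumes "\<epsilon> = 1 \<or> \<epsilon> = - 1"
  shows "face_of \<epsilon> c \<in> faces"
proof -
  have "(real_of_int (corner k j) / 2, \<epsilon> * int k) \<in> Defs.lattice" for k j
  proof -
    have "2 dvd corner k j - \<epsilon> * int k" using assms unfolding corner_def by presburger
    then have "real_of_int (corner k j) / 2 - real_of_int (\<epsilon> * int k) / 2 = real_of_int ((corner k j - \<epsilon> * int k) div 2)"
      by (simp add: real_of_int_div diff_divide_distrib)
    then show ?thesis by (simp only: Defs.lattice_def mem_Collect_eq prod.case Ints_of_int)
  qed
  moreover have "up_face u k \<in> faces" "down_face u k \<in> faces" if "(u, k) \<in> Defs.lattice" for u k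
    using that unfolding faces_def by blast+
  ultimately show ?thesis using assms by (cases c) (auto simp: face_of_cases)
qed

lemma face_adj_face_of:
  assumes "\<epsilon> = 1 \<or> \<epsilon> = - 1"
  shows "face_adj (face_of \<epsilon> c) (face_of \<epsilon> d) \<longleftrightarrow> cell_adj c d"
proof -
  have ne: "\<epsilon> \<noteq> 0" using assms by auto
  have "face_of \<epsilon> c \<inter> face_of \<epsilon> d = pt \<epsilon> ` (corners c \<inter> corners d)"
    unfolding face_of_def by (rule image_Int[OF inj_pt[OF ne], symmetric])
  then have "card (face_of \<epsilon> c \<inter> face_of \<epsilon> d) = card (corners c \<inter> corners d)"
    by (simp add: card_image[OF inj_pt[OF ne]])
  then show ?thesis using face_of_faces[OF assms] by (simp add: face_adj_def card_corners)
qed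

lemma matchings_face_of:
  assumes "\<epsilon> = 1 \<or> \<epsilon> = - 1"
  shows "matchings face_adj (face_of \<epsilon> ` C) = matchings cell_adj C"
proof -
  have "\<epsilon> \<noteq> 0" using assms by auto
  then show ?thesis by (intro matchings_transport inj_face_of) (simp_all add: face_adj_face_of[OF assms])
qed

fun above :: "cell \<Rightarrow> bool" where
  "above (Up k j) \<longleftrightarrow> True"
| "above (Dn k j) \<longleftrightarrow> k > 0"

text \<open>The zigzag depends only on the parity of the height, hence is symmetric in the cut, and
  the same cell coordinates describe both halves.\<close>

lemma lattice_right_of_zigzag:
  assumes "(u, k) \<in> Defs.lattice" "zigzag k \<le> u" "0 \<le> \<epsilon> * k" "\<epsilon> = 1 \<or> \<epsilon> = - 1"
  obtains j l where "u = real_of_int (corner l j) / 2" "k = \<epsilon> * int l"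
proof -
  define l where "l = nat (\<epsilon> * k)"
  have k: "k = \<epsilon> * int l" using assms(3,4) by (auto simp: l_def)
  have kl: "k mod 2 = int l mod 2" using k assms(4) by (auto simp: minus_mod_int_eq) presburger
  obtain w where w: "u - real_of_int k / 2 = real_of_int w" using assms(1) by (auto simp: Defs.lattice_def elim: Ints_cases)
  have z: "zigzag k = real_of_int (k mod 2) / 2" by (auto simp: zigzag_def even_iff_mod_2_eq_zero odd_iff_mod_2_eq_one)
  have "real_of_int (k mod 2) \<le> real_of_int (2 * w + k)" using assms(2) w z by simp
  then have le: "k mod 2 \<le> 2 * w + k" by linarith
  define j where "j = nat (w + k div 2)"
  have "0 \<le> w + k div 2" using le by presburger
  then have "int j = w + k div 2" by (simp add: j_def)
  then have "corner l j = 2 * w + k" unfolding corner_def kl[symmetric] by presburger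
  then have "u = real_of_int (corner l j) / 2" using w by simp
  with k that show thesis by blast
qed

lemma face_right_of_zigzag:
  assumes f: "f \<in> faces" and \<epsilon>: "\<epsilon> = 1 \<or> \<epsilon> = - 1"
    and pos: "\<And>u k. (u, k) \<in> f \<Longrightarrow> 0 \<le> \<epsilon> * k \<and> zigzag k \<le> u"
  obtains c where "f = face_of \<epsilon> c" "above c"
proof -
  from f consider (up) u k where "(u, k) \<in> Defs.lattice" "f = up_face u k"
    | (down) u k where "(u, k) \<in> Defs.lattice" "f = down_face u k"
    by (auto simp: faces_def)
  then show thesis
  proof cases
    case up
    have p1: "0 \<le> \<epsilon> * k" "zigzag k \<le> u" using pos[of u k] up by (auto simp: up_face_def)
    have p2: "0 \<le> \<epsilon> * (k + 1)" using pos[of "u + 1/2" "k + 1"] up by (auto simp: up_face_def)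
    obtain j l where jl: "u = real_of_int (corner l j) / 2" "k = \<epsilon> * int l"
      using lattice_right_of_zigzag[OF up(1) p1(2,1) \<epsilon>] .
    show thesis
    proof (cases "\<epsilon> = 1")
      case True
      then show thesis using that[of "Up l j"] up jl by (simp add: face_of_cases)
    next
      case False
      then have e: "\<epsilon> = - 1" using \<epsilon> by simp
      then have "l > 0" using p2 jl by (cases l) auto
      then show thesis using that[of "Dn l j"] up jl e by (simp add: face_of_cases)
    qed
  next
    case down
    have p1: "0 \<le> \<epsilon> * k" "zigzag k \<le> u" using pos[of u k] down by (auto simp: down_face_def)
    have p2: "0 \<le> \<epsilon> * (k - 1)" using pos[of "u + 1/2" "k - 1"] down by (auto simp: down_face_def)
    obtain j l where jl: "u = real_of_int (corner l j) / 2" "k = \<epsilon> * int l"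
      using lattice_right_of_zigzag[OF down(1) p1(2,1) \<epsilon>] .
    show thesis
    proof (cases "\<epsilon> = 1")
      case True
      then have "l > 0" using p2 jl by (cases l) auto
      then show thesis using that[of "Dn l j"] down jl True by (simp add: face_of_cases)
    next
      case False
      then have "\<epsilon> = - 1" using \<epsilon> by simp
      then show thesis using that[of "Up l j"] down jl by (simp add: face_of_cases)
    qed
  qed
qed

section \<open>Parts of the plane bounded by lattice lines, as sets of cells\<close>

lemma faces_within_eq:
  assumes \<epsilon>: "\<epsilon> = 1 \<or> \<epsilon> = - 1"
    and Q: "\<And>u k. (u, k) \<in> Q \<Longrightarrow> 0 \<le> \<epsilon> * k \<and> zigzag k \<le> u"
    and C: "\<And>c. above c \<Longrightarrow> (\<forall>p\<in>corners c. pt \<epsilon> p \<in> Q) \<longleftrightarrow> c \<in> C" "\<And>c. c \<in> C \<Longrightarrow> above c"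
  shows "faces_within Q = face_of \<epsilon> ` C"
proof (intro equalityI subsetI)
  fix f assume "f \<in> faces_within Q"
  then have f: "f \<in> faces" "f \<subseteq> Q" by (auto simp: faces_within_def)
  then obtain c where c: "f = face_of \<epsilon> c" "above c"
    using face_right_of_zigzag[OF f(1) \<epsilon>] Q by (metis subsetD)
  then have "\<forall>p\<in>corners c. pt \<epsilon> p \<in> Q" using f by (auto simp: face_of_def)
  then show "f \<in> face_of \<epsilon> ` C" using C(1)[OF c(2)] c by blast
next
  fix f assume "f \<in> face_of \<epsilon> ` C"
  then obtain c where c: "c \<in> C" "f = face_of \<epsilon> c" by blast
  then have "\<forall>p\<in>corners c. pt \<epsilon> p \<in> Q" using C by blast
  then show "f \<in> faces_within Q"
    using face_of_faces[OF \<epsilon>, of c] c by (auto simp: faces_within_def face_of_def)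
qed

lemma face_of_faces_within:
  "\<epsilon> = 1 \<or> \<epsilon> = - 1 \<Longrightarrow> face_of \<epsilon> c \<in> faces_within Q \<longleftrightarrow> (\<forall>p\<in>corners c. pt \<epsilon> p \<in> Q)"
  using face_of_faces[of \<epsilon> c] by (auto simp: faces_within_def face_of_def)

lemma zigzag_le_iff: "zigzag K \<le> real_of_int X / 2 \<longleftrightarrow> K mod 2 \<le> X"
proof -
  have "zigzag K = real_of_int (K mod 2) / 2"
    by (auto simp: zigzag_def even_iff_mod_2_eq_zero odd_iff_mod_2_eq_one)
  then show ?thesis by simp
qed

lemma right_side_iff:
  "real_of_int X / 2 \<le> real L - real_of_int K / 2 \<longleftrightarrow> X + K \<le> 2 * int L"
  "real_of_int X / 2 \<le> real L + real_of_int K / 2 \<longleftrightarrow> X - K \<le> 2 * int L"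
  by linarith+

lemma right_side_add_iff:
  "real_of_int X / 2 \<le> real L + real z - real_of_int K / 2 \<longleftrightarrow> X + K \<le> 2 * int (L + z)"
  "real_of_int X / 2 \<le> real L + real z + real_of_int K / 2 \<longleftrightarrow> X - K \<le> 2 * int (L + z)"
  using right_side_iff[of X "L + z" K] by simp_all

lemma left_side_iff:
  "real p + real_of_int K / 2 \<le> real_of_int X / 2 \<longleftrightarrow> 2 * int p + K \<le> X"
  "real p - real_of_int K / 2 \<le> real_of_int X / 2 \<longleftrightarrow> 2 * int p - K \<le> X"
  by linarith+

lemmas side_iffs = zigzag_le_iff right_side_iff right_side_add_iff left_side_iff

fun row :: "cell \<Rightarrow> nat" where "row (Up k j) = k" | "row (Dn k j) = k"
fun col :: "cell \<Rightarrow> nat" where "col (Up k j) = j" | "col (Dn k j) = j"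

lemma corners_right:
  "(\<forall>(X, K)\<in>corners c. X + K \<le> 2 * int M) \<longleftrightarrow> col c + (row c + 1) div 2 < M"
proof -
  have "(\<forall>(X, K)\<in>corners c. X + K \<le> 2 * int M) \<longleftrightarrow> corner (row c) (col c) + int (row c) + 2 \<le> 2 * int M"
    by (cases c) auto
  also have "\<dots> \<longleftrightarrow> col c + (row c + 1) div 2 < M" unfolding corner_add by linarith
  finally show ?thesis .
qed

lemma corners_left:
  "(\<forall>(X, K)\<in>corners c. 2 * int p + K \<le> X) \<longleftrightarrow> p + row c div 2 \<le> col c"
proof -
  have "(\<forall>(X, K)\<in>corners c. 2 * int p + K \<le> X) \<longleftrightarrow> 2 * int p \<le> corner (row c) (col c) - int (row c)"
    by (cases c) auto
  also have "\<dots> \<longleftrightarrow> p + row c div 2 \<le> col c" unfolding corner_diff by linarith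
  finally show ?thesis .
qed

text \<open>The side of a triangle is a lattice line and cuts no cell, so a cell that is not on one
  side of it lies entirely on the other.\<close>

lemma corners_left_complement:
  "(\<forall>(X, K)\<in>corners c. X - K \<le> 2 * int p) \<longleftrightarrow> \<not> p + row c div 2 \<le> col c"
proof -
  have "(\<forall>(X, K)\<in>corners c. X - K \<le> 2 * int p) \<longleftrightarrow> corner (row c) (col c) - int (row c) + 2 \<le> 2 * int p"
    by (cases c) auto
  also have "\<dots> \<longleftrightarrow> \<not> p + row c div 2 \<le> col c" unfolding corner_diff by linarith
  finally show ?thesis .
qed

lemma corners_zigzag: "(X, K) \<in> corners c \<Longrightarrow> K mod 2 \<le> X"
  using corner_bounds by (cases c) auto

lemma neg_mod_2: "(- K) mod 2 = K mod (2 :: int)"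
  by presburger

lemma corners_above: "above c \<Longrightarrow> (X, K) \<in> corners c \<Longrightarrow> 0 \<le> K"
  by (cases c) auto

lemma layers_iff:
  assumes "above c"
  shows "c \<in> layers L (2 * n - 1) 0 \<longleftrightarrow>
    (\<forall>(X, K)\<in>corners c. K \<le> 2 * int n - 1) \<and> col c + (row c + 1) div 2 < L"
  using assms by (cases c) auto

lemma region_over_iff:
  assumes "above c"
  shows "c \<in> region_over Q \<longleftrightarrow> (row c, col c) \<in> Q"
  using assms by (cases c; cases "row c") auto

lemma above_layers: "c \<in> layers L h k \<Longrightarrow> above c"
  by (cases c) auto

lemma ball_pt: "(\<forall>p\<in>corners c. pt \<epsilon> p \<in> {(u, k). P u k}) \<longleftrightarrow> (\<forall>(X, K)\<in>corners c. P (real_of_int X / 2) (\<epsilon> * K))"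
  by (auto simp: pt_def)

lemma ball_conj: "(\<forall>(X, K)\<in>A. P X K \<and> Q X K) \<longleftrightarrow> (\<forall>(X, K)\<in>A. P X K) \<and> (\<forall>(X, K)\<in>A. Q X K)"
  by auto

lemma trapezoid_faces:
  "faces_within {(u, k). 0 \<le> k \<and> k \<le> 2 * int n - 1 \<and> zigzag k \<le> u \<and> u \<le> real L - real_of_int k / 2}
    = face_of 1 ` layers L (2 * n - 1) 0"
proof (rule faces_within_eq)
  fix c assume c: "above c"
  have "(\<forall>(X, K)\<in>corners c. 0 \<le> K)" "(\<forall>(X, K)\<in>corners c. K mod 2 \<le> X)"
    using corners_above[OF c] corners_zigzag by auto
  then show "(\<forall>p\<in>corners c. pt 1 p \<in> {(u, k). 0 \<le> k \<and> k \<le> 2 * int n - 1 \<and> zigzag k \<le> u \<and> u \<le> real L - real_of_int k / 2})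
    \<longleftrightarrow> c \<in> layers L (2 * n - 1) 0"
    unfolding ball_pt mult_1 side_iffs ball_conj corners_right layers_iff[OF c] by simp
qed (auto simp: above_layers)

text \<open>After reflection the last bound excludes the cells beyond the left side of the triangle
  on the segment from \<open>L\<close> to \<open>L + z\<close>. The lower half is therefore a
  trapezoid with base \<open>L + z\<close> minus one triangle, which can be treated like a fern
  triangle.\<close>

lemma lower_trapezoid_faces:
  "faces_within {(u, k). - (2 * int n - 1) \<le> k \<and> k \<le> 0 \<and> zigzag k \<le> u \<and> u \<le> real L - real_of_int k / 2
      \<and> u \<le> real L + real z + real_of_int k / 2}
    = face_of (- 1) ` (layers (L + z) (2 * n - 1) 0 - region_over (triangle_over L z))"
proof (rule faces_within_eq)
  fix c assume c: "above c"
  have 1: "(\<forall>(X, K)\<in>corners c. - K \<le> 0)" "(\<forall>(X, K)\<in>corners c. (- K) mod 2 \<le> X)"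
    using corners_above[OF c] corners_zigzag by (auto simp: neg_mod_2)
  have "(\<forall>p\<in>corners c. pt (- 1) p \<in> {(u, k). - (2 * int n - 1) \<le> k \<and> k \<le> 0 \<and> zigzag k \<le> u \<and> u \<le> real L - real_of_int k / 2
      \<and> u \<le> real L + real z + real_of_int k / 2})
    \<longleftrightarrow> (\<forall>(X, K)\<in>corners c. K \<le> 2 * int n - 1) \<and> (\<forall>(X, K)\<in>corners c. X - K \<le> 2 * int L)
      \<and> (\<forall>(X, K)\<in>corners c. X + K \<le> 2 * int (L + z))"
    unfolding ball_pt mult_minus1 neg_le_iff_le side_iffs ball_conj using 1 by simp
  then show "(\<forall>p\<in>corners c. pt (- 1) p \<in> {(u, k). - (2 * int n - 1) \<le> k \<and> k \<le> 0 \<and> zigzag k \<le> u \<and> u \<le> real L - real_of_int k / 2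
      \<and> u \<le> real L + real z + real_of_int k / 2})
    \<longleftrightarrow> c \<in> layers (L + z) (2 * n - 1) 0 - region_over (triangle_over L z)"
    unfolding corners_right corners_left_complement Diff_iff layers_iff[OF c] region_over_iff[OF c] triangle_over_def by auto
qed (auto simp: above_layers)

lemma face_of_up_triangle:
  assumes "above c"
  shows "face_of 1 c \<in> up_triangle (real p) (real s) \<longleftrightarrow> c \<in> region_over (triangle_over p s)"
proof -
  have "(\<forall>(X, K)\<in>corners c. 0 \<le> K)" using corners_above[OF assms] by auto
  then have "face_of 1 c \<in> up_triangle (real p) (real s) \<longleftrightarrow>
    (\<forall>(X, K)\<in>corners c. 2 * int p + K \<le> X) \<and> (\<forall>(X, K)\<in>corners c. X + K \<le> 2 * int (p + s))"
    unfolding up_triangle_def face_of_faces_within[OF disjI1[OF refl]] ball_pt mult_1 side_iffs ball_conj by simp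
  then show ?thesis unfolding corners_left corners_right region_over_iff[OF assms] by (simp add: triangle_over_def)
qed

lemma face_of_down_triangle:
  assumes "above c"
  shows "face_of (- 1) c \<in> down_triangle (real p) (real s) \<longleftrightarrow> c \<in> region_over (triangle_over p s)"
proof -
  have "(\<forall>(X, K)\<in>corners c. - K \<le> 0)" using corners_above[OF assms] by auto
  then have "face_of (- 1) c \<in> down_triangle (real p) (real s) \<longleftrightarrow>
    (\<forall>(X, K)\<in>corners c. 2 * int p + K \<le> X) \<and> (\<forall>(X, K)\<in>corners c. X + K \<le> 2 * int (p + s))"
    unfolding down_triangle_def face_of_faces_within[OF disjI2[OF refl]] ball_pt mult_minus1 side_iffs ball_conj by simp
  then show ?thesis unfolding corners_left corners_right region_over_iff[OF assms] by (simp add: triangle_over_def)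
qed

lemma face_of_half_triangle:
  assumes "above c"
  shows "face_of 1 c \<in> half_triangle a \<longleftrightarrow> c \<in> region_over (half_triangle_over (entry a 1))"
proof -
  have "face_of 1 c \<in> half_triangle a \<longleftrightarrow> (\<forall>(X, K)\<in>corners c. X + K \<le> 2 * int (entry a 1))"
    unfolding half_triangle_def face_of_faces_within[OF disjI1[OF refl]] ball_pt mult_1 side_iffs ..
  then show ?thesis unfolding corners_right region_over_iff[OF assms] by (simp add: half_triangle_over_def)
qed

text \<open>Every cell has a corner strictly off the line, so a fern triangle affects only the half
  in which it lies.\<close>

lemma face_of_other_side:
  assumes "above c"
  shows "face_of 1 c \<notin> down_triangle p s" "face_of (- 1) c \<notin> up_triangle p s"
proof -
  have "\<exists>(X, K)\<in>corners c. K > 0" using assms by (cases c) auto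
  then obtain X K where "(X, K) \<in> corners c" "K > 0" by blast
  then show "face_of 1 c \<notin> down_triangle p s" "face_of (- 1) c \<notin> up_triangle p s"
    unfolding down_triangle_def up_triangle_def
    by (auto simp: face_of_faces_within pt_def intro!: bexI[of _ "(X, K)"])
qed

text \<open>Two triangles on opposite sides can share vertices only on the line, and just the
  \<open>Up 0 j\<close> have two of them there.\<close>

lemma face_adj_across:
  assumes "above c" "above d"
  shows "face_adj (face_of 1 c) (face_of (- 1) d) \<longleftrightarrow> (\<exists>j. c = Up 0 j \<and> d = Up 0 j)"
proof -
  define r :: "int \<times> int \<Rightarrow> int \<times> int" where "r = (\<lambda>(X, K). (X, - K))"
  have "face_of (- 1) d = pt 1 ` r ` corners d"
    unfolding face_of_def image_image by (intro image_cong) (auto simp: pt_def r_def)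
  then have "face_of 1 c \<inter> face_of (- 1) d = pt 1 ` (corners c \<inter> r ` corners d)"
    unfolding face_of_def by (simp add: image_Int[OF inj_pt])
  then have card: "card (face_of 1 c \<inter> face_of (- 1) d) = card (corners c \<inter> r ` corners d)"
    by (simp add: card_image[OF inj_pt])
  have "card (corners c \<inter> r ` corners d) = 2 \<longleftrightarrow> (\<exists>j. c = Up 0 j \<and> d = Up 0 j)"
  proof (cases c)
    case (Up k j)
    show ?thesis
    proof (cases d)
      case (Up l i)
      have "card (corners c \<inter> r ` corners d) = 2 \<longleftrightarrow> k = 0 \<and> l = 0 \<and> corner k j = corner l i"
        unfolding \<open>c = Up k j\<close> Up corners.simps(1)[of k j]
        by (subst card_Int_triple) (auto simp: of_bool_def r_def)
      then show ?thesis using corner_eq_iff[of k j i] Up \<open>c = Up k j\<close> by auto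
    next
      case (Dn l i)
      have "card (corners c \<inter> r ` corners d) \<noteq> 2"
        unfolding \<open>c = Up k j\<close> Dn corners.simps(1)[of k j]
        by (subst card_Int_triple) (use assms(2) Dn in \<open>auto simp: of_bool_def r_def\<close>)
      then show ?thesis using Dn by auto
    qed
  next
    case (Dn k j)
    have "card (corners c \<inter> r ` corners d) \<noteq> 2"
      unfolding Dn corners.simps(2)[of k j]
      by (subst card_Int_triple, simp, simp, simp, cases d) (use assms Dn in \<open>auto simp: of_bool_def r_def\<close>)
    then show ?thesis using Dn by auto
  qed
  then show ?thesis using card face_of_faces[of 1 c] face_of_faces[of "- 1" d] by (simp add: face_adj_def)
qed

lemma face_of_opposite:
  assumes "above c" "above d"
  shows "face_of 1 c \<noteq> face_of (- 1) d"
proof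
  assume eq: "face_of 1 c = face_of (- 1) d"
  have "\<exists>(X, K)\<in>corners c. K > 0" using assms(1) by (cases c) auto
  then obtain X K where XK: "(X, K) \<in> corners c" "K > 0" by blast
  have "K' \<ge> 0" if "(X', K') \<in> corners d" for X' K' using that assms(2) by (cases d) auto
  moreover have "pt 1 (X, K) \<in> face_of (- 1) d" using XK eq by (auto simp: face_of_def)
  ultimately show False using XK(2) by (force simp: face_of_def pt_def)
qed

lemma face_of_image_Diff:
  assumes "\<And>c. c \<in> C \<Longrightarrow> face_of \<epsilon> c \<in> T \<longleftrightarrow> c \<in> D"
  shows "face_of \<epsilon> ` C - T = face_of \<epsilon> ` (C - D)"
  using assms by auto

lemma region_over_Un: "region_over (Q \<union> Q') = region_over Q \<union> region_over Q'"
  by (auto simp: region_over_def)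

lemma region_over_UN: "region_over (\<Union>i\<in>I. Q i) = (\<Union>i\<in>I. region_over (Q i))"
  by (auto simp: region_over_def)

section \<open>Quartered hexagons\<close>

definition hexagon_shadow :: "nat list \<Rightarrow> (nat \<times> nat) set" where
  "hexagon_shadow t = (\<Union>i\<in>{1..length t div 2}. triangle_over (psum t (2 * i - 1)) (entry t (2 * i)))"

lemma psum_step: "i \<in> {1..length t} \<Longrightarrow> psum t i = psum t (i - 1) + entry t i"
  using psum_Suc[of "i - 1" t] by auto

lemma hexagon_shadow_base: "{j. (0, j) \<in> hexagon_shadow t} = segs False 0 t"
proof (rule Set.set_eqI)
  fix j
  have "j \<in> segs False 0 t \<longleftrightarrow> (\<exists>i\<in>{1..length t}. even i \<and> psum t (i - 1) \<le> j \<and> j < psum t i)"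
    by (simp add: mem_segs_iff)
  also have "\<dots> \<longleftrightarrow> (\<exists>i\<in>{1..length t div 2}. psum t (2 * i - 1) \<le> j \<and> j < psum t (2 * i))"
  proof
    assume "\<exists>i\<in>{1..length t}. even i \<and> psum t (i - 1) \<le> j \<and> j < psum t i"
    then obtain k where "2 * k \<in> {1..length t}" "psum t (2 * k - 1) \<le> j" "j < psum t (2 * k)"
      by (auto elim!: evenE)
    then show "\<exists>i\<in>{1..length t div 2}. psum t (2 * i - 1) \<le> j \<and> j < psum t (2 * i)"
      by (intro bexI[of _ k]) auto
  next
    assume "\<exists>i\<in>{1..length t div 2}. psum t (2 * i - 1) \<le> j \<and> j < psum t (2 * i)"
    then obtain i where "i \<in> {1..length t div 2}" "psum t (2 * i - 1) \<le> j" "j < psum t (2 * i)" by blast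
    then show "\<exists>i\<in>{1..length t}. even i \<and> psum t (i - 1) \<le> j \<and> j < psum t i"
      by (intro bexI[of _ "2 * i"]) auto
  qed
  also have "\<dots> \<longleftrightarrow> (\<exists>i\<in>{1..length t div 2}. (0, j) \<in> triangle_over (psum t (2 * i - 1)) (entry t (2 * i)))"
  proof (rule bex_cong[OF refl])
    fix i assume "i \<in> {1..length t div 2}"
    then have "psum t (2 * i) = psum t (2 * i - 1) + entry t (2 * i)" by (intro psum_step) auto
    then show "psum t (2 * i - 1) \<le> j \<and> j < psum t (2 * i) \<longleftrightarrow> (0, j) \<in> triangle_over (psum t (2 * i - 1)) (entry t (2 * i))"
      by (simp add: triangle_over_def)
  qed
  finally show "j \<in> {j. (0, j) \<in> hexagon_shadow t} \<longleftrightarrow> j \<in> segs False 0 t"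
    by (simp add: hexagon_shadow_def)
qed

lemma quartered_hexagon_faces:
  "quartered_hexagon t
    = face_of 1 ` (layers (odd_sum t + even_sum t) (2 * even_sum t - 1) 0 - region_over (hexagon_shadow t))"
  unfolding quartered_hexagon_def trapezoid_faces hexagon_shadow_def region_over_UN
  by (rule face_of_image_Diff) (auto dest!: above_layers simp: face_of_up_triangle)

text \<open>The removed triangles turn into dents on the segments of even index. Their number
  \<open>even_sum t\<close> is the one that fits the height
  \<open>2 * even_sum t - 1\<close>.\<close>

lemma K_count_eq: "real (K_count t) = vand (segs False 0 t) / dent_norm (card (segs False 0 t))"
proof (cases "even_sum t = 0")
  case True
  then have "segs False 0 t = {}" using card_segs[of False 0 t] by simp
  then show ?thesis using True by (simp add: K_count_def vand_def dent_norm_def)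
next
  case False
  let ?L = "odd_sum t + even_sum t" and ?n = "even_sum t"
  have card: "card (segs False 0 t) = ?n" by (simp add: card_segs)
  have "shadow (layers ?L (2 * ?n - 1) 0 - Up 0 ` {}) (hexagon_shadow t)"
    unfolding hexagon_shadow_def
  proof (rule shadow_UN, rule shadow_triangle_over)
    fix i assume "i \<in> {1..length t div 2}"
    then have "psum t (2 * i) = psum t (2 * i - 1) + entry t (2 * i)" by (intro psum_step) auto
    then show "psum t (2 * i - 1) + entry t (2 * i) \<le> ?L" using psum_le[of t "2 * i"] odd_even_sum[of t] by simp
    show "entry t (2 * i) \<le> ?n" by (rule entry_le_even_sum) simp
  qed
  from matchings_layers_shadow[OF this]
  have "num_tilings (quartered_hexagon t) = dented ?L (2 * ?n - 1) 0 (segs False 0 t)"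
    unfolding num_tilings_eq_matchings quartered_hexagon_faces matchings_face_of[OF disjI1[OF refl]] hexagon_shadow_base
    by simp
  moreover have "segs False 0 t \<subseteq> {..<?L}" using segs_subset[of False 0 t] odd_even_sum[of t] by auto
  ultimately show ?thesis
    using matchings_dented_trapezoid[of "segs False 0 t" ?L] False by (simp add: K_count_def card)
qed

section \<open>The halved hexagon\<close>

text \<open>In both ferns the odd terms lie above the cut, so \<open>r = True\<close> belongs to the
  upper half. The first term of \<open>a\<close> is included there: the half triangle rests on that
  segment.\<close>

definition fern_segs :: "bool \<Rightarrow> nat \<Rightarrow> nat list \<Rightarrow> nat list \<Rightarrow> nat set" where
  "fern_segs r L a b = segs r 0 a \<union> (\<lambda>t. L - 1 - t) ` segs r 0 b"

definition left_shadow :: "bool \<Rightarrow> nat list \<Rightarrow> (nat \<times> nat) set" where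
  "left_shadow r a = (\<Union>i\<in>{i \<in> {2..length a}. odd i = r}. triangle_over (psum a (i - 1)) (entry a i))"

definition right_shadow :: "bool \<Rightarrow> nat \<Rightarrow> nat list \<Rightarrow> (nat \<times> nat) set" where
  "right_shadow r L b = (\<Union>j\<in>{j \<in> {1..length b}. odd j = r}. triangle_over (L - psum b j) (entry b j))"

lemma left_shadow_base:
  "j \<in> segs r 0 a \<longleftrightarrow> (0, j) \<in> left_shadow r a \<or> r \<and> j < entry a 1"
proof -
  have "j \<in> segs r 0 a \<longleftrightarrow> (\<exists>i\<in>{1..length a}. odd i = r \<and> psum a (i - 1) \<le> j \<and> j < psum a (i - 1) + entry a i)"
    unfolding mem_segs_iff by (intro bex_cong refl) (auto simp: psum_step)
  also have "\<dots> \<longleftrightarrow> (\<exists>i\<in>{2..length a}. odd i = r \<and> psum a (i - 1) \<le> j \<and> j < psum a (i - 1) + entry a i) \<or> r \<and> j < entry a 1"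
  proof (cases "length a = 0")
    case True
    then show ?thesis by (simp add: entry_def)
  next
    case False
    then have "1 \<le> length a" by (cases a) auto
    then have "{1..length a} = insert 1 {2..length a}" by auto
    then show ?thesis by (auto simp: psum_def)
  qed
  also have "(\<exists>i\<in>{2..length a}. odd i = r \<and> psum a (i - 1) \<le> j \<and> j < psum a (i - 1) + entry a i) \<longleftrightarrow> (0, j) \<in> left_shadow r a"
    by (simp add: left_shadow_def triangle_over_def Bex_def conj_assoc)
  finally show ?thesis .
qed

lemma right_shadow_base:
  assumes "sum_list b \<le> L"
  shows "t \<in> (\<lambda>t. L - 1 - t) ` segs r 0 b \<longleftrightarrow> (0, t) \<in> right_shadow r L b"
proof
  assume "t \<in> (\<lambda>t. L - 1 - t) ` segs r 0 b"
  then obtain u where "t = L - 1 - u" "u \<in> segs r 0 b" by blast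
  then obtain i where u: "t = L - 1 - u" "i \<in> {1..length b}" "odd i = r" "psum b (i - 1) \<le> u" "u < psum b i"
    using mem_segs_iff[of u r 0 b] by (simp only: add_0) blast
  then show "(0, t) \<in> right_shadow r L b"
    using psum_step[OF u(2)] psum_le[of b i] assms
    by (auto simp: right_shadow_def triangle_over_def intro!: bexI[of _ i])
next
  assume "(0, t) \<in> right_shadow r L b"
  then obtain i where i: "i \<in> {1..length b}" "odd i = r" "L - psum b i \<le> t" "t < L - psum b i + entry b i"
    by (auto simp: right_shadow_def triangle_over_def)
  then have "L - 1 - t \<in> segs r 0 b" "t = L - 1 - (L - 1 - t)"
    using psum_step[OF i(1)] psum_le[of b i] assms by (auto simp: mem_segs_iff intro!: bexI[of _ i])
  then show "t \<in> (\<lambda>t. L - 1 - t) ` segs r 0 b" by (rule image_eqI[rotated])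
qed

lemma fern_entry_le:
  "entry a i \<le> (if odd i then odd_sum a else even_sum a)"
  using entry_le_odd_sum[of i a] entry_le_even_sum[of i a] by simp

lemma shadow_left_shadow:
  assumes "sum_list a \<le> L" "(if r then odd_sum a else even_sum a) \<le> n"
  shows "shadow (layers L (2 * n - 1) 0 - Up 0 ` S) (left_shadow r a)"
  unfolding left_shadow_def
proof (rule shadow_UN, rule shadow_triangle_over)
  fix i assume i: "i \<in> {i \<in> {2..length a}. odd i = r}"
  then show "psum a (i - 1) + entry a i \<le> L" using psum_step[of i a] psum_le[of a i] assms by auto
  show "entry a i \<le> n" using fern_entry_le[of a i] assms i by (auto split: if_splits)
qed

lemma shadow_right_shadow:
  assumes "sum_list b \<le> L" "(if r then odd_sum b else even_sum b) \<le> n"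
  shows "shadow (layers L (2 * n - 1) 0 - Up 0 ` S) (right_shadow r L b)"
  unfolding right_shadow_def
proof (rule shadow_UN, rule shadow_triangle_over)
  fix i assume i: "i \<in> {i \<in> {1..length b}. odd i = r}"
  then show "L - psum b i + entry b i \<le> L" using psum_step[of i b] psum_le[of b i] assms by auto
  show "entry b i \<le> n" using fern_entry_le[of b i] assms i by (auto split: if_splits)
qed

text \<open>Below the cut the trapezoid has base \<open>L + z\<close>, while the ferns are placed
  relative to \<open>L\<close>.\<close>

lemma shadow_mono_base:
  assumes "shadow (layers L h 0 - Up 0 ` S) Q" "L \<le> L'"
  shows "shadow (layers L' h 0 - Up 0 ` S) Q"
proof -
  have "layers L h 0 \<subseteq> layers L' h 0" using assms(2) by (auto simp: layers_def)
  then show ?thesis using assms(1) unfolding shadow_def by blast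
qed

lemma face_of_ferns:
  assumes "above c" "sum_list b \<le> L"
  shows "face_of 1 c \<in> left_fern a \<longleftrightarrow> c \<in> region_over (left_shadow True a)"
    "face_of (- 1) c \<in> left_fern a \<longleftrightarrow> c \<in> region_over (left_shadow False a)"
    "face_of 1 c \<in> right_fern L b \<longleftrightarrow> c \<in> region_over (right_shadow True L b)"
    "face_of (- 1) c \<in> right_fern L b \<longleftrightarrow> c \<in> region_over (right_shadow False L b)"
proof -
  note iff = face_of_up_triangle[OF assms(1)] face_of_down_triangle[OF assms(1)] face_of_other_side[OF assms(1)]
  have e: "real L - real (psum b j) = real (L - psum b j)" for j
    using psum_le[of b j] assms(2) by (simp add: of_nat_diff)
  have up: "face_of 1 c \<in> (if odd j then up_triangle else down_triangle) (real p) (real s)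
      \<longleftrightarrow> odd j \<and> c \<in> region_over (triangle_over p s)"
    and down: "face_of (- 1) c \<in> (if odd j then up_triangle else down_triangle) (real p) (real s)
      \<longleftrightarrow> even j \<and> c \<in> region_over (triangle_over p s)" for j p s
    by (cases "odd j"; simp add: iff)+
  have swap: "(if even j then down_triangle else up_triangle) = (if odd j then up_triangle else down_triangle)" for j :: nat
    by simp
  show "face_of 1 c \<in> left_fern a \<longleftrightarrow> c \<in> region_over (left_shadow True a)"
    "face_of (- 1) c \<in> left_fern a \<longleftrightarrow> c \<in> region_over (left_shadow False a)"
    unfolding left_fern_def left_shadow_def region_over_UN UN_iff swap up down by (simp_all add: Bex_def conj_assoc)
  show "face_of 1 c \<in> right_fern L b \<longleftrightarrow> c \<in> region_over (right_shadow True L b)"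
    "face_of (- 1) c \<in> right_fern L b \<longleftrightarrow> c \<in> region_over (right_shadow False L b)"
    unfolding right_fern_def right_shadow_def region_over_UN UN_iff e up down by (simp_all only: Bex_def mem_Collect_eq simp_thms conj_assoc)
qed

definition upper_shadow :: "nat \<Rightarrow> nat list \<Rightarrow> nat list \<Rightarrow> (nat \<times> nat) set" where
  "upper_shadow L a b = half_triangle_over (entry a 1) \<union> (left_shadow True a \<union> right_shadow True L b)"

definition lower_shadow :: "nat \<Rightarrow> nat \<Rightarrow> nat list \<Rightarrow> nat list \<Rightarrow> (nat \<times> nat) set" where
  "lower_shadow L z a b = triangle_over L z \<union> (left_shadow False a \<union> right_shadow False L b)"

lemma upper_shadow_base:
  assumes "sum_list b \<le> L"
  shows "{j. (0, j) \<in> upper_shadow L a b} = fern_segs True L a b"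
  using left_shadow_base[of _ True a] right_shadow_base[OF assms, of _ True]
  by (auto simp: upper_shadow_def fern_segs_def half_triangle_over_def)

lemma lower_shadow_base:
  assumes "sum_list b \<le> L"
  shows "{j. (0, j) \<in> lower_shadow L z a b} = fern_segs False L a b \<union> {L..<L + z}"
  using left_shadow_base[of _ False a] right_shadow_base[OF assms, of _ False]
  by (auto simp: lower_shadow_def fern_segs_def triangle_over_def)

lemma shadow_upper_shadow:
  assumes "sum_list a + sum_list b \<le> L" "odd_sum a + odd_sum b \<le> n"
  shows "shadow (layers L (2 * n - 1) 0 - Up 0 ` S) (upper_shadow L a b)"
proof -
  have "entry a 1 \<le> odd_sum a" by (rule entry_le_odd_sum) simp
  moreover have "odd_sum a \<le> L" using odd_even_sum[of a] assms by simp
  ultimately show ?thesis unfolding upper_shadow_def using assms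
    by (intro shadow_Un shadow_half_triangle_over shadow_left_shadow shadow_right_shadow) auto
qed

lemma shadow_lower_shadow:
  assumes "sum_list a + sum_list b \<le> L" "z + even_sum a + even_sum b \<le> n"
  shows "shadow (layers (L + z) (2 * n - 1) 0 - Up 0 ` S) (lower_shadow L z a b)"
  unfolding lower_shadow_def using assms
  by (intro shadow_Un shadow_triangle_over shadow_mono_base[OF shadow_left_shadow, of _ L]
      shadow_mono_base[OF shadow_right_shadow, of _ L]) auto

section \<open>Cutting the halved hexagon into two dented trapezoids\<close>

lemma H2_region_faces:
  fixes x y z a b
  defines "L \<equiv> base_length x y a b"
  defines "n \<equiv> y + odd_sum a + odd_sum b" and "n' \<equiv> y + z + even_sum a + even_sum b"
  shows "H2_region x y z a b = face_of 1 ` (layers L (2 * n - 1) 0 - region_over (upper_shadow L a b))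
    \<union> face_of (- 1) ` (layers (L + z) (2 * n' - 1) 0 - region_over (lower_shadow L z a b))"
proof -
  have right_fern_fits: "sum_list b \<le> L" by (simp add: L_def base_length_def)
  have up: "upper_part x y a b = face_of 1 ` layers L (2 * n - 1) 0"
    unfolding upper_part_def upper_height_def L_def[symmetric] n_def[symmetric] by (rule trapezoid_faces)
  have lo: "lower_part x y z a b = face_of (- 1) ` (layers (L + z) (2 * n' - 1) 0 - region_over (triangle_over L z))"
    unfolding lower_part_def lower_height_def L_def[symmetric] n'_def[symmetric] by (rule lower_trapezoid_faces)
  have "(upper_part x y a b - half_triangle a) - left_fern a - right_fern L b
    = face_of 1 ` layers L (2 * n - 1) 0 - (half_triangle a \<union> (left_fern a \<union> right_fern L b))"
    unfolding up by blast
  also have "\<dots> = face_of 1 ` (layers L (2 * n - 1) 0 - region_over (upper_shadow L a b))"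
    unfolding upper_shadow_def region_over_Un
    by (rule face_of_image_Diff) (auto dest!: above_layers simp: face_of_half_triangle face_of_ferns[OF _ right_fern_fits])
  finally have 1: "(upper_part x y a b - half_triangle a) - left_fern a - right_fern L b = \<dots>" .
  have "lower_part x y z a b - left_fern a - right_fern L b
    = face_of (- 1) ` (layers (L + z) (2 * n' - 1) 0 - region_over (triangle_over L z)) - (left_fern a \<union> right_fern L b)"
    unfolding lo by blast
  also have "\<dots> = face_of (- 1) ` (layers (L + z) (2 * n' - 1) 0 - region_over (triangle_over L z)
      - region_over (left_shadow False a \<union> right_shadow False L b))"
    unfolding region_over_Un
    by (rule face_of_image_Diff) (auto dest!: above_layers simp: face_of_ferns[OF _ right_fern_fits])
  also have "layers (L + z) (2 * n' - 1) 0 - region_over (triangle_over L z)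
      - region_over (left_shadow False a \<union> right_shadow False L b)
    = layers (L + z) (2 * n' - 1) 0 - region_over (lower_shadow L z a b)"
    unfolding lower_shadow_def region_over_Un by blast
  finally have 2: "lower_part x y z a b - left_fern a - right_fern L b = face_of (- 1) ` \<dots>" .
  have "H2_region x y z a b = ((upper_part x y a b - half_triangle a) - left_fern a - right_fern L b)
    \<union> (lower_part x y z a b - left_fern a - right_fern L b)"
    unfolding H2_region_def L_def[symmetric] by blast
  then show ?thesis unfolding 1 2 .
qed

lemma matchings_two_sided:
  assumes C: "\<And>c. c \<in> C \<Longrightarrow> above c" "\<And>c. c \<in> C' \<Longrightarrow> above c" and fin: "finite C" "finite C'"
  shows "matchings face_adj (face_of 1 ` C \<union> face_of (- 1) ` C')
    = (\<Sum>S\<in>Pow {j. Up 0 j \<in> C \<and> Up 0 j \<in> C'}. matchings cell_adj (C - Up 0 ` S) * matchings cell_adj (C' - Up 0 ` S))"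
proof -
  let ?J = "{j. Up 0 j \<in> C \<and> Up 0 j \<in> C'}"
  let ?f = "\<lambda>j. face_of 1 (Up 0 j)" and ?g = "\<lambda>j. face_of (- 1) (Up 0 j)"
  have inj: "inj (face_of 1)" "inj (face_of (- 1))" by (simp_all add: inj_face_of)
  have "matchings face_adj (face_of 1 ` C \<union> face_of (- 1) ` C')
    = (\<Sum>S\<in>Pow ?J. matchings face_adj (face_of 1 ` C - ?f ` S) * matchings face_adj (face_of (- 1) ` C' - ?g ` S))"
  proof (rule matchings_split[OF symp_face_adj])
    show "face_of 1 ` C \<inter> face_of (- 1) ` C' = {}"
      using face_of_opposite C by blast
    show "inj_on ?f ?J" "inj_on ?g ?J" using inj by (auto simp: inj_on_def)
    fix f g assume "f \<in> face_of 1 ` C" "g \<in> face_of (- 1) ` C'"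
    then obtain c d where cd: "c \<in> C" "d \<in> C'" "f = face_of 1 c" "g = face_of (- 1) d" by blast
    have "face_adj f g \<longleftrightarrow> (\<exists>j. c = Up 0 j \<and> d = Up 0 j)"
      unfolding cd by (rule face_adj_across[OF C(1)[OF cd(1)] C(2)[OF cd(2)]])
    also have "\<dots> \<longleftrightarrow> (\<exists>j\<in>?J. c = Up 0 j \<and> d = Up 0 j)" using cd(1,2) by auto
    also have "\<dots> \<longleftrightarrow> (\<exists>j\<in>?J. f = ?f j \<and> g = ?g j)" unfolding cd using inj by (simp add: inj_eq)
    finally show "face_adj f g \<longleftrightarrow> (\<exists>j\<in>?J. f = ?f j \<and> g = ?g j)" .
  qed (use fin in auto)
  moreover have "face_of 1 ` C - ?f ` S = face_of 1 ` (C - Up 0 ` S)"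
    "face_of (- 1) ` C' - ?g ` S = face_of (- 1) ` (C' - Up 0 ` S)" for S
    using inj by (auto simp: inj_eq)
  ultimately show ?thesis by (simp only: matchings_face_of simp_thms)
qed

lemma inj_on_mirror:
  assumes "sum_list b \<le> L"
  shows "inj_on (\<lambda>t. L - 1 - t) (segs r 0 b)"
proof (rule inj_onI)
  fix s t assume "s \<in> segs r 0 b" "t \<in> segs r 0 b" "L - 1 - s = L - 1 - t"
  moreover from this have "s < sum_list b" "t < sum_list b" using segs_subset[of r 0 b] by auto
  ultimately show "s = t" using assms by linarith
qed

context
  fixes x y z :: nat and a b :: "nat list" and L U D g
  defines L: "L \<equiv> base_length x y a b"
    and U: "U \<equiv> fern_segs True L a b" and D: "D \<equiv> fern_segs False L a b \<union> {L..<L + z}"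
    and g: "g \<equiv> {sum_list a..<sum_list a + x + y}"
begin

lemma right_fern_fits: "sum_list b \<le> L" "L - sum_list b = sum_list a + x + y" "sum_list a + sum_list b \<le> L"
  by (auto simp: L base_length_def)

lemma mirror_interval: "(\<lambda>t. L - 1 - t) ` {0..<sum_list b} = {L - sum_list b..<L}"
proof (intro equalityI subsetI)
  fix t assume "t \<in> {L - sum_list b..<L}"
  then show "t \<in> (\<lambda>t. L - 1 - t) ` {0..<sum_list b}"
    by (intro image_eqI[of _ _ "L - 1 - t"]) auto
qed (use right_fern_fits in auto)

lemma segs_partition: "segs True 0 v \<union> segs False 0 v = {0..<sum_list v}" "segs True 0 v \<inter> segs False 0 v = {}"
  using segs_Un[of True 0 v] segs_Int[of True 0 v] by simp_all

lemma mirror_segs: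
  "(\<lambda>t. L - 1 - t) ` segs True 0 b \<union> (\<lambda>t. L - 1 - t) ` segs False 0 b = {L - sum_list b..<L}"
  "(\<lambda>t. L - 1 - t) ` segs True 0 b \<inter> (\<lambda>t. L - 1 - t) ` segs False 0 b = {}"
proof -
  show "(\<lambda>t. L - 1 - t) ` segs True 0 b \<union> (\<lambda>t. L - 1 - t) ` segs False 0 b = {L - sum_list b..<L}"
    unfolding image_Un[symmetric] segs_partition by (rule mirror_interval)
  have "inj_on (\<lambda>t. L - 1 - t) {0..<sum_list b}" using right_fern_fits(1) by (intro inj_onI) auto
  then have "(\<lambda>t. L - 1 - t) ` segs True 0 b \<inter> (\<lambda>t. L - 1 - t) ` segs False 0 b
    = (\<lambda>t. L - 1 - t) ` (segs True 0 b \<inter> segs False 0 b)"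
    by (intro inj_on_image_Int[symmetric]) (use segs_subset[of True 0 b] segs_subset[of False 0 b] in simp_all)
  then show "(\<lambda>t. L - 1 - t) ` segs True 0 b \<inter> (\<lambda>t. L - 1 - t) ` segs False 0 b = {}"
    by (simp add: segs_partition)
qed

lemma fern_segs_Un_Int: "U \<union> D = {..<sum_list a} \<union> {sum_list a + x + y..<sum_list a + x + y + (sum_list b + z)}" "U \<inter> D = {}"
proof -
  have "U \<union> D = (segs True 0 a \<union> segs False 0 a)
    \<union> ((\<lambda>t. L - 1 - t) ` segs True 0 b \<union> (\<lambda>t. L - 1 - t) ` segs False 0 b) \<union> {L..<L + z}"
    unfolding U D fern_segs_def by blast
  also have "\<dots> = {..<sum_list a} \<union> {sum_list a + x + y..<sum_list a + x + y + (sum_list b + z)}"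
    unfolding segs_partition mirror_segs by (auto simp: L base_length_def)
  finally show "U \<union> D = \<dots>" .
  have s: "segs r 0 a \<subseteq> {..<sum_list a}" "(\<lambda>t. L - 1 - t) ` segs r 0 b \<subseteq> {sum_list a + x + y..<L}" for r
    using segs_subset[of r 0 a] mirror_segs(1) unfolding right_fern_fits(2)[symmetric] by (cases r; auto)+
  have "segs r 0 a \<inter> (\<lambda>t. L - 1 - t) ` segs r' 0 b = {}" "segs r 0 a \<inter> {L..<L + z} = {}"
    "(\<lambda>t. L - 1 - t) ` segs r 0 b \<inter> {L..<L + z} = {}" for r r'
    using s[of r] s(2)[of r'] right_fern_fits(3) by fastforce+
  then show "U \<inter> D = {}"
    unfolding U D fern_segs_def using segs_partition(2)[of a] mirror_segs(2) by blast
qed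

lemma card_fern_segs: "card U = odd_sum a + odd_sum b" "card D = even_sum a + even_sum b + z" "finite U" "finite D"
proof -
  have fin: "finite (fern_segs r L a b)" for r by (simp add: fern_segs_def)
  show "finite U" "finite D" using fin by (simp_all add: U D)
  have c: "card (fern_segs r L a b) = card (segs r 0 a) + card (segs r 0 b)" for r
  proof -
    note inj_on_mirror[OF right_fern_fits(1), of r]
    moreover have "segs r 0 a \<inter> (\<lambda>t. L - 1 - t) ` segs r 0 b = {}"
    proof -
      have "(\<lambda>t. L - 1 - t) ` segs r 0 b \<subseteq> {sum_list a + x + y..<L}"
        using mirror_segs(1) unfolding right_fern_fits(2)[symmetric] by (cases r) auto
      then show ?thesis using segs_subset[of r 0 a] by fastforce
    qed
    ultimately show ?thesis unfolding fern_segs_def by (subst card_Un_disjoint) (simp_all add: card_image)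
  qed
  show "card U = odd_sum a + odd_sum b" by (simp add: U c card_segs)
  have "fern_segs False L a b \<inter> {L..<L + z} = {}"
  proof -
    have "(\<lambda>t. L - 1 - t) ` segs False 0 b \<subseteq> {..<L}" using mirror_segs(1) by auto
    then show ?thesis using segs_subset[of False 0 a] right_fern_fits(3) unfolding fern_segs_def by fastforce
  qed
  then show "card D = even_sum a + even_sum b + z"
    using fin by (simp add: D card_Un_disjoint c card_segs)
qed

lemma upper_fern_subset: "U \<subseteq> {..<L}"
proof -
  have "(\<lambda>t. L - 1 - t) ` segs True 0 b \<subseteq> {..<L}" using mirror_segs(1) by auto
  then show ?thesis using segs_subset[of True 0 a] right_fern_fits(3) unfolding U fern_segs_def by fastforce
qed

lemma lower_fern_subset: "D \<subseteq> {..<L + z}"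
proof -
  have "D \<subseteq> {..<sum_list a} \<union> {sum_list a + x + y..<sum_list a + x + y + (sum_list b + z)}"
    unfolding fern_segs_Un_Int(1)[symmetric] by blast
  then show ?thesis using right_fern_fits(3) by (auto simp: L base_length_def)
qed

text \<open>The upper trapezoid requires \<open>y + odd_sum a + odd_sum b\<close> dents and its
  ferns supply all but \<open>y\<close>, so balance above the cut leaves only the sets
  \<open>S\<close> with \<open>y\<close> elements. For these the lower half has the right number of
  dents as well.\<close>

lemma num_tilings_sum:
  "real (num_tilings (H2_region x y z a b))
    = (\<Sum>S | S \<subseteq> g \<and> card S = y. vand (U \<union> S) * vand (D \<union> S))
      / (dent_norm (odd_sum a + odd_sum b + y) * dent_norm (even_sum a + even_sum b + z + y))"
proof -
  define n where "n = y + odd_sum a + odd_sum b"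
  define n' where "n' = y + z + even_sum a + even_sum b"
  let ?C = "layers L (2 * n - 1) 0 - region_over (upper_shadow L a b)"
  let ?C' = "layers (L + z) (2 * n' - 1) 0 - region_over (lower_shadow L z a b)"
  define J where "J = {j. Up 0 j \<in> ?C \<and> Up 0 j \<in> ?C'}"
  have nL: "n \<le> L" using odd_even_sum[of a] odd_even_sum[of b] by (simp add: n_def L base_length_def)
  have ub: "{j. (0, j) \<in> upper_shadow L a b} = U" unfolding U by (rule upper_shadow_base[OF right_fern_fits(1)])
  then have Ub: "(0, j) \<in> upper_shadow L a b \<longleftrightarrow> j \<in> U" for j by blast
  have db: "{j. (0, j) \<in> lower_shadow L z a b} = D" unfolding D by (rule lower_shadow_base[OF right_fern_fits(1)])
  then have Db: "(0, j) \<in> lower_shadow L z a b \<longleftrightarrow> j \<in> D" for j by blast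
  \<comment> \<open>If one half is empty, no lozenge can cross. In that case \<open>y = 0\<close>,
    and the only \<open>S\<close> with \<open>y\<close> elements is empty anyway, so the exception
    disappears once the cardinality is fixed.\<close>
  have Jg: "J = (if n > 0 \<and> n' > 0 then g else {})"
  proof -
    have "j \<in> J \<longleftrightarrow> n > 0 \<and> n' > 0 \<and> j < L \<and> j \<notin> U \<union> D" for j by (auto simp: J_def Ub Db)
    moreover have "j < L \<and> j \<notin> U \<union> D \<longleftrightarrow> j \<in> g" for j unfolding fern_segs_Un_Int(1) by (auto simp: g L base_length_def)
    ultimately show ?thesis by auto
  qed
  have "g \<inter> (U \<union> D) = {}" unfolding fern_segs_Un_Int(1) g by auto
  then have gU: "g \<inter> U = {}" "g \<inter> D = {}" by blast+
  have gL: "g \<subseteq> {..<L}" by (auto simp: g L base_length_def)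
  have fing: "finite g" by (simp add: g)
  have finJ: "finite J" unfolding Jg using fing by simp
  have "num_tilings (H2_region x y z a b) = (\<Sum>S\<in>Pow J. matchings cell_adj (?C - Up 0 ` S) * matchings cell_adj (?C' - Up 0 ` S))"
    unfolding num_tilings_eq_matchings H2_region_faces J_def n_def[symmetric] n'_def[symmetric] L[symmetric]
    by (rule matchings_two_sided) (auto dest: above_layers)
  also have "\<dots> = (\<Sum>S\<in>Pow J. dented L (2 * n - 1) 0 (U \<union> S)
      * dented (L + z) (2 * n' - 1) 0 (D \<union> S))"
  proof (rule sum.cong[OF refl], rule arg_cong2[where f = "(*)"])
    fix S
    show "matchings cell_adj (?C - Up 0 ` S) = dented L (2 * n - 1) 0 (U \<union> S)"
      unfolding ub[symmetric] by (rule matchings_layers_shadow[OF shadow_upper_shadow[OF right_fern_fits(3)]]) (simp add: n_def)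
    show "matchings cell_adj (?C' - Up 0 ` S) = dented (L + z) (2 * n' - 1) 0 (D \<union> S)"
      unfolding db[symmetric] by (rule matchings_layers_shadow[OF shadow_lower_shadow[OF right_fern_fits(3)]]) (simp add: n'_def)
  qed
  also have "\<dots> = (\<Sum>S | S \<subseteq> J \<and> card S = y. dented L (2 * n - 1) 0 (U \<union> S)
      * dented (L + z) (2 * n' - 1) 0 (D \<union> S))"
  proof (rule sum.mono_neutral_right)
    show "\<forall>S\<in>Pow J - {S. S \<subseteq> J \<and> card S = y}. dented L (2 * n - 1) 0 (U \<union> S)
      * dented (L + z) (2 * n' - 1) 0 (D \<union> S) = 0"
    proof
      fix S assume "S \<in> Pow J - {S. S \<subseteq> J \<and> card S = y}"
      then have S: "S \<subseteq> J" "card S \<noteq> y" by auto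
      have n: "n > 0"
      proof (rule ccontr)
        assume "\<not> n > 0"
        then have "J = {}" "y = 0" by (auto simp: Jg n_def)
        then show False using S by simp
      qed
      have Sg: "S \<subseteq> g" using S(1) by (auto simp: Jg split: if_splits)
      have "card (U \<union> S) = card U + card S"
        using Sg gU card_fern_segs finite_subset[OF Sg fing] by (intro card_Un_disjoint) auto
      then have "card (U \<union> S) \<noteq> n" using S(2) card_fern_segs(1) by (simp add: n_def)
      moreover have "Up 0 ` (U \<union> S) \<subseteq> layers L (2 * n - 1) 0" using upper_fern_subset Sg gL n by auto
      ultimately show "dented L (2 * n - 1) 0 (U \<union> S)
        * dented (L + z) (2 * n' - 1) 0 (D \<union> S) = 0"
        using matchings_layers_unbalanced[of "U \<union> S" L n] n nL by simp
    qed
  qed (use finJ in auto)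
  also have "{S. S \<subseteq> J \<and> card S = y} = {S. S \<subseteq> g \<and> card S = y}"
  proof (cases "y = 0")
    case True
    then show ?thesis using finJ fing finite_subset by fastforce
  next
    case False
    then show ?thesis by (simp add: Jg n_def n'_def)
  qed
  finally have M: "num_tilings (H2_region x y z a b)
    = (\<Sum>S | S \<subseteq> g \<and> card S = y. dented L (2 * n - 1) 0 (U \<union> S)
      * dented (L + z) (2 * n' - 1) 0 (D \<union> S))" .
  show ?thesis
    unfolding M of_nat_sum of_nat_mult sum_divide_distrib
  proof (rule sum.cong[OF refl])
    fix S assume "S \<in> {S. S \<subseteq> g \<and> card S = y}"
    then have S: "S \<subseteq> g" "card S = y" by auto
    have cU: "card (U \<union> S) = n"
      using S gU card_fern_segs finite_subset[OF S(1) fing] by (subst card_Un_disjoint) (auto simp: n_def)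
    have cD: "card (D \<union> S) = n'"
      using S gU card_fern_segs finite_subset[OF S(1) fing] by (subst card_Un_disjoint) (auto simp: n'_def)
    have "U \<union> S \<subseteq> {..<L}" "D \<union> S \<subseteq> {..<L + z}" using upper_fern_subset lower_fern_subset gL S(1) by fastforce+
    from matchings_dented_trapezoid[OF this(1)] matchings_dented_trapezoid[OF this(2)]
    show "real (dented L (2 * n - 1) 0 (U \<union> S))
      * real (dented (L + z) (2 * n' - 1) 0 (D \<union> S))
      = vand (U \<union> S) * vand (D \<union> S)
        / (dent_norm (odd_sum a + odd_sum b + y) * dent_norm (even_sum a + even_sum b + z + y))"
      unfolding cU cD by (simp add: n_def n'_def add_ac)
  qed
qed

end

section \<open>Summing over the positions of the crossing lozenges\<close>

lemma qlat_strict_mono: "s < t \<Longrightarrow> qlat s < qlat t"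
  using qlat_diff[of t s] by (smt (verit) mult_pos_pos of_nat_0_le_iff of_nat_less_iff)

lemma vand_pos: "finite S \<Longrightarrow> vand S > 0"
  unfolding vand_def by (intro prod_pos) (auto dest: qlat_strict_mono)

text \<open>A mixed pair enters through its larger element, which may lie in either set; absolute
  values make the cross product symmetric, so that the contributions of different sets can be
  merged.\<close>

lemma vand_Un:
  assumes fin: "finite A" "finite B" and disj: "A \<inter> B = {}"
  shows "vand (A \<union> B) = vand A * vand B * (\<Prod>s\<in>B. \<Prod>v\<in>A. \<bar>qlat s - qlat v\<bar>)"
proof -
  have split: "(\<Prod>s\<in>{s \<in> A \<union> B. s < t}. qlat t - qlat s)
      = (\<Prod>s\<in>{s \<in> A. s < t}. qlat t - qlat s) * (\<Prod>s\<in>{s \<in> B. s < t}. qlat t - qlat s)" for t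
  proof -
    have "{s \<in> A \<union> B. s < t} = {s \<in> A. s < t} \<union> {s \<in> B. s < t}" by auto
    then show ?thesis using fin disj by (simp add: prod.union_disjoint disjoint_iff)
  qed
  have "(\<Prod>t\<in>A. \<Prod>s\<in>{s \<in> B. s < t}. qlat t - qlat s) * (\<Prod>t\<in>B. \<Prod>s\<in>{s \<in> A. s < t}. qlat t - qlat s)
    = (\<Prod>s\<in>B. (\<Prod>v\<in>{v \<in> A. s < v}. qlat v - qlat s) * (\<Prod>v\<in>{v \<in> A. v < s}. qlat s - qlat v))"
    unfolding prod.distrib by (subst prod.swap_restrict[OF fin]) simp
  also have "\<dots> = (\<Prod>s\<in>B. \<Prod>v\<in>A. \<bar>qlat s - qlat v\<bar>)"
  proof (rule prod.cong[OF refl])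
    fix s assume s: "s \<in> B"
    have 1: "(\<Prod>v\<in>{v \<in> A. s < v}. qlat v - qlat s) = (\<Prod>v\<in>{v \<in> A. s < v}. \<bar>qlat s - qlat v\<bar>)"
      by (rule prod.cong) (auto dest: qlat_strict_mono)
    have 2: "(\<Prod>v\<in>{v \<in> A. v < s}. qlat s - qlat v) = (\<Prod>v\<in>{v \<in> A. v < s}. \<bar>qlat s - qlat v\<bar>)"
      by (rule prod.cong) (auto dest: qlat_strict_mono)
    have "v \<noteq> s" if "v \<in> A" for v using that s disj by blast
    then have "A = {v \<in> A. s < v} \<union> {v \<in> A. v < s}" by (auto simp: neq_iff)
    then have "(\<Prod>v\<in>A. \<bar>qlat s - qlat v\<bar>) = (\<Prod>v\<in>{v \<in> A. s < v} \<union> {v \<in> A. v < s}. \<bar>qlat s - qlat v\<bar>)" by simp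
    also have "\<dots> = (\<Prod>v\<in>{v \<in> A. s < v}. \<bar>qlat s - qlat v\<bar>) * (\<Prod>v\<in>{v \<in> A. v < s}. \<bar>qlat s - qlat v\<bar>)"
      by (rule prod.union_disjoint) (use fin in auto)
    finally show "(\<Prod>v\<in>{v \<in> A. s < v}. qlat v - qlat s) * (\<Prod>v\<in>{v \<in> A. v < s}. qlat s - qlat v)
      = (\<Prod>v\<in>A. \<bar>qlat s - qlat v\<bar>)" unfolding 1 2 by simp
  qed
  finally have cross: "(\<Prod>t\<in>A. \<Prod>s\<in>{s \<in> B. s < t}. qlat t - qlat s) * (\<Prod>t\<in>B. \<Prod>s\<in>{s \<in> A. s < t}. qlat t - qlat s) = \<dots>" .
  have "vand (A \<union> B) = (\<Prod>t\<in>A. \<Prod>s\<in>{s \<in> A \<union> B. s < t}. qlat t - qlat s) * (\<Prod>t\<in>B. \<Prod>s\<in>{s \<in> A \<union> B. s < t}. qlat t - qlat s)"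
    unfolding vand_def by (rule prod.union_disjoint[OF fin disj])
  also have "\<dots> = vand A * vand B * ((\<Prod>t\<in>A. \<Prod>s\<in>{s \<in> B. s < t}. qlat t - qlat s) * (\<Prod>t\<in>B. \<Prod>s\<in>{s \<in> A. s < t}. qlat t - qlat s))"
    unfolding split prod.distrib vand_def by (simp only: mult_ac)
  finally show ?thesis unfolding cross .
qed

lemma prod_abs_qlat_gap:
  assumes "a \<le> s" "s < B"
  shows "(\<Prod>v\<in>{..<a} \<union> {B..<B + c}. \<bar>qlat s - qlat v\<bar>)
    = (\<Prod>v<a. qlat s - qlat v) * (\<Prod>v<c. qlat (B + v) - qlat s)"
proof -
  have "(\<Prod>v\<in>{..<a} \<union> {B..<B + c}. \<bar>qlat s - qlat v\<bar>)
    = (\<Prod>v<a. \<bar>qlat s - qlat v\<bar>) * (\<Prod>v\<in>{B..<B + c}. \<bar>qlat s - qlat v\<bar>)"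
    by (rule prod.union_disjoint) (use assms in auto)
  also have "(\<Prod>v<a. \<bar>qlat s - qlat v\<bar>) = (\<Prod>v<a. qlat s - qlat v)"
  proof (rule prod.cong[OF refl])
    fix v assume "v \<in> {..<a}"
    then have "qlat v < qlat s" using assms by (intro qlat_strict_mono) simp
    then show "\<bar>qlat s - qlat v\<bar> = qlat s - qlat v" by simp
  qed
  also have "(\<Prod>v\<in>{B..<B + c}. \<bar>qlat s - qlat v\<bar>) = (\<Prod>v<c. \<bar>qlat s - qlat (B + v)\<bar>)"
    by (rule prod.reindex_bij_witness[of _ "\<lambda>v. B + v" "\<lambda>v. v - B"]) auto
  also have "\<dots> = (\<Prod>v<c. qlat (B + v) - qlat s)"
  proof (rule prod.cong[OF refl])
    fix v
    have "qlat s < qlat (B + v)" using assms by (intro qlat_strict_mono) simp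
    then show "\<bar>qlat s - qlat (B + v)\<bar> = qlat (B + v) - qlat s" by simp
  qed
  finally show ?thesis .
qed

lemma selberg_sum_gap:
  "selberg_sum y a B c = (\<Sum>S | S \<subseteq> {a..<B} \<and> card S = y. vand S * vand S *
      (\<Prod>t\<in>S. (\<Prod>v<a. qlat t - qlat v) * (\<Prod>v<c. qlat (B + v) - qlat t)))"
  unfolding selberg_sum_def
proof (rule sum.mono_neutral_right)
  show "\<forall>S\<in>{S. S \<subseteq> {..<B} \<and> card S = y} - {S. S \<subseteq> {a..<B} \<and> card S = y}.
    vand S * vand S * (\<Prod>t\<in>S. (\<Prod>v<a. qlat t - qlat v) * (\<Prod>v<c. qlat (B + v) - qlat t)) = 0"
  proof
    fix S assume "S \<in> {S. S \<subseteq> {..<B} \<and> card S = y} - {S. S \<subseteq> {a..<B} \<and> card S = y}"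
    then have S: "S \<subseteq> {..<B}" "\<not> S \<subseteq> {a..<B}" by auto
    then obtain t where t: "t \<in> S" "t < a" by (auto simp: subset_iff)
    then have "(\<Prod>v<a. qlat t - qlat v) = 0" by (intro prod_zero) auto
    then have "(\<Prod>t\<in>S. (\<Prod>v<a. qlat t - qlat v) * (\<Prod>v<c. qlat (B + v) - qlat t)) = 0"
      using t finite_subset[OF S(1)] by (intro prod_zero) auto
    then show "vand S * vand S * (\<Prod>t\<in>S. (\<Prod>v<a. qlat t - qlat v) * (\<Prod>v<c. qlat (B + v) - qlat t)) = 0" by simp
  qed
qed (auto intro: finite_subset[of _ "Pow {..<B}"])

text \<open>The cross products of \<open>S\<close> with the two fern sets combine to a product over
  all positions outside the gap: \<open>sum_list a\<close> of them on the left and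
  \<open>sum_list b + z\<close> on the right, which are the parameters of the Selberg sum.\<close>

lemma num_tilings_H2_region:
  fixes x y z a b
  defines "L \<equiv> base_length x y a b"
  shows "real (num_tilings (H2_region x y z a b))
    = vand (fern_segs True L a b) * vand (fern_segs False L a b \<union> {L..<L + z})
      / (dent_norm (odd_sum a + odd_sum b + y) * dent_norm (even_sum a + even_sum b + z + y))
      * selberg_sum y (sum_list a) (sum_list a + x + y) (sum_list b + z)"
proof -
  define U where "U = fern_segs True L a b"
  define D where "D = fern_segs False L a b \<union> {L..<L + z}"
  define N where "N = dent_norm (odd_sum a + odd_sum b + y) * dent_norm (even_sum a + even_sum b + z + y)"
  let ?A = "sum_list a" and ?B = "sum_list a + x + y" and ?c = "sum_list b + z"
  have fern_segs_Un_Int: "U \<union> D = {..<?A} \<union> {?B..<?B + ?c}" "U \<inter> D = {}"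
    unfolding U_def D_def L_def by (rule fern_segs_Un_Int)+
  have fin: "finite U" "finite D" unfolding U_def D_def L_def by (rule card_fern_segs)+
  have "real (num_tilings (H2_region x y z a b)) = (\<Sum>S | S \<subseteq> {?A..<?B} \<and> card S = y. vand (U \<union> S) * vand (D \<union> S)) / N"
    unfolding U_def D_def N_def L_def by (rule num_tilings_sum)
  also have "(\<Sum>S | S \<subseteq> {?A..<?B} \<and> card S = y. vand (U \<union> S) * vand (D \<union> S))
    = (\<Sum>S | S \<subseteq> {?A..<?B} \<and> card S = y. vand U * vand D * (vand S * vand S *
      (\<Prod>t\<in>S. (\<Prod>v<?A. qlat t - qlat v) * (\<Prod>v<?c. qlat (?B + v) - qlat t))))"
  proof (rule sum.cong[OF refl])
    fix S assume "S \<in> {S. S \<subseteq> {?A..<?B} \<and> card S = y}"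
    then have S: "S \<subseteq> {?A..<?B}" by simp
    then have finS: "finite S" using finite_subset by blast
    have "(U \<union> D) \<inter> S = {}" unfolding fern_segs_Un_Int using S by auto
    then have "U \<inter> S = {}" "D \<inter> S = {}" by blast+
    then have "vand (U \<union> S) * vand (D \<union> S) = vand U * vand D * (vand S * vand S *
      (\<Prod>s\<in>S. (\<Prod>v\<in>U. \<bar>qlat s - qlat v\<bar>) * (\<Prod>v\<in>D. \<bar>qlat s - qlat v\<bar>)))"
      using vand_Un[OF fin(1) finS] vand_Un[OF fin(2) finS] by (simp add: prod.distrib mult_ac)
    also have "(\<Prod>s\<in>S. (\<Prod>v\<in>U. \<bar>qlat s - qlat v\<bar>) * (\<Prod>v\<in>D. \<bar>qlat s - qlat v\<bar>))
      = (\<Prod>t\<in>S. (\<Prod>v<?A. qlat t - qlat v) * (\<Prod>v<?c. qlat (?B + v) - qlat t))"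
    proof (rule prod.cong[OF refl])
      fix s assume "s \<in> S"
      then have s: "?A \<le> s" "s < ?B" using S by auto
      have "(\<Prod>v\<in>U. \<bar>qlat s - qlat v\<bar>) * (\<Prod>v\<in>D. \<bar>qlat s - qlat v\<bar>) = (\<Prod>v\<in>U \<union> D. \<bar>qlat s - qlat v\<bar>)"
        by (rule prod.union_disjoint[OF fin fern_segs_Un_Int(2), symmetric])
      also have "\<dots> = (\<Prod>v<?A. qlat s - qlat v) * (\<Prod>v<?c. qlat (?B + v) - qlat s)"
        unfolding fern_segs_Un_Int(1) by (rule prod_abs_qlat_gap[OF s])
      finally show "(\<Prod>v\<in>U. \<bar>qlat s - qlat v\<bar>) * (\<Prod>v\<in>D. \<bar>qlat s - qlat v\<bar>) = \<dots>" .
    qed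
    finally show "vand (U \<union> S) * vand (D \<union> S) = vand U * vand D * (vand S * vand S *
      (\<Prod>t\<in>S. (\<Prod>v<?A. qlat t - qlat v) * (\<Prod>v<?c. qlat (?B + v) - qlat t)))" .
  qed
  also have "\<dots> = vand U * vand D * selberg_sum y ?A ?B ?c"
    unfolding selberg_sum_gap sum_distrib_left ..
  finally show ?thesis unfolding U_def D_def N_def by simp
qed

section \<open>The sequences of the quartered hexagons\<close>

text \<open>Entry \<open>Suc N\<close> has the parity that is not selected. It can be moved into the
  middle term of a sequence: the selected segments stay where they are and only the total length has
  to be preserved. An entry beyond the end is 0.\<close>

lemma segs_take_entries:
  assumes "length v \<le> Suc N" and "odd N = r"
  shows "segs r 0 (map (entry v) [1..<N + 1]) = segs r 0 v"
    "sum_list (map (entry v) [1..<N + 1]) + entry v (Suc N) = sum_list v"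
proof -
  have eq: "map (entry v) [1..<N + 1] @ [entry v (Suc N)] = v @ replicate (Suc N - length v) 0"
    using map_entry[OF assms(1)] by simp
  from arg_cong[OF eq, of "segs r 0"] show "segs r 0 (map (entry v) [1..<N + 1]) = segs r 0 v"
    using assms(2) by (cases r) (simp_all add: segs_append del: upt_Suc)
  from arg_cong[OF eq, of sum_list] show "sum_list (map (entry v) [1..<N + 1]) + entry v (Suc N) = sum_list v"
    by (simp add: sum_list_replicate del: upt_Suc)
qed

lemma num_terms_bounds: "0 < num_terms v" "length v \<le> num_terms v"
  by (simp_all add: num_terms_def)

text \<open>The leading 0 shifts the indices of \<open>a\<close> by one, so its odd terms get even
  index. The middle term has odd index \<open>\<mu> + 1\<close>, and the odd terms of
  \<open>b\<close>, read backwards, again fall on even indices.\<close>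

lemma segs_t_plus:
  "segs False 0 (t_plus x y a b) = fern_segs True (base_length x y a b) a b"
proof -
  define M where "M = 2 * ((num_terms a + 1) div 2) - 1"
  define N where "N = 2 * ((num_terms b + 1) div 2) - 1"
  have M: "2 * ((num_terms a + 1) div 2) = Suc M" "length a \<le> Suc M" "odd M"
    using num_terms_bounds[of a] unfolding M_def by presburger+
  have N: "2 * ((num_terms b + 1) div 2) = Suc N" "length b \<le> Suc N" "odd N"
    using num_terms_bounds[of b] unfolding N_def by presburger+
  let ?A = "map (entry a) [1..<M + 1]" and ?B = "map (entry b) [1..<N + 1]"
  let ?m = "entry a (Suc M) + x + y + entry b (Suc N)"
  have A: "segs True 0 ?A = segs True 0 a" "sum_list ?A + entry a (Suc M) = sum_list a" "length ?A = M"
    using segs_take_entries[OF M(2), of True] M(3) by (simp_all del: upt_Suc)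
  have B: "segs True 0 ?B = segs True 0 b" "sum_list ?B + entry b (Suc N) = sum_list b" "length ?B = N"
    using segs_take_entries[OF N(2), of True] N(3) by (simp_all del: upt_Suc)
  have L: "sum_list ?A + ?m + 0 + sum_list ?B = base_length x y a b"
    using A(2) B(2) by (simp add: base_length_def)
  have seq: "t_plus x y a b = 0 # ?A @ ?m # rev ?B"
    unfolding t_plus_def Let_def M N by simp
  have parts: "segs False 0 (0 # ?A @ ?m # rev ?B) = segs True 0 ?A \<union> segs True (sum_list ?A + ?m) (rev ?B)"
    using M(3) A(3) by (simp add: segs_append del: upt_Suc)
  have mirror: "segs True (sum_list ?A + ?m) (rev ?B) = (\<lambda>t. sum_list ?A + ?m + 0 + sum_list ?B - 1 - t) ` segs True 0 ?B"
    using segs_rev[of "sum_list ?A + ?m" 0 ?B True] N(3) B(3) by (simp del: upt_Suc)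
  show ?thesis unfolding seq parts mirror L A(1) B(1) fern_segs_def ..
qed

lemma ceiling_half: "k > 0 \<Longrightarrow> nat \<lceil>(real k - 1) / 2\<rceil> = k div 2"
proof -
  assume "k > 0"
  have "\<lceil>(real k - 1) / 2\<rceil> = int (k div 2)"
  proof (cases "even k")
    case True
    then obtain c where "k = 2 * c" by (elim evenE)
    then show ?thesis by (simp add: ceiling_eq_iff field_simps)
  next
    case False
    then obtain c where "k = 2 * c + 1" by (elim oddE)
    then show ?thesis by simp
  qed
  then show ?thesis by simp
qed

text \<open>Without a leading 0 the even terms of \<open>a\<close> keep their parity, and the middle
  term has odd index because \<open>\<mu>'\<close> is even. The last index is even too, which makes
  \<open>z\<close> the segment behind position \<open>L\<close>.\<close>

lemma segs_t_minus:
  fixes x y z a b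
  defines "L \<equiv> base_length x y a b"
  shows "segs False 0 (t_minus x y z a b) = fern_segs False L a b \<union> {L..<L + z}"
proof -
  define M where "M = 2 * (num_terms a div 2)"
  define N where "N = 2 * (num_terms b div 2)"
  have pos: "num_terms a > 0" "num_terms b > 0" by (simp_all add: num_terms_def)
  have M: "length a \<le> Suc M" "even M"
    using num_terms_bounds[of a] unfolding M_def by presburger+
  have N: "length b \<le> Suc N" "even N"
    using num_terms_bounds[of b] unfolding N_def by presburger+
  let ?A = "map (entry a) [1..<M + 1]" and ?B = "map (entry b) [1..<N + 1]"
  let ?m = "entry a (M + 1) + x + y + entry b (N + 1)"
  have A: "segs False 0 ?A = segs False 0 a" "sum_list ?A + entry a (Suc M) = sum_list a" "length ?A = M"
    using segs_take_entries[OF M(1), of False] M(2) by (simp_all del: upt_Suc)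
  have B: "segs False 0 ?B = segs False 0 b" "sum_list ?B + entry b (Suc N) = sum_list b" "length ?B = N"
    using segs_take_entries[OF N(1), of False] N(2) by (simp_all del: upt_Suc)
  have L: "sum_list ?A + ?m + 0 + sum_list ?B = L"
    using A(2) B(2) by (simp add: L_def base_length_def)
  have seq: "t_minus x y z a b = ?A @ ?m # rev ?B @ [z]"
    unfolding t_minus_def Let_def ceiling_half[OF pos(1)] ceiling_half[OF pos(2)] M_def N_def by simp
  have parts: "segs False 0 (?A @ ?m # rev ?B @ [z]) = segs False 0 ?A \<union> (segs True (sum_list ?A + ?m) (rev ?B)
      \<union> segs True (sum_list ?A + ?m + 0 + sum_list ?B) [z])"
    using M(2) A(3) N(2) B(3) by (simp add: segs_append sum_list_rev del: upt_Suc)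
  have mirror: "segs True (sum_list ?A + ?m) (rev ?B) = (\<lambda>t. sum_list ?A + ?m + 0 + sum_list ?B - 1 - t) ` segs False 0 ?B"
    using segs_rev[of "sum_list ?A + ?m" 0 ?B False] N(2) B(3) by (simp del: upt_Suc)
  show ?thesis unfolding seq parts mirror L A(1) B(1) fern_segs_def by auto
qed

lemma hyperfact2_even: "hyperfact2 (2 * n) = dent_norm n"
proof -
  have "hyperfact2 (2 * n) = (\<Prod>i<n. fact (2 * n - 2 * Suc i))"
    unfolding hyperfact2_def by (rule prod.reindex_bij_witness[of _ Suc "\<lambda>i. i - 1"]) auto
  also have "\<dots> = (\<Prod>i<n. fact (2 * (n - Suc i)))" by (simp add: diff_mult_distrib2)
  also have "\<dots> = dent_norm n" unfolding dent_norm_def by (rule prod.nat_diff_reindex)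
  finally show ?thesis .
qed

lemma selberg_sum_no_points: "selberg_sum 0 a B c = 1"
proof -
  have "{S. S \<subseteq> {..<B} \<and> card S = 0} = {{}}" using finite_subset by fastforce
  then show ?thesis by (simp add: selberg_sum_def vand_def)
qed

theorem theorem2p5:
  fixes x y z :: nat and a b :: "nat list"
  shows
    "num_tilings (H2_region y 0 z a b) \<noteq> 0 \<and>
     real (num_tilings (H2_region x y z a b)) =
       real (num_tilings (H2_region (x + y) 0 z a b)) * real (num_tilings (H2_region 0 y z a b))
         / real (num_tilings (H2_region y 0 z a b))
       * ((T_prod (real x + 1) (2 * sum_list a + sum_list b + 2 * y + z - 1) y
           * V_prod (2 * real x + 2 * real (sum_list a) + 3) (sum_list b + 2 * y + z - 2) y)
          / (T_prod 1 (2 * sum_list a + sum_list b + 2 * y + z - 1) y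
           * V_prod (2 * real (sum_list a) + 3) (sum_list b + 2 * y + z - 2) y)) \<and>
     real (num_tilings (H2_region x y z a b)) =
       real (K_count (t_plus x y a b)) * real (K_count (t_minus x y z a b))
       * (odd_double_fact (sum_list a) / odd_double_fact (sum_list a + y))
       * ((hyperfact2 (2 * odd_sum a + 2 * odd_sum b)
           * hyperfact2 (2 * even_sum a + 2 * even_sum b + 2 * z))
          / (hyperfact2 (2 * odd_sum a + 2 * odd_sum b + 2 * y)
           * hyperfact2 (2 * even_sum a + 2 * even_sum b + 2 * y + 2 * z)))
       * ((hyperfact (2 * sum_list a + sum_list b + 2 * y + z) * hyperfact (sum_list b + y + z))
          / (hyperfact (2 * sum_list a + sum_list b + y + z) * hyperfact (sum_list b + z)))
       * ((T_prod (real x + 1) (2 * sum_list a + sum_list b + 2 * y + z - 1) y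
           * V_prod (2 * real x + 2 * real (sum_list a) + 3) (sum_list b + 2 * y + z - 2) y)
          / (T_prod 1 (2 * sum_list a + sum_list b + 2 * y + z - 1) y
           * V_prod (2 * real (sum_list a) + 3) (sum_list b + 2 * y + z - 2) y))"
proof -
  define od ev where "od = odd_sum a + odd_sum b" and "ev = even_sum a + even_sum b + z"
  define U where "U x y = vand (fern_segs True (base_length x y a b) a b)" for x y
  define D where "D x y = vand (fern_segs False (base_length x y a b) a b
      \<union> {base_length x y a b..<base_length x y a b + z})" for x y
  define Sel where "Sel x = selberg_sum y (sum_list a) (sum_list a + x + y) (sum_list b + z)" for x
  define TV where "TV = (T_prod (real x + 1) (2 * sum_list a + sum_list b + 2 * y + z - 1) y
           * V_prod (2 * real x + 2 * real (sum_list a) + 3) (sum_list b + 2 * y + z - 2) y)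
          / (T_prod 1 (2 * sum_list a + sum_list b + 2 * y + z - 1) y
           * V_prod (2 * real (sum_list a) + 3) (sum_list b + 2 * y + z - 2) y)"
  define H where "H = (hyperfact (2 * sum_list a + sum_list b + 2 * y + z) * hyperfact (sum_list b + y + z))
          / (hyperfact (2 * sum_list a + sum_list b + y + z) * hyperfact (sum_list b + z))"
  define F where "F = odd_double_fact (sum_list a) / odd_double_fact (sum_list a + y)"
  have args: "2 * sum_list a + (sum_list b + z) + 2 * y = 2 * sum_list a + sum_list b + 2 * y + z"
    "2 * sum_list a + (sum_list b + z) + y = 2 * sum_list a + sum_list b + y + z"
    "sum_list b + z + y = sum_list b + y + z" "sum_list b + z + 2 * y = sum_list b + 2 * y + z" by simp_all
  have Sel: "Sel x = F * H * TV"
    unfolding Sel_def selberg_sum_eq args F_def H_def TV_def ..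
  have Sel0: "Sel 0 = F * H"
    unfolding Sel_def add_0_right selberg_sum_0 args F_def H_def ..
  have pos: "U x y > 0" "D x y > 0" for x y
    unfolding U_def D_def by (auto intro!: vand_pos simp: fern_segs_def)
  have npos: "dent_norm n > 0" for n by (rule dent_norm_pos)
  have M: "real (num_tilings (H2_region x' y z a b)) = U x' y * D x' y / (dent_norm (od + y) * dent_norm (ev + y)) * Sel x'" for x'
    unfolding num_tilings_H2_region U_def D_def Sel_def od_def ev_def ..
  have M0: "real (num_tilings (H2_region x' 0 z a b)) = U x' 0 * D x' 0 / (dent_norm od * dent_norm ev)" for x'
    unfolding num_tilings_H2_region U_def D_def od_def ev_def by (simp add: selberg_sum_no_points)
  \<comment> \<open>The ferns see \<open>x\<close> and \<open>y\<close> only through the base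
    length. So the fern factors of \<open>(x + y, 0)\<close> are those of \<open>(x, y)\<close>, and
    the ones of \<open>(y, 0)\<close> are those of \<open>(0, y)\<close>.\<close>
  have bl: "base_length (x' + y) 0 a b = base_length x' y a b" for x' by (simp add: base_length_def)
  have shift: "U (x' + y) 0 = U x' y" "D (x' + y) 0 = D x' y" for x'
    unfolding U_def D_def bl by simp_all
  note shift0 = shift[of 0, simplified]
  have ne: "num_tilings (H2_region y 0 z a b) \<noteq> 0"
  proof -
    have "real (num_tilings (H2_region y 0 z a b)) > 0"
      unfolding M0 by (intro divide_pos_pos mult_pos_pos pos npos)
    then show ?thesis by simp
  qed
  have K: "real (K_count (t_plus x y a b)) = U x y / dent_norm od"
    "real (K_count (t_minus x y z a b)) = D x y / dent_norm ev"
    unfolding K_count_eq segs_t_plus segs_t_minus card_fern_segs U_def D_def od_def ev_def by simp_all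
  have h: "hyperfact2 (2 * odd_sum a + 2 * odd_sum b) = dent_norm od"
    "hyperfact2 (2 * even_sum a + 2 * even_sum b + 2 * z) = dent_norm ev"
    "hyperfact2 (2 * odd_sum a + 2 * odd_sum b + 2 * y) = dent_norm (od + y)"
    "hyperfact2 (2 * even_sum a + 2 * even_sum b + 2 * y + 2 * z) = dent_norm (ev + y)"
    unfolding hyperfact2_even[symmetric] od_def ev_def by (simp_all add: algebra_simps)
  have nz: "dent_norm n \<noteq> 0" for n using npos[of n] by simp
  have nz': "U x y \<noteq> 0" "D x y \<noteq> 0" for x y using pos[of x y] by simp_all
  \<comment> \<open>By \<open>shift\<close> the quotient of the three counts has the fern factors of
    \<open>(x, y)\<close>, the normalisation for \<open>y\<close> crossing lozenges and the Selberg
    sum at \<open>x = 0\<close>; only \<open>TV\<close>, the ratio \<open>Sel x / Sel 0\<close>, is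
    missing.\<close>
  have one: "real (num_tilings (H2_region x y z a b)) =
       real (num_tilings (H2_region (x + y) 0 z a b)) * real (num_tilings (H2_region 0 y z a b))
         / real (num_tilings (H2_region y 0 z a b)) * TV"
    unfolding M M0 shift shift0 Sel Sel0 using nz nz' by (simp add: field_simps)
  have two: "real (num_tilings (H2_region x y z a b)) =
       real (K_count (t_plus x y a b)) * real (K_count (t_minus x y z a b)) * F
       * ((dent_norm od * dent_norm ev) / (dent_norm (od + y) * dent_norm (ev + y))) * H * TV"
    unfolding M K Sel using nz by (simp add: field_simps)
  show ?thesis
    using ne one two unfolding h F_def H_def TV_def by blast
qed

end
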